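(* Let $K$ be the Sierpiński gasket. There exists a self-similar strongly local regular Dirichlet form $(\mathcal{E}_{\mathrm{loc}},\mathcal{F}_{\mathrm{loc}})$ on $L^2(K;\nu)$ such that $$\mathcal{F}_{\mathrm{loc}}=\left\{u\in L^2(K;\nu):\sup_{n\ge1}\left(\tfrac53\right)^n\sum_{w^{(1)}\sim_n w^{(2)}}\left(P_nu(w^{(1)})-P_nu(w^{(2)})\right)^2<+\infty\right\}$$ and, for all $u\in\mathcal{F}_{\mathrm{loc}}$, $$\mathcal{E}_{\mathrm{loc}}(u,u)\asymp\sup_{n\ge1}\left(\tfrac53\right)^n\sum_{w^{(1)}\sim_n w^{(2)}}\left(P_nu(w^{(1)})-P_nu(w^{(2)})\right)^2,$$ that is, the ratio of the two sides is bounded above and below by positive constants independent of $u$.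
   Context: Sierpiński gasket: let $p_0=(0,0)$, $p_1=(1,0)$, $p_2=(\frac12,\frac{\sqrt3}{2})$ and $f_i(x)=(x+p_i)/2$ for $x\in\mathbb{R}^2$, $i=0,1,2$. $K$ is the unique non-empty compact set with $K=\bigcup_{i=0}^2 f_i(K)$, with the Euclidean metric, and $\nu$ is the normalized Hausdorff measure on $K$ of dimension $\alpha=\log3/\log2$. For $n\ge1$, $W_n=\{0,1,2\}^n$; for $w=w_1\ldots w_n\in W_n$, $f_w=f_{w_1}\circ\cdots\circ f_{w_n}$ and $K_w=f_w(K)$. For $w^{(1)},w^{(2)}\in W_n$, write $w^{(1)}\sim_n w^{(2)}$ if $w^{(1)}\ne w^{(2)}$ and $K_{w^{(1)}}\cap K_{w^{(2)}}\neq\emptyset$. For $u\in L^2(K;\nu)$, $P_nu(w)=\frac{1}{\nu(K_w)}\int_{K_w}u\,d\nu$, $w\in W_n$. A Dirichlet form $(\mathcal{E},\mathcal{F})$ on $L^2(K;\nu)$ is strongly local if $\mathcal{E}(u,v)=0$ for all $u,v\in\mathcal{F}$ with compact supports such that $v$ is constant in an open neighborhood of $\mathrm{supp}(u)$. It is self-similar if $u\circ f_i\in\mathcal{F}$ for all $u\in\mathcal{F}$ and all $i$, and there is a constant $r>0$ such that $\mathcal{E}(u,u)=r\sum_{i}\mathcal{E}(u\circ f_i,u\circ f_i)$ for all $u\in\mathcal{F}$. Regular means $\mathcal{F}\cap C(K)$ is dense in $\mathcal{F}$ for the norm $(\mathcal{E}(u,u)+\|u\|_2^2)^{1/2}$ and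 uniformly dense in $C(K)$. *)

theory Defs
  imports "HOL-Analysis.Analysis"
begin

section \<open>Hausdorff measure\<close>

text \<open>
  Only dimensions \<open>s > 0\<close> are intended: then \<open>0 powr s = 0\<close>, so empty covering sets are
  harmless. Boundedness is required explicitly because the library's \<open>diameter\<close> is a
  real-valued supremum, meaningless on unbounded sets.
\<close>

definition hausdorff_content :: "real \<Rightarrow> real \<Rightarrow> 'a::metric_space set \<Rightarrow> ennreal" where
  "hausdorff_content s \<delta> A =
     (INF U \<in> {U :: nat \<Rightarrow> 'a set. A \<subseteq> (\<Union>i. U i) \<and> (\<forall>i. bounded (U i) \<and> diameter (U i) \<le> \<delta>)}.
        \<Sum>i. ennreal (diameter (U i) powr s))"

definition hausdorff_outer :: "real \<Rightarrow> 'a::metric_space set \<Rightarrow> ennreal" where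
  "hausdorff_outer s A = (SUP \<delta> \<in> {0<..}. hausdorff_content s \<delta> A)"

text \<open>
  The Hausdorff outer measure is a metric outer measure, hence countably additive on Borel sets, so
  \<open>measure_of\<close> does not fall back to the zero measure.
\<close>

definition hausdorff_measure :: "real \<Rightarrow> 'a::metric_space measure" where
  "hausdorff_measure s = measure_of UNIV (sets borel) (hausdorff_outer s)"

section \<open>Dirichlet forms\<close>

text \<open>
  Elements of \<open>L\<^sup>2\<close> are represented by functions; only values on \<open>space M\<close> matter. A domain is a set
  of functions that is saturated under almost-everywhere equality, and a form has to respect that
  equality.
\<close>

definition L2 :: "'a measure \<Rightarrow> ('a \<Rightarrow> real) set" where
  "L2 M = {u. u \<in> borel_measurable M \<and> integrable M (\<lambda>x. (u x)\<^sup>2)}"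

definition ae_eq :: "'a measure \<Rightarrow> ('a \<Rightarrow> real) \<Rightarrow> ('a \<Rightarrow> real) \<Rightarrow> bool" where
  "ae_eq M u v \<longleftrightarrow> (AE x in M. u x = v x)"

definition L2_norm2 :: "'a measure \<Rightarrow> ('a \<Rightarrow> real) \<Rightarrow> real" where
  "L2_norm2 M u = (\<integral>x. (u x)\<^sup>2 \<partial>M)"

definition E1_norm :: "'a measure \<Rightarrow> (('a \<Rightarrow> real) \<Rightarrow> ('a \<Rightarrow> real) \<Rightarrow> real) \<Rightarrow> ('a \<Rightarrow> real) \<Rightarrow> real" where
  "E1_norm M E u = sqrt (E u u + L2_norm2 M u)"

text \<open>A densely defined, non-negative, symmetric bilinear form on \<open>L\<^sup>2\<close>.\<close>

definition symmetric_form ::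
  "'a measure \<Rightarrow> ('a \<Rightarrow> real) set \<Rightarrow> (('a \<Rightarrow> real) \<Rightarrow> ('a \<Rightarrow> real) \<Rightarrow> real) \<Rightarrow> bool" where
  "symmetric_form M F E \<longleftrightarrow>
     F \<subseteq> L2 M \<and>
     (\<forall>u\<in>F. \<forall>v\<in>L2 M. ae_eq M u v \<longrightarrow> v \<in> F) \<and>
     (\<lambda>x. 0) \<in> F \<and>
     (\<forall>u\<in>F. \<forall>v\<in>F. (\<lambda>x. u x + v x) \<in> F) \<and>
     (\<forall>c. \<forall>u\<in>F. (\<lambda>x. c * u x) \<in> F) \<and>
     (\<forall>u\<in>L2 M. \<forall>\<epsilon>>0. \<exists>v\<in>F. L2_norm2 M (\<lambda>x. u x - v x) < \<epsilon>) \<and>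
     (\<forall>u\<in>F. \<forall>u'\<in>F. \<forall>v\<in>F. ae_eq M u u' \<longrightarrow> E u v = E u' v) \<and>
     (\<forall>u\<in>F. \<forall>v\<in>F. E u v = E v u) \<and>
     (\<forall>u\<in>F. \<forall>v\<in>F. \<forall>w\<in>F. E (\<lambda>x. u x + v x) w = E u w + E v w) \<and>
     (\<forall>c. \<forall>u\<in>F. \<forall>v\<in>F. E (\<lambda>x. c * u x) v = c * E u v) \<and>
     (\<forall>u\<in>F. E u u \<ge> 0)"

definition closed_form ::
  "'a measure \<Rightarrow> ('a \<Rightarrow> real) set \<Rightarrow> (('a \<Rightarrow> real) \<Rightarrow> ('a \<Rightarrow> real) \<Rightarrow> real) \<Rightarrow> bool" where
  "closed_form M F E \<longleftrightarrow>
     (\<forall>u :: nat \<Rightarrow> 'a \<Rightarrow> real.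
        (\<forall>n. u n \<in> F) \<and>
        (\<forall>\<epsilon>>0. \<exists>N. \<forall>m\<ge>N. \<forall>n\<ge>N. E1_norm M E (\<lambda>x. u m x - u n x) < \<epsilon>) \<longrightarrow>
        (\<exists>v\<in>F. (\<lambda>n. E1_norm M E (\<lambda>x. u n x - v x)) \<longlonglongrightarrow> 0))"

definition markovian_form ::
  "('a \<Rightarrow> real) set \<Rightarrow> (('a \<Rightarrow> real) \<Rightarrow> ('a \<Rightarrow> real) \<Rightarrow> real) \<Rightarrow> bool" where
  "markovian_form F E \<longleftrightarrow>
     (\<forall>u\<in>F. (\<lambda>x. min (max (u x) 0) 1) \<in> F \<and>
        E (\<lambda>x. min (max (u x) 0) 1) (\<lambda>x. min (max (u x) 0) 1) \<le> E u u)"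

definition dirichlet_form ::
  "'a measure \<Rightarrow> ('a \<Rightarrow> real) set \<Rightarrow> (('a \<Rightarrow> real) \<Rightarrow> ('a \<Rightarrow> real) \<Rightarrow> real) \<Rightarrow> bool" where
  "dirichlet_form M F E \<longleftrightarrow> symmetric_form M F E \<and> closed_form M F E \<and> markovian_form F E"

text \<open>
  Regularity for a compact underlying space \<open>space M\<close>, where all continuous functions have compact
  support.
\<close>

definition regular_form ::
  "'a::topological_space measure \<Rightarrow> ('a \<Rightarrow> real) set \<Rightarrow>
     (('a \<Rightarrow> real) \<Rightarrow> ('a \<Rightarrow> real) \<Rightarrow> real) \<Rightarrow> bool" where
  "regular_form M F E \<longleftrightarrow>
     (\<forall>u\<in>F. \<forall>\<epsilon>>0. \<exists>v\<in>F. continuous_on (space M) v \<and> E1_norm M E (\<lambda>x. u x - v x) < \<epsilon>) \<and>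
     (\<forall>g. continuous_on (space M) g \<longrightarrow>
        (\<forall>\<epsilon>>0. \<exists>v\<in>F. continuous_on (space M) v \<and> (\<forall>x\<in>space M. \<bar>g x - v x\<bar> < \<epsilon>)))"

text \<open>
  The support of a class \<open>u\<close> is that of the measure \<open>|u| M\<close>: the complement in \<open>space M\<close> of the
  largest relatively open set on which \<open>u\<close> vanishes almost everywhere.
\<close>

definition ess_support :: "'a::topological_space measure \<Rightarrow> ('a \<Rightarrow> real) \<Rightarrow> 'a set" where
  "ess_support M u = space M - \<Union>{U. open U \<and> (AE x in M. x \<in> U \<longrightarrow> u x = 0)}"

definition strongly_local ::
  "'a::topological_space measure \<Rightarrow> ('a \<Rightarrow> real) set \<Rightarrow>
     (('a \<Rightarrow> real) \<Rightarrow> ('a \<Rightarrow> real) \<Rightarrow> real) \<Rightarrow> bool" where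
  "strongly_local M F E \<longleftrightarrow>
     (\<forall>u\<in>F. \<forall>v\<in>F. compact (ess_support M u) \<and> compact (ess_support M v) \<and>
        (\<exists>U c. open U \<and> ess_support M u \<subseteq> U \<and> (AE x in M. x \<in> U \<longrightarrow> v x = c)) \<longrightarrow>
        E u v = 0)"

section \<open>The Sierpinski gasket\<close>

definition sg_vertex :: "nat \<Rightarrow> real^2" where
  "sg_vertex i = (if i = 0 then vector [0, 0]
                  else if i = 1 then vector [1, 0]
                  else vector [1/2, sqrt 3 / 2])"

definition sg_map :: "nat \<Rightarrow> real^2 \<Rightarrow> real^2" where
  "sg_map i x = (1/2) *\<^sub>R (x + sg_vertex i)"

text \<open>The attractor exists and is unique by Hutchinson's theorem.\<close>

definition gasket :: "(real^2) set" where
  "gasket = (THE K. compact K \<and> K \<noteq> {} \<and> K = (\<Union>i\<in>{0,1,2}. sg_map i ` K))"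

definition words :: "nat \<Rightarrow> nat list set" where
  "words n = {w. length w = n \<and> set w \<subseteq> {0,1,2}}"

definition word_map :: "nat list \<Rightarrow> real^2 \<Rightarrow> real^2" where
  "word_map w = foldr (\<circ>) (map sg_map w) id"

definition cell :: "nat list \<Rightarrow> (real^2) set" where
  "cell w = word_map w ` gasket"

definition adjacent :: "nat list \<Rightarrow> nat list \<Rightarrow> bool" where
  "adjacent v w \<longleftrightarrow> v \<noteq> w \<and> cell v \<inter> cell w \<noteq> {}"

definition sg_measure :: "(real^2) measure" where
  "sg_measure =
     (let H = hausdorff_measure (ln 3 / ln 2)
      in scale_measure (1 / emeasure H gasket) (restrict_space H gasket))"

definition cell_average :: "(real^2 \<Rightarrow> real) \<Rightarrow> nat list \<Rightarrow> real" where
  "cell_average u w = (1 / measure sg_measure (cell w)) * (LINT x:cell w|sg_measure. u x)"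

text \<open>The sum is over ordered pairs of words, so every adjacent pair is counted twice.\<close>

definition discrete_energy :: "nat \<Rightarrow> (real^2 \<Rightarrow> real) \<Rightarrow> real" where
  "discrete_energy n u =
     (\<Sum>(v, w) \<in> {(v, w). v \<in> words n \<and> w \<in> words n \<and> adjacent v w}.
        (cell_average u v - cell_average u w)\<^sup>2)"

definition sup_energy :: "(real^2 \<Rightarrow> real) \<Rightarrow> ennreal" where
  "sup_energy u = (SUP n \<in> {1..}. ennreal ((5/3) ^ n * discrete_energy n u))"

definition self_similar ::
  "(real^2 \<Rightarrow> real) set \<Rightarrow> ((real^2 \<Rightarrow> real) \<Rightarrow> (real^2 \<Rightarrow> real) \<Rightarrow> real) \<Rightarrow> bool" where
  "self_similar F E \<longleftrightarrow>
     (\<forall>u\<in>F. \<forall>i\<in>{0,1,2}. u \<circ> sg_map i \<in> F) \<and>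
     (\<exists>r>0. \<forall>u\<in>F. E u u = r * (\<Sum>i\<in>{0,1,2}. E (u \<circ> sg_map i) (u \<circ> sg_map i)))"

end

(*
  Everything is expressed through words. The means of an L2 function over the cells form a function A
  on words with A w the average of its three children, and adjacency of cells has a symbolic
  description, so the energies in the theorem become sums over words. If they are bounded, the means
  along w, w i, w i i, ... converge to a vertex value T w i, the vertex values are compatible, and
  their energies (5/3)^n * sum_w sum_(i<j) (T w i - T w j)^2 are bounded. These vertex energies increase
  with n and control oscillations, so T extends to a continuous function, which has the same means as
  the given function and therefore represents it. Conversely, vertex energies bound the energies of
  the means. The form is the limit of the polarized vertex energies of the continuous representatives;
  its properties are inherited from the discrete forms, with harmonic splines providing regularity.
*)

theory Submission
  imports Defs
begin

subsection \<open>The Hausdorff outer measure\<close>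

text \<open>Why vertex values besides means: a supremum of quadratic forms is in general not
  quadratic. The factor 5/3 compensates exactly the energy lost when one triangle is refined
  harmonically, and any other refinement costs more. So the vertex energies increase, and their
  limit is both their supremum and a quadratic form. A mean over a cell feels all scales inside that
  cell. It can be compared with a vertex value only through the limit of the energies inside the
  cell, not through the energy of its own level; these limits still add up to the total energy. In
  the other direction the increments along w, w i, w i i, ... have sums of squares of order
  (3/5)^(n+m) over the words of length n. Weights (4/3)^m in the Cauchy-Schwarz inequality leave a
  convergent series of ratio 4/5 and keep the rate (3/5)^n, which the factor (5/3)^n must cancel.
  The normalization of the measure is meaningful only if the Hausdorff measure of the gasket is
  positive and finite. Finiteness is a direct covering; positivity needs a count of the cells that a
  small set can meet.\<close>

lemma hausdorff_content_le:
  assumes "A \<subseteq> (\<Union>i. U i)" "\<And>i. bounded (U i)" "\<And>i. diameter (U i) \<le> \<delta>"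
  shows "hausdorff_content s \<delta> A \<le> (\<Sum>i::nat. ennreal (diameter (U i) powr s))"
  unfolding hausdorff_content_def using assms by (intro INF_lower) auto

lemma hausdorff_content_mono: "A \<subseteq> B \<Longrightarrow> hausdorff_content s \<delta> A \<le> hausdorff_content s \<delta> B"
  unfolding hausdorff_content_def by (intro INF_superset_mono) auto

lemma hausdorff_content_antimono: "\<delta> \<le> \<epsilon> \<Longrightarrow> hausdorff_content s \<epsilon> A \<le> hausdorff_content s \<delta> A"
  unfolding hausdorff_content_def by (intro INF_superset_mono) (auto intro: order_trans)

lemma hausdorff_content_cover:
  fixes A :: "'a::metric_space set"
  assumes "hausdorff_content s \<delta> A < c"
  obtains U :: "nat \<Rightarrow> 'a set" where "A \<subseteq> (\<Union>i. U i)" "\<And>i. bounded (U i)"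
    "\<And>i. diameter (U i) \<le> \<delta>" "(\<Sum>i. ennreal (diameter (U i) powr s)) < c"
  using assms unfolding hausdorff_content_def INF_less_iff by auto

text \<open>Covers of the \<open>A i\<close> that are optimal up to e / 2^(i+1) are merged into one
  sequence by the pairing \<open>prod_decode\<close>; no set is enlarged, so the bound \<delta> on
  the diameters survives.\<close>

lemma hausdorff_content_countably_subadditive:
  fixes A :: "nat \<Rightarrow> 'a::metric_space set"
  shows "hausdorff_content s \<delta> (\<Union>i. A i) \<le> (\<Sum>i. hausdorff_content s \<delta> (A i))"
proof (rule ennreal_le_epsilon)
  fix e :: real assume fin: "(\<Sum>i. hausdorff_content s \<delta> (A i)) < top" and e: "0 < e"
  have lt: "hausdorff_content s \<delta> (A i) < hausdorff_content s \<delta> (A i) + e * (1/2) ^ Suc i" for i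
  proof -
    have "hausdorff_content s \<delta> (A i) < top"
      by (rule ennreal_suminf_lessD[OF fin])
    then obtain r where "hausdorff_content s \<delta> (A i) = ennreal r" "0 \<le> r"
      by (cases "hausdorff_content s \<delta> (A i)") auto
    thus ?thesis using e by (simp add: ennreal_less_iff flip: ennreal_plus)
  qed
  have "\<exists>U. A i \<subseteq> (\<Union>j. U j) \<and> (\<forall>j. bounded (U j)) \<and> (\<forall>j. diameter (U j) \<le> \<delta>) \<and>
     (\<Sum>j::nat. ennreal (diameter (U j) powr s)) < hausdorff_content s \<delta> (A i) + e * (1/2) ^ Suc i" for i
    by (rule hausdorff_content_cover[OF lt[of i]]) blast
  then obtain U where U: "\<And>i. A i \<subseteq> (\<Union>j. U i j)" "\<And>i j. bounded (U i j)"
      "\<And>i j. diameter (U i j) \<le> \<delta>"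
      "\<And>i. (\<Sum>j::nat. ennreal (diameter (U i j) powr s)) < hausdorff_content s \<delta> (A i) + e * (1/2) ^ Suc i"
    by metis
  let ?V = "\<lambda>n. case_prod U (prod_decode n)"
  have "hausdorff_content s \<delta> (\<Union>i. A i) \<le> (\<Sum>n. ennreal (diameter (?V n) powr s))"
  proof (rule hausdorff_content_le)
    show "(\<Union>i. A i) \<subseteq> (\<Union>n. ?V n)"
    proof
      fix x assume "x \<in> (\<Union>i. A i)"
      then obtain i j where "x \<in> U i j" using U(1) by blast
      hence "x \<in> ?V (prod_encode (i, j))" by simp
      thus "x \<in> (\<Union>n. ?V n)" by (rule UN_I[OF UNIV_I])
    qed
  qed (use U in \<open>auto split: prod.split\<close>)
  also have "\<dots> = (\<Sum>i. \<Sum>j. ennreal (diameter (U i j) powr s))"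
    by (rule suminf_ennreal_2dimen[where f="\<lambda>p. ennreal (diameter (case_prod U p) powr s)"])
       (simp only: prod.case)
  also have "\<dots> \<le> (\<Sum>i. hausdorff_content s \<delta> (A i) + e * (1/2) ^ Suc i)"
    using U(4) by (intro suminf_le) (auto intro: less_imp_le)
  also have "... = (\<Sum>i. hausdorff_content s \<delta> (A i)) + (\<Sum>n. ennreal e * ennreal ((1/2) ^ Suc n))"
    using e by (subst suminf_add[symmetric])
               (auto simp del: ennreal_suminf_cmult simp add: ennreal_mult[symmetric])
  also have "\<dots> = (\<Sum>i. hausdorff_content s \<delta> (A i)) + e"
    unfolding ennreal_suminf_cmult
    by (subst suminf_ennreal_eq[OF zero_le_power power_half_series]) auto
  finally show "hausdorff_content s \<delta> (\<Union>i. A i) \<le> (\<Sum>i. hausdorff_content s \<delta> (A i)) + e" .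
qed

lemma hausdorff_content_le_outer: "0 < \<delta> \<Longrightarrow> hausdorff_content s \<delta> A \<le> hausdorff_outer s A"
  unfolding hausdorff_outer_def by (intro SUP_upper) auto

lemma hausdorff_outer_mono: "A \<subseteq> B \<Longrightarrow> hausdorff_outer s A \<le> hausdorff_outer s B"
  unfolding hausdorff_outer_def by (intro SUP_mono') (auto intro: hausdorff_content_mono)

lemma hausdorff_outer_countably_subadditive:
  "hausdorff_outer s (\<Union>i::nat. A i) \<le> (\<Sum>i. hausdorff_outer s (A i))"
  unfolding hausdorff_outer_def[of s "\<Union>i. A i"]
  by (intro SUP_least order_trans[OF hausdorff_content_countably_subadditive] suminf_le)
     (auto intro: hausdorff_content_le_outer)

text \<open>A singleton covers itself, and \<open>0 powr s = 0\<close>. This later makes the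
  overlaps of cells null sets.\<close>

lemma hausdorff_outer_finite:
  assumes "finite A"
  shows "hausdorff_outer s (A :: 'a::metric_space set) = 0"
proof -
  have sing: "hausdorff_outer s B \<le> 0" if B: "B \<subseteq> {x}" for B :: "'a set" and x
    unfolding hausdorff_outer_def
  proof (rule SUP_least)
    fix \<delta> :: real assume "\<delta> \<in> {0<..}"
    hence "hausdorff_content s \<delta> B \<le> (\<Sum>i::nat. ennreal (diameter {x} powr s))"
      using B by (intro hausdorff_content_le) auto
    thus "hausdorff_content s \<delta> B \<le> 0" by simp
  qed
  obtain f where f: "A \<subseteq> range (f :: nat \<Rightarrow> 'a)"
  proof (cases "A = {}")
    case False
    thus ?thesis using that range_from_nat_into[OF False] countable_finite[OF assms] by blast
  qed (use that in auto)
  have "A \<subseteq> (\<Union>i. {f i})" using f by auto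
  hence "hausdorff_outer s A \<le> (\<Sum>i. hausdorff_outer s {f i})"
    by (rule order_trans[OF hausdorff_outer_mono hausdorff_outer_countably_subadditive])
  also have "\<dots> = 0" using sing by simp
  finally show ?thesis by simp
qed

lemma hausdorff_outer_Un: "hausdorff_outer s (A \<union> B) \<le> hausdorff_outer s A + hausdorff_outer s B"
proof -
  have eq: "A \<union> B = (\<Union>i::nat. (if i = 0 then A else if i = 1 then B else {}))"
    by (auto split: if_splits)
  have "hausdorff_outer s (A \<union> B) \<le> (\<Sum>i::nat. hausdorff_outer s (if i = 0 then A else if i = 1 then B else {}))"
    unfolding eq by (rule hausdorff_outer_countably_subadditive)
  also have "\<dots> = (\<Sum>i<2::nat. hausdorff_outer s (if i = 0 then A else if i = 1 then B else {}))"
    by (intro suminf_finite) (auto simp: hausdorff_outer_finite)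
  finally show ?thesis by (simp add: numeral_2_eq_2)
qed

text \<open>A set of diameter at most \<delta> < d cannot meet both \<open>A\<close> and
  \<open>B\<close>, so every cover of the union splits into a cover of \<open>A\<close> and a cover
  of \<open>B\<close>, with the remaining members replaced by the empty set.\<close>

lemma hausdorff_content_metric:
  assumes d: "\<And>x y. x \<in> A \<Longrightarrow> y \<in> B \<Longrightarrow> d \<le> dist x y" and \<delta>: "0 < \<delta>" "\<delta> < d"
  shows "hausdorff_content s \<delta> A + hausdorff_content s \<delta> B \<le> hausdorff_content s \<delta> (A \<union> B)"
  unfolding hausdorff_content_def[of _ _ "A \<union> B"]
proof (rule INF_greatest)
  fix U :: "nat \<Rightarrow> 'a set"
  assume "U \<in> {U. A \<union> B \<subseteq> (\<Union>i. U i) \<and> (\<forall>i. bounded (U i) \<and> diameter (U i) \<le> \<delta>)}"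
  hence U: "A \<union> B \<subseteq> (\<Union>i. U i)" "\<And>i. bounded (U i)" "\<And>i. diameter (U i) \<le> \<delta>" by auto
  define V where "V i = (if U i \<inter> A \<noteq> {} then U i else {})" for i
  define W where "W i = (if U i \<inter> A \<noteq> {} then {} else U i)" for i
  have "hausdorff_content s \<delta> A \<le> (\<Sum>i. ennreal (diameter (V i) powr s))"
  proof (rule hausdorff_content_le)
    show "A \<subseteq> (\<Union>i. V i)"
    proof
      fix x assume "x \<in> A"
      moreover from this obtain i where "x \<in> U i" using U(1) by blast
      ultimately have "x \<in> V i" by (auto simp: V_def)
      thus "x \<in> (\<Union>i. V i)" by blast
    qed
  qed (use U \<delta> in \<open>auto simp: V_def\<close>)
  moreover have "hausdorff_content s \<delta> B \<le> (\<Sum>i. ennreal (diameter (W i) powr s))"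
  proof (rule hausdorff_content_le)
    show "B \<subseteq> (\<Union>i. W i)"
    proof
      fix y assume y: "y \<in> B"
      then obtain i where i: "y \<in> U i" using U(1) by blast
      have "U i \<inter> A = {}"
      proof (rule ccontr)
        assume "U i \<inter> A \<noteq> {}"
        then obtain x where "x \<in> U i" "x \<in> A" by blast
        hence "d \<le> dist x y" "dist x y \<le> \<delta>"
          using d y diameter_bounded_bound[OF U(2), of x i y] i U(3)[of i] by auto
        thus False using \<delta> by linarith
      qed
      hence "y \<in> W i" using i by (simp add: W_def)
      thus "y \<in> (\<Union>i. W i)" by blast
    qed
  qed (use U \<delta> in \<open>auto simp: W_def\<close>)
  ultimately have "hausdorff_content s \<delta> A + hausdorff_content s \<delta> B \<le>
     (\<Sum>i. ennreal (diameter (V i) powr s)) + (\<Sum>i. ennreal (diameter (W i) powr s))"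
    by (rule add_mono)
  also have "\<dots> = (\<Sum>i. ennreal (diameter (V i) powr s) + ennreal (diameter (W i) powr s))"
    by (intro suminf_add) auto
  also have "\<dots> = (\<Sum>i. ennreal (diameter (U i) powr s))"
    by (intro suminf_cong) (auto simp: V_def W_def)
  finally show "hausdorff_content s \<delta> A + hausdorff_content s \<delta> B \<le> (\<Sum>i. ennreal (diameter (U i) powr s))" .
qed

lemma hausdorff_outer_metric:
  assumes d: "\<And>x y. x \<in> A \<Longrightarrow> y \<in> B \<Longrightarrow> d \<le> dist x y" and "0 < d"
  shows "hausdorff_outer s A + hausdorff_outer s B \<le> hausdorff_outer s (A \<union> B)"
proof -
  have "hausdorff_content s \<delta> A + hausdorff_content s \<epsilon> B \<le> hausdorff_outer s (A \<union> B)"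
    if "0 < \<delta>" "0 < \<epsilon>" for \<delta> \<epsilon>
  proof -
    \<comment> \<open>The contents grow as the scale shrinks, so both scales may be replaced by a
      common one strictly below the gap d.\<close>
    define \<eta> where "\<eta> = min (min \<delta> \<epsilon>) (d / 2)"
    have \<eta>: "0 < \<eta>" "\<eta> < d" "\<eta> \<le> \<delta>" "\<eta> \<le> \<epsilon>" using that assms by (auto simp: \<eta>_def)
    have "hausdorff_content s \<delta> A + hausdorff_content s \<epsilon> B \<le> hausdorff_content s \<eta> A + hausdorff_content s \<eta> B"
      using \<eta> by (intro add_mono hausdorff_content_antimono) auto
    also have "\<dots> \<le> hausdorff_content s \<eta> (A \<union> B)"
      using d \<eta> by (intro hausdorff_content_metric) auto
    also have "\<dots> \<le> hausdorff_outer s (A \<union> B)" by (rule hausdorff_content_le_outer[OF \<eta>(1)])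
    finally show ?thesis .
  qed
  hence "(SUP \<delta>\<in>{0<..}. hausdorff_content s \<delta> A) + hausdorff_content s \<epsilon> B \<le> hausdorff_outer s (A \<union> B)"
    if "0 < \<epsilon>" for \<epsilon>
    using that by (subst ennreal_SUP_add_left[symmetric]) (auto intro!: SUP_least)
  hence "(SUP \<delta>\<in>{0<..}. hausdorff_content s \<delta> A) + (SUP \<epsilon>\<in>{0<..}. hausdorff_content s \<epsilon> B)
      \<le> hausdorff_outer s (A \<union> B)"
    by (subst ennreal_SUP_add_right) (auto intro!: SUP_least)
  thus ?thesis by (simp add: hausdorff_outer_def)
qed

text \<open>The gap between \<open>R i\<close> and the later sets is uniform over all of them, so
  the first set can be split off from the union of the rest; the induction runs downwards from
  n.\<close>

lemma hausdorff_outer_metric_sum: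
  assumes d: "\<And>i j. i < j \<Longrightarrow> \<exists>d>0. \<forall>x\<in>R i. \<forall>k\<ge>j. \<forall>y\<in>R k. d \<le> dist x y"
  shows "(\<Sum>i<n. hausdorff_outer s (R i)) \<le> hausdorff_outer s (\<Union>i<n::nat. R i)"
proof -
  have "(\<Sum>i\<in>{m..<n}. hausdorff_outer s (R i)) \<le> hausdorff_outer s (\<Union>i\<in>{m..<n}. R i)" if "m \<le> n" for m
    using that
  proof (induction rule: inc_induct)
    case (step m)
    obtain e where e: "e > 0" "\<forall>x\<in>R m. \<forall>k\<ge>Suc m. \<forall>y\<in>R k. e \<le> dist x y" using d[of m "Suc m"] by auto
    have eq: "{m..<n} = insert m {Suc m..<n}" using step by auto
    have "(\<Sum>i\<in>{m..<n}. hausdorff_outer s (R i)) = hausdorff_outer s (R m) + (\<Sum>i\<in>{Suc m..<n}. hausdorff_outer s (R i))"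
      unfolding eq by simp
    also have "\<dots> \<le> hausdorff_outer s (R m) + hausdorff_outer s (\<Union>i\<in>{Suc m..<n}. R i)"
      by (intro add_left_mono step.IH)
    also have "\<dots> \<le> hausdorff_outer s (R m \<union> (\<Union>i\<in>{Suc m..<n}. R i))"
      by (rule hausdorff_outer_metric[of _ _ e]) (use e in auto)
    also have "R m \<union> (\<Union>i\<in>{Suc m..<n}. R i) = (\<Union>i\<in>{m..<n}. R i)"
      unfolding eq by simp
    finally show ?case .
  qed simp
  from this[of 0] show ?thesis by (simp add: lessThan_atLeast0)
qed

section \<open>Caratheodory measurability of closed sets\<close>

lemma ennreal_suminf_tail_less:
  fixes f :: "nat \<Rightarrow> ennreal"
  assumes "(\<Sum>i. f i) < top" "0 < e"
  shows "\<exists>n. (\<Sum>i. f (i + n)) < ennreal e"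
proof -
  have fin: "f i \<noteq> top" for i using ennreal_suminf_lessD[OF assms(1), of i] by auto
  define g where "g i = enn2real (f i)" for i
  have fg: "f i = ennreal (g i)" for i using fin by (simp add: g_def less_top)
  have g0: "g i \<ge> 0" for i by (simp add: g_def)
  have sg: "summable g" using assms(1) g0 by (intro summable_suminf_not_top) (auto simp: fg)
  have "\<exists>n. norm (\<Sum>i. g (i + n)) < e"
    using suminf_exist_split[OF assms(2) sg] by blast
  then obtain n where n: "norm (\<Sum>i. g (i + n)) < e" by blast
  have "(\<Sum>i. f (i + n)) = ennreal (\<Sum>i. g (i + n))"
    unfolding fg by (rule suminf_ennreal2) (use g0 sg summable_ignore_initial_segment in auto)
  also have "\<dots> < ennreal e" using n assms(2) by (intro ennreal_lessI) auto
  finally show ?thesis by blast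
qed

text \<open>
  Caratheodory's criterion. The set \<open>A - C\<close> is exhausted by the sets \<open>D n\<close> of points at distance
  at least \<open>1 / (n + 1)\<close> from \<open>C\<close>; alternate annuli are metrically separated, so the measures of
  the annuli are summable and the rest \<open>A - C - D n\<close> is eventually negligible.
\<close>

lemma hausdorff_outer_closed:
  fixes C :: "'a::metric_space set"
  assumes "closed C"
  shows "hausdorff_outer s (C \<inter> A) + hausdorff_outer s (A - C) \<le> hausdorff_outer s A"
proof (cases "C = {} \<or> hausdorff_outer s A = top")
  case True
  thus ?thesis by (auto simp: hausdorff_outer_finite)
next
  case False
  hence ne: "C \<noteq> {}" and fin: "hausdorff_outer s A < top" by (auto simp: less_top)
  define D where "D n = {x \<in> A. 1 / (real n + 1) \<le> infdist x C}" for n :: nat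
  define R where "R n = {x \<in> A. 1 / (real n + 2) \<le> infdist x C \<and> infdist x C < 1 / (real n + 1)}" for n :: nat
  have sep: "\<exists>d>0. \<forall>x\<in>R i. \<forall>k\<ge>j. \<forall>y\<in>R k. d \<le> dist x y" if "i + 2 \<le> j" for i j
  proof (intro exI conjI ballI allI impI)
    have "1 / (real i + 3) < 1 / (real i + 2)" by (intro divide_strict_left_mono) auto
    thus "0 < 1 / (real i + 2) - 1 / (real i + 3)" by simp
    fix x k y assume *: "x \<in> R i" "j \<le> k" "y \<in> R k"
    have "infdist y C < 1 / (real k + 1)" using * by (auto simp: R_def)
    also have "\<dots> \<le> 1 / (real i + 3)" using * that by (intro divide_left_mono) auto
    finally have "infdist y C < 1 / (real i + 3)" .
    moreover have "1 / (real i + 2) \<le> infdist x C" using * by (auto simp: R_def)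
    moreover have "infdist x C \<le> infdist y C + dist x y" by (rule infdist_triangle)
    ultimately show "1 / (real i + 2) - 1 / (real i + 3) \<le> dist x y" by linarith
  qed
  have even_le: "(\<Sum>i<n. hausdorff_outer s (R (2 * i))) \<le> hausdorff_outer s A" for n
  proof (rule order_trans[OF hausdorff_outer_metric_sum hausdorff_outer_mono])
    fix i j :: nat assume "i < j"
    then obtain d where "d > 0" "\<forall>x\<in>R (2*i). \<forall>k\<ge>2*j. \<forall>y\<in>R k. d \<le> dist x y" using sep[of "2*i" "2*j"] \<open>i < j\<close> by fastforce
    thus "\<exists>d>0. \<forall>x\<in>R (2*i). \<forall>k\<ge>j. \<forall>y\<in>R (2*k). d \<le> dist x y" by (meson mult_le_mono2)
  qed (auto simp: R_def)
  have odd_le: "(\<Sum>i<n. hausdorff_outer s (R (2 * i + 1))) \<le> hausdorff_outer s A" for n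
  proof (rule order_trans[OF hausdorff_outer_metric_sum hausdorff_outer_mono])
    fix i j :: nat assume "i < j"
    then obtain d where "d > 0" "\<forall>x\<in>R (2*i+1). \<forall>k\<ge>2*j+1. \<forall>y\<in>R k. d \<le> dist x y" using sep[of "2*i+1" "2*j+1"] \<open>i < j\<close> by fastforce
    thus "\<exists>d>0. \<forall>x\<in>R (2*i+1). \<forall>k\<ge>j. \<forall>y\<in>R (2*k+1). d \<le> dist x y" by (meson mult_le_mono2 add_le_mono1)
  qed (auto simp: R_def)
  have eo: "(\<Sum>i<2*n. f i) = (\<Sum>i<n. f (2*i)) + (\<Sum>i<n. f (2*i+1))" for n and f :: "nat \<Rightarrow> ennreal"
    by (induction n) (auto simp: ac_simps)
  have "(\<Sum>i. hausdorff_outer s (R i)) \<le> 2 * hausdorff_outer s A"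
  proof (intro suminf_le_const summableI)
    fix n
    have "(\<Sum>i<n. hausdorff_outer s (R i)) \<le> (\<Sum>i<2*n. hausdorff_outer s (R i))"
      by (intro sum_mono2) auto
    also have "\<dots> \<le> hausdorff_outer s A + hausdorff_outer s A"
      unfolding eo by (intro add_mono even_le odd_le)
    finally show "(\<Sum>i<n. hausdorff_outer s (R i)) \<le> 2 * hausdorff_outer s A" by (simp add: mult_2)
  qed
  also have "\<dots> < top" using fin by (simp add: ennreal_mult_less_top)
  finally have sumR: "(\<Sum>i. hausdorff_outer s (R i)) < top" .
  show ?thesis
  proof (rule ennreal_le_epsilon)
    fix e :: real assume e: "0 < e"
    obtain n where n: "(\<Sum>i. hausdorff_outer s (R (i + n))) < ennreal e"
      using ennreal_suminf_tail_less[OF sumR e] by blast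
    have "A - C \<subseteq> D n \<union> (\<Union>i. R (i + n))"
    proof
      fix x assume x: "x \<in> A - C"
      hence pos: "infdist x C > 0"
        using in_closed_iff_infdist_zero[OF assms ne] infdist_nonneg[of x C] by (auto simp: order_less_le)
      show "x \<in> D n \<union> (\<Union>i. R (i + n))"
      proof (rule ccontr)
        assume "x \<notin> D n \<union> (\<Union>i. R (i + n))"
        hence "x \<notin> D n" and nR: "\<And>i. x \<notin> R (i + n)" by auto
        hence "infdist x C < 1 / (real (0 + n) + 1)" using x by (auto simp: D_def)
        moreover have "infdist x C < 1 / (real (Suc i + n) + 1)" if "infdist x C < 1 / (real (i + n) + 1)" for i
          using nR[of i] x that by (auto simp: R_def algebra_simps)
        ultimately have all: "infdist x C < 1 / (real (i + n) + 1)" for i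
          by (induction i) auto
        obtain k where k: "1 / (real k + 1) < infdist x C"
          using nat_approx_posE[OF pos] by (metis of_nat_Suc add.commute)
        have "1 / (real (k + n) + 1) \<le> 1 / (real k + 1)" by (intro divide_left_mono) auto
        thus False using all[of k] k by linarith
      qed
    qed
    hence "hausdorff_outer s (A - C) \<le> hausdorff_outer s (D n \<union> (\<Union>i. R (i + n)))"
      by (rule hausdorff_outer_mono)
    also have "\<dots> \<le> hausdorff_outer s (D n) + hausdorff_outer s (\<Union>i. R (i + n))"
      by (rule hausdorff_outer_Un)
    also have "\<dots> \<le> hausdorff_outer s (D n) + e"
      using n order_trans[OF hausdorff_outer_countably_subadditive less_imp_le[OF n]] by (intro add_left_mono)
    finally have "hausdorff_outer s (C \<inter> A) + hausdorff_outer s (A - C)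
        \<le> (hausdorff_outer s (C \<inter> A) + hausdorff_outer s (D n)) + e"
      by (metis add.assoc add_left_mono)
    also have "\<dots> \<le> hausdorff_outer s (C \<inter> A \<union> D n) + e"
    proof (intro add_right_mono hausdorff_outer_metric)
      fix x y assume "x \<in> C \<inter> A" "y \<in> D n"
      thus "1 / (real n + 1) \<le> dist x y"
        using infdist_le[of x C y] by (auto simp: D_def dist_commute)
    qed auto
    also have "\<dots> \<le> hausdorff_outer s A + e"
      by (intro add_right_mono hausdorff_outer_mono) (auto simp: D_def)
    finally show "hausdorff_outer s (C \<inter> A) + hausdorff_outer s (A - C) \<le> hausdorff_outer s A + e" .
  qed
qed

text \<open>The Caratheodory measurable sets form a sigma-algebra on which the outer measure is
  countably additive. It contains the closed sets by \<open>hausdorff_outer_closed\<close>, hence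
  all Borel sets, and countable additivity is inherited by the smaller sigma-algebra.\<close>

lemma measure_space_hausdorff_outer: "measure_space UNIV (sets borel) (hausdorff_outer s)"
proof -
  interpret sigma_algebra UNIV "Pow UNIV :: 'a set set" by (rule sigma_algebra_Pow)
  have "positive (Pow UNIV :: 'a set set) (hausdorff_outer s)"
    by (simp add: positive_def hausdorff_outer_finite)
  moreover have "increasing (Pow UNIV :: 'a set set) (hausdorff_outer s)"
    by (simp add: increasing_def hausdorff_outer_mono)
  moreover have "countably_subadditive (Pow UNIV :: 'a set set) (hausdorff_outer s)"
    by (simp add: countably_subadditive_def hausdorff_outer_countably_subadditive)
  ultimately have "outer_measure_space (Pow UNIV :: 'a set set) (hausdorff_outer s)"
    by (simp add: outer_measure_space_def)
  from caratheodory_lemma[OF this]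
  have L: "measure_space UNIV (lambda_system UNIV (Pow UNIV) (hausdorff_outer s :: 'a set \<Rightarrow> _)) (hausdorff_outer s)" .
  have "closed C \<Longrightarrow> C \<in> lambda_system UNIV (Pow UNIV) (hausdorff_outer s)" for C :: "'a set"
    unfolding lambda_system_def
  proof (intro CollectI conjI ballI antisym)
    fix A assume C: "closed C"
    show "hausdorff_outer s (C \<inter> A) + hausdorff_outer s ((UNIV - C) \<inter> A) \<le> hausdorff_outer s A"
      using hausdorff_outer_closed[OF C, of s A] by (simp add: Int_commute Diff_eq)
    show "hausdorff_outer s A \<le> hausdorff_outer s (C \<inter> A) + hausdorff_outer s ((UNIV - C) \<inter> A)"
      by (rule order_trans[OF hausdorff_outer_mono hausdorff_outer_Un]) auto
  qed auto
  hence "sigma_sets UNIV {C. closed C} \<subseteq> lambda_system UNIV (Pow UNIV) (hausdorff_outer s :: 'a set \<Rightarrow> _)"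
    using L by (intro sigma_algebra.sigma_sets_subset) (auto simp: measure_space_def)
  hence "sets (borel :: 'a measure) \<subseteq> lambda_system UNIV (Pow UNIV) (hausdorff_outer s)"
    by (simp add: borel_eq_closed)
  moreover have "sigma_algebra UNIV (sets (borel :: 'a measure))"
    using sets.sigma_algebra_axioms[of "borel :: 'a measure"] by simp
  ultimately show ?thesis using L
    unfolding measure_space_def positive_def countably_additive_def by (meson order_trans subset_iff)
qed

lemma sets_hausdorff_measure [simp, measurable_cong]: "sets (hausdorff_measure s) = sets borel"
  unfolding hausdorff_measure_def using sets.sigma_sets_eq[of borel] by (simp add: sets_measure_of_conv)

lemma space_hausdorff_measure [simp]: "space (hausdorff_measure s) = UNIV"
  using sets_eq_imp_space_eq[OF sets_hausdorff_measure] by simp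

lemma emeasure_hausdorff_measure:
  "A \<in> sets borel \<Longrightarrow> emeasure (hausdorff_measure s) A = hausdorff_outer s A"
  unfolding hausdorff_measure_def using measure_space_hausdorff_outer[of s]
  by (intro emeasure_measure_of_sigma) (auto simp: measure_space_def)

section \<open>Lipschitz images\<close>

lemma diameter_le_dist:
  assumes "S \<noteq> {}" "\<And>x y. x \<in> S \<Longrightarrow> y \<in> S \<Longrightarrow> dist x y \<le> c"
  shows "diameter S \<le> c"
  using assms unfolding diameter_def by (auto intro!: cSUP_least)

text \<open>The images of a cover at scale \<delta>/r form a cover at scale \<delta>, and each term
  grows at most by the factor \<open>r powr s\<close>. The argument by contradiction produces a
  single good cover, which avoids moving the constant through the infimum.\<close>

lemma hausdorff_outer_image_le:
  fixes f :: "'a::metric_space \<Rightarrow> 'b::metric_space"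
  assumes f: "\<And>x y. dist (f x) (f y) \<le> r * dist x y" and r: "0 < r" and s: "0 < s"
  shows "hausdorff_outer s (f ` A) \<le> ennreal (r powr s) * hausdorff_outer s A"
  unfolding hausdorff_outer_def[of s "f ` A"]
proof (rule SUP_least)
  have less_divide_iff: "x < y / ennreal (r powr s) \<longleftrightarrow> ennreal (r powr s) * x < y" for x y :: ennreal
  proof -
    have "y / ennreal (r powr s) = y * ennreal (inverse (r powr s))"
      using r by (simp add: divide_ennreal_def inverse_ennreal)
    moreover have "x = ennreal (inverse (r powr s)) * (ennreal (r powr s) * x)"
      using r by (simp add: mult.assoc[symmetric] flip: ennreal_mult)
    moreover have "ennreal (r powr s) * (y * ennreal (inverse (r powr s))) = y"
      using r by (simp add: mult.left_commute flip: ennreal_mult)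
    ultimately show ?thesis
      using ennreal_mult_strict_left_mono[of x "y / ennreal (r powr s)" "ennreal (r powr s)"]
        ennreal_mult_strict_left_mono[of "ennreal (r powr s) * x" y "ennreal (inverse (r powr s))"] r
      by (auto simp: mult.commute)
  qed
  fix \<delta> :: real assume "\<delta> \<in> {0<..}"
  hence \<delta>: "0 < \<delta>" by simp
  have "hausdorff_content s \<delta> (f ` A) \<le> ennreal (r powr s) * hausdorff_content s (\<delta> / r) A"
  proof (rule ccontr)
    assume "\<not> ?thesis"
    hence "ennreal (r powr s) * hausdorff_content s (\<delta> / r) A < hausdorff_content s \<delta> (f ` A)" by simp
    hence "hausdorff_content s (\<delta> / r) A < hausdorff_content s \<delta> (f ` A) / ennreal (r powr s)"
      using r by (simp add: less_divide_iff)
    then obtain U :: "nat \<Rightarrow> 'a set" where U: "A \<subseteq> (\<Union>i. U i)" "\<And>i. bounded (U i)"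
        "\<And>i. diameter (U i) \<le> \<delta> / r"
        "(\<Sum>i. ennreal (diameter (U i) powr s)) < hausdorff_content s \<delta> (f ` A) / ennreal (r powr s)"
      by (rule hausdorff_content_cover) blast
    have d: "dist x y \<le> r * diameter (U i)" if "x \<in> f ` U i" "y \<in> f ` U i" for x y i
      using that U(2)[of i] f diameter_bounded_bound[OF U(2)] r
      by (auto intro: order_trans[OF f mult_left_mono])
    have bd: "bounded (f ` U i)" for i
      unfolding bounded_any_center[of _ "f (SOME x. x \<in> U i)"]
    proof (intro exI ballI)
      fix y assume "y \<in> f ` U i"
      moreover from this have "(SOME x. x \<in> U i) \<in> U i" by (auto intro: someI)
      ultimately show "dist (f (SOME x. x \<in> U i)) y \<le> r * diameter (U i)" by (intro d) auto
    qed
    have diam: "diameter (f ` U i) \<le> r * diameter (U i)" for i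
    proof (cases "U i = {}")
      case False
      thus ?thesis using d[of _ i] by (intro diameter_le_dist) auto
    qed simp
    have "hausdorff_content s \<delta> (f ` A) \<le> (\<Sum>i. ennreal (diameter (f ` U i) powr s))"
    proof (rule hausdorff_content_le)
      show "f ` A \<subseteq> (\<Union>i. f ` U i)" using U(1) by blast
      show "diameter (f ` U i) \<le> \<delta>" for i
        using diam[of i] U(3)[of i] r by (simp add: field_simps)
    qed (use bd in auto)
    also have "\<dots> \<le> (\<Sum>i. ennreal (r powr s) * ennreal (diameter (U i) powr s))"
    proof (intro suminf_le)
      fix i
      have "diameter (f ` U i) powr s \<le> (r * diameter (U i)) powr s"
        using diam[of i] diameter_ge_0[OF bd[of i]] s by (intro powr_mono2) auto
      thus "ennreal (diameter (f ` U i) powr s) \<le> ennreal (r powr s) * ennreal (diameter (U i) powr s)"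
        using r diameter_ge_0[OF U(2)] by (simp add: powr_mult flip: ennreal_mult)
    qed auto
    also have "\<dots> = ennreal (r powr s) * (\<Sum>i. ennreal (diameter (U i) powr s))" by simp
    also have "\<dots> < hausdorff_content s \<delta> (f ` A)"
      using U(4) r by (simp add: less_divide_iff)
    finally show False by simp
  qed
  also have "\<dots> \<le> ennreal (r powr s) * hausdorff_outer s A"
    using \<delta> r by (intro mult_left_mono hausdorff_content_le_outer) auto
  finally show "hausdorff_content s \<delta> (f ` A) \<le> ennreal (r powr s) * hausdorff_outer s A" .
qed

subsection \<open>Words and barycentric coordinates\<close>

lemma words_0 [simp]: "words 0 = {[]}"
  by (auto simp: words_def)

lemma Nil_in_words_iff [simp]: "[] \<in> words n \<longleftrightarrow> n = 0"
  by (auto simp: words_def)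

lemma Cons_in_words_iff [simp]: "a # w \<in> words (Suc n) \<longleftrightarrow> a \<in> {0,1,2} \<and> w \<in> words n"
  by (auto simp: words_def)

lemma length_words: "w \<in> words n \<Longrightarrow> length w = n"
  by (auto simp: words_def)

lemma append_words: "v \<in> words n \<Longrightarrow> w \<in> words m \<Longrightarrow> v @ w \<in> words (n + m)"
  by (auto simp: words_def)

lemma snoc_in_words [simp]: "w @ [a] \<in> words (Suc n) \<longleftrightarrow> w \<in> words n \<and> a \<in> {0,1,2}"
  by (auto simp: words_def)

lemma replicate_in_words: "a \<in> {0,1,2} \<Longrightarrow> replicate k a \<in> words k"
  by (auto simp: words_def)

lemma finite_words [simp]: "finite (words n)"
  unfolding words_def using finite_lists_length_eq[of "{0,1,2::nat}" n] by (simp add: conj_commute)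

lemma card_words: "card (words n) = 3 ^ n"
  unfolding words_def using card_lists_length_eq[of "{0,1,2::nat}" n] by (simp add: conj_commute numeral_3_eq_3)

lemma words_add: "words (n + m) = (\<lambda>(v, w). v @ w) ` (words n \<times> words m)"
proof (intro set_eqI iffI)
  fix w assume w: "w \<in> words (n + m)"
  hence "take n w \<in> words n" "drop n w \<in> words m"
    by (auto simp: words_def dest: in_set_takeD in_set_dropD)
  thus "w \<in> (\<lambda>(v, w). v @ w) ` (words n \<times> words m)"
    by (auto intro!: image_eqI[of _ _ "(take n w, drop n w)"])
qed (auto intro: append_words)

lemma sum_words_add: "(\<Sum>w\<in>words (n + m). f w) = (\<Sum>v\<in>words n. \<Sum>w\<in>words m. f (v @ w))"
proof -
  have "inj_on (\<lambda>(v, w). v @ w) (words n \<times> words m)"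
    by (auto simp: inj_on_def words_def)
  from sum.reindex[OF this, of f] show ?thesis
    by (simp add: words_add sum.cartesian_product case_prod_unfold)
qed

lemma words_1: "words (Suc 0) = {[0], [1], [2]}"
  by (auto simp: words_def length_Suc_conv)

lemma sum_words_snoc:
  "(\<Sum>w\<in>words (Suc n). f w) = (\<Sum>w\<in>words n. \<Sum>a\<in>{0,1,2}. f (w @ [a]))"
  using sum_words_add[of f n 1] by (simp add: words_1)

lemma sum_words_Cons:
  "(\<Sum>w\<in>words (Suc n). f w) = (\<Sum>a\<in>{0,1,2}. \<Sum>w\<in>words n. f (a # w))"
  using sum_words_add[of f 1 n] by (simp add: words_1)

lemma words_SucE:
  assumes "w \<in> words (Suc n)"
  obtains a v where "w = a # v" "a \<in> {0,1,2}" "v \<in> words n"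
  using assms by (cases w) (auto simp: words_def)

lemma word_map_Nil [simp]: "word_map [] = id"
  by (simp add: word_map_def)

lemma word_map_Cons [simp]: "word_map (a # w) = sg_map a \<circ> word_map w"
  by (simp add: word_map_def)

lemma word_map_append: "word_map (v @ w) = word_map v \<circ> word_map w"
  by (induction v) (auto simp: fun_eq_iff)

lemma dist_sg_map: "dist (sg_map i x) (sg_map i y) = dist x y / 2"
  by (simp add: sg_map_def dist_norm flip: scaleR_diff_right)

lemma inj_sg_map: "inj (sg_map i)"
  by (auto simp: inj_def sg_map_def)

lemma continuous_on_sg_map [continuous_intros]: "continuous_on A (sg_map i)"
  unfolding sg_map_def by (intro continuous_intros)

lemma dist_word_map: "dist (word_map w x) (word_map w y) = dist x y / 2 ^ length w"
  by (induction w arbitrary: x y) (auto simp: dist_sg_map)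

lemma inj_word_map: "inj (word_map w)"
proof (rule injI)
  fix x y assume "word_map w x = word_map w y"
  thus "x = y" using dist_word_map[of w x y] by simp
qed

lemma continuous_on_word_map [continuous_intros]: "continuous_on A (word_map w)"
proof (induction w)
  case (Cons a w)
  thus ?case unfolding word_map_Cons by (intro continuous_on_compose continuous_on_sg_map)
qed simp

lemma sg_map_vertex [simp]: "sg_map i (sg_vertex i) = sg_vertex i"
  by (simp add: sg_map_def flip: scaleR_2)

lemma sg_map_vertex_swap: "sg_map i (sg_vertex j) = sg_map j (sg_vertex i)"
  by (simp add: sg_map_def add.commute)

lemma word_map_replicate_vertex [simp]: "word_map (replicate n i) (sg_vertex i) = sg_vertex i"
  by (induction n) auto

section \<open>Barycentric coordinates\<close>

text \<open>The barycentric coordinates with respect to the three vertices, extended affinely to the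
  plane. In them \<open>sg_map j\<close> halves all coordinates and adds 1/2 to the j-th, so the
  positions of cells are read off as binary digits.\<close>

definition bary :: "nat \<Rightarrow> real^2 \<Rightarrow> real" where
  "bary i x = (if i = 0 then 1 - x$1 - x$2 / sqrt 3
               else if i = 1 then x$1 - x$2 / sqrt 3 else 2 * x$2 / sqrt 3)"

lemma bary_vertex:
  "i \<in> {0,1,2} \<Longrightarrow> j \<in> {0,1,2} \<Longrightarrow> bary i (sg_vertex j) = (if i = j then 1 else 0)"
  by (auto simp: bary_def sg_vertex_def)

lemma bary_sg_map:
  assumes "i \<in> {0,1,2}" "j \<in> {0,1,2}"
  shows "bary i (sg_map j x) = (bary i x + (if i = j then 1 else 0)) / 2"
  using assms by (auto simp: bary_def sg_map_def sg_vertex_def field_simps)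

lemma bary_sum: "bary 0 x + bary 1 x + bary 2 x = 1"
  by (simp add: bary_def field_simps)

lemma bary_eqI: "bary 1 x = bary 1 y \<Longrightarrow> bary 2 x = bary 2 y \<Longrightarrow> x = y"
  by (auto simp: bary_def vec_eq_iff forall_2)

lemma continuous_on_bary [continuous_intros]: "continuous_on A (bary i)"
  unfolding bary_def by (cases "i = 0"; cases "i = 1"; simp) (intro continuous_intros; simp)+

lemma bary_lipschitz: "\<bar>bary i x - bary i y\<bar> \<le> 2 * dist x y"
proof -
  have c: "\<bar>x $ k - y $ k\<bar> \<le> dist x y" for k
    using component_le_norm_cart[of "x - y" k] by (simp add: dist_norm)
  have s: "1 \<le> sqrt 3" by simp
  have d: "\<bar>(x $ 2 - y $ 2) / sqrt 3\<bar> \<le> dist x y"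
  proof -
    have "\<bar>(x $ 2 - y $ 2) / sqrt 3\<bar> \<le> \<bar>x $ 2 - y $ 2\<bar> / 1"
      using s unfolding abs_divide by (intro frac_le) auto
    thus ?thesis using c[of 2] by simp
  qed
  define a where "a = x$1 - y$1"
  define t where "t = (x$2 - y$2) / sqrt 3"
  have "bary i x - bary i y = (if i = 0 then - a - t else if i = 1 then a - t else 2 * t)"
    by (auto simp: bary_def a_def t_def field_simps)
  moreover have "\<bar>a\<bar> \<le> dist x y" "\<bar>t\<bar> \<le> dist x y" using c[of 1] d by (auto simp: a_def t_def)
  ultimately show ?thesis by (auto simp: abs_le_iff)
qed

subsection \<open>Existence and uniqueness of the gasket\<close>

definition hutchinson :: "(real^2) set \<Rightarrow> (real^2) set" where
  "hutchinson A = (\<Union>i\<in>{0,1,2}. sg_map i ` A)"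

lemma norm_sg_vertex_le: "norm (sg_vertex i) \<le> 1"
proof -
  have "(1/2)^2 + (sqrt 3 / 2)^2 = (1::real)" by (simp add: power_divide)
  thus ?thesis by (auto simp: sg_vertex_def norm_vec_def L2_set_def sum_2)
qed

lemma norm_sg_map_le: "norm (sg_map i x) \<le> (norm x + 1) / 2"
  using norm_triangle_ineq[of x "sg_vertex i"] norm_sg_vertex_le[of i] by (simp add: sg_map_def)

lemma hutchinson_fixedE:
  assumes "K = hutchinson K" "x \<in> K"
  obtains i y where "i \<in> {0,1,2}" "y \<in> K" "x = sg_map i y"
  using equalityD1[OF assms(1), THEN subsetD, OF assms(2)] unfolding hutchinson_def by blast

lemma hutchinson_fixedI:
  assumes "K = hutchinson K" "x \<in> K" "i \<in> {0,1,2}"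
  shows "sg_map i x \<in> K"
  by (rule equalityD2[OF assms(1), THEN subsetD]) (use assms(2,3) in \<open>auto simp: hutchinson_def\<close>)

lemma hutchinson_fixed_wordE:
  assumes "K = hutchinson K" "x \<in> K"
  shows "\<exists>w\<in>words n. \<exists>y\<in>K. x = word_map w y"
  using assms(2)
proof (induction n arbitrary: x)
  case (Suc n)
  obtain a y where a: "a \<in> {0,1,2}" "y \<in> K" "x = sg_map a y" using hutchinson_fixedE[OF assms(1) Suc.prems] .
  then obtain w z where "w \<in> words n" "z \<in> K" "y = word_map w z" using Suc.IH by blast
  thus ?case using a by (intro bexI[of _ "a # w"] bexI[of _ z]) auto
qed auto

lemma hutchinson_fixed_wordI:
  assumes "K = hutchinson K"
  shows "w \<in> words n \<Longrightarrow> x \<in> K \<Longrightarrow> word_map w x \<in> K"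
proof (induction w arbitrary: n)
  case (Cons a w)
  thus ?case using hutchinson_fixedI[OF assms] by (cases n) (auto simp: words_def)
qed auto

lemma LIMSEQ_divide_pow2: "(\<lambda>n. D / 2 ^ n :: real) \<longlonglongrightarrow> 0"
  using tendsto_mult_right[OF LIMSEQ_realpow_zero[of "1/2 :: real"], of D]
  by (simp add: power_divide mult.commute)

text \<open>A point of \<open>K\<close> has the form \<open>word_map w z\<close> with w of length n.
  Replacing z by a fixed point y of \<open>L\<close> moves it by at most D / 2^n and lands in
  \<open>L\<close>, so \<open>K\<close> lies in the closure of \<open>L\<close>. Used in both
  directions, this is uniqueness of the attractor.\<close>

lemma hutchinson_fixed_subset:
  assumes K: "compact K" "K = hutchinson K" and L: "compact L" "L \<noteq> {}" "L = hutchinson L"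
  shows "K \<subseteq> L"
proof
  fix x assume x: "x \<in> K"
  obtain y where y: "y \<in> L" using L by blast
  obtain D where D: "\<And>z. z \<in> K \<Longrightarrow> dist z y \<le> D"
    using compact_imp_bounded[OF K(1)] unfolding bounded_any_center[of _ y] by (auto simp: dist_commute)
  have "x \<in> closure L"
    unfolding closure_approachable
  proof (intro allI impI)
    fix e :: real assume e: "0 < e"
    obtain n where n: "D / 2 ^ n < e"
      using order_tendstoD(2)[OF LIMSEQ_divide_pow2[of D] e] by (auto simp: eventually_sequentially)
    obtain w z where w: "w \<in> words n" "z \<in> K" "x = word_map w z"
      using hutchinson_fixed_wordE[OF K(2) x, of n] by blast
    have "word_map w y \<in> L" using hutchinson_fixed_wordI[OF L(3) w(1) y] .
    moreover have "dist (word_map w y) x \<le> D / 2 ^ n"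
      using D[OF w(2)] w length_words[OF w(1)]
      by (simp add: dist_word_map dist_commute divide_right_mono)
    ultimately show "\<exists>y\<in>L. dist y x < e" using n by (intro bexI[of _ "word_map w y"]) auto
  qed
  thus "x \<in> L" by (simp add: compact_imp_closed[OF L(1)])
qed

text \<open>The vertices have norm at most 1, so the unit ball is mapped into itself and its
  iterates decrease; their intersection is the attractor.\<close>

lemma ex_hutchinson_fixed: "\<exists>K. compact K \<and> K \<noteq> {} \<and> K = hutchinson K"
proof -
  define A where "A n = (hutchinson ^^ n) (cball 0 1)" for n
  have mono: "X \<subseteq> Y \<Longrightarrow> hutchinson X \<subseteq> hutchinson Y" for X Y by (auto simp: hutchinson_def)
  have A_Suc: "A (Suc n) = hutchinson (A n)" for n by (simp add: A_def)
  have comp: "compact (A n)" for n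
  proof (induction n)
    case (Suc n)
    thus ?case unfolding A_Suc hutchinson_def
      by (intro compact_UN compact_continuous_image continuous_on_sg_map) auto
  qed (simp add: A_def)
  have ne: "A n \<noteq> {}" for n by (induction n) (auto simp: A_Suc hutchinson_def, simp add: A_def)
  have dec: "A (Suc n) \<subseteq> A n" for n
  proof (induction n)
    case 0
    have "norm (sg_map i x) \<le> 1" if "norm x \<le> 1" for i x using norm_sg_map_le[of i x] that by simp
    thus ?case by (auto simp: A_def hutchinson_def)
  next
    case (Suc n)
    show ?case using mono[OF Suc] by (simp add: A_Suc)
  qed
  have dec': "m \<le> n \<Longrightarrow> A n \<subseteq> A m" for m n
    using lift_Suc_antimono_le[of A] dec by blast
  define K where "K = (\<Inter>n. A n)"
  have "compact K" unfolding K_def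
    using comp by (intro compact_Inter) auto
  moreover have "K \<noteq> {}" unfolding K_def
    using compact_nest[of A] comp ne dec' by auto
  moreover have "K = hutchinson K"
  proof
    show "hutchinson K \<subseteq> K"
    proof
      fix x assume x: "x \<in> hutchinson K"
      have "x \<in> A n" for n
      proof -
        have "K \<subseteq> A n" by (auto simp: K_def)
        hence "x \<in> A (Suc n)" using mono[of K "A n"] x by (auto simp: A_Suc)
        thus ?thesis using dec by blast
      qed
      thus "x \<in> K" by (simp add: K_def)
    qed
    show "K \<subseteq> hutchinson K"
    proof
      fix x assume x: "x \<in> K"
      show "x \<in> hutchinson K"
      proof (rule ccontr)
        assume nx: "x \<notin> hutchinson K"
        \<comment> \<open>Injectivity of \<open>sg_map i\<close> makes the preimage of x the same
          for all n, so a point in all the images would come from a point of \<open>K\<close>. With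
          three maps one level m then excludes x from all images at once.\<close>
        have "\<exists>n. x \<notin> sg_map i ` A n" if "i \<in> {0,1,2}" for i
        proof (rule ccontr)
          assume "\<nexists>n. x \<notin> sg_map i ` A n"
          hence *: "\<forall>n. \<exists>y. y \<in> A n \<and> x = sg_map i y" by auto
          obtain y where y: "y \<in> A 0" "x = sg_map i y" using * by blast
          hence "y \<in> A n" for n using * inj_sg_map[of i] by (metis injD)
          hence "y \<in> K" by (simp add: K_def)
          thus False using nx y that by (auto simp: hutchinson_def)
        qed
        then obtain N where N: "\<And>i. i \<in> {0,1,2} \<Longrightarrow> x \<notin> sg_map i ` A (N i)" by metis
        define m where "m = N 0 + N 1 + N 2"
        have "x \<in> A (Suc m)" using x by (simp add: K_def)
        then obtain i where i: "i \<in> {0,1,2}" "x \<in> sg_map i ` A m" by (auto simp: A_Suc hutchinson_def)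
        have "N i \<le> m" using i by (auto simp: m_def)
        hence "x \<in> sg_map i ` A (N i)" using i dec' by blast
        thus False using N i by blast
      qed
    qed
  qed
  ultimately show ?thesis by blast
qed

lemma gasket: "compact gasket" "gasket \<noteq> {}" "gasket = hutchinson gasket"
proof -
  have "\<exists>!K. compact K \<and> K \<noteq> {} \<and> K = (\<Union>i\<in>{0,1,2}. sg_map i ` K)"
  proof (rule ex_ex1I)
    show "\<exists>K. compact K \<and> K \<noteq> {} \<and> K = (\<Union>i\<in>{0,1,2}. sg_map i ` K)"
      using ex_hutchinson_fixed by (simp only: hutchinson_def)
  next
    fix K L
    assume "compact K \<and> K \<noteq> {} \<and> K = (\<Union>i\<in>{0,1,2}. sg_map i ` K)"
      "compact L \<and> L \<noteq> {} \<and> L = (\<Union>i\<in>{0,1,2}. sg_map i ` L)"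
    thus "K = L"
      using hutchinson_fixed_subset[of K L] hutchinson_fixed_subset[of L K]
      by (simp only: hutchinson_def) blast
  qed
  from theI'[OF this] show "compact gasket" "gasket \<noteq> {}" "gasket = hutchinson gasket"
    unfolding gasket_def hutchinson_def by blast+
qed

lemma gasket_eq_UN_cell: "gasket = (\<Union>w\<in>words n. cell w)"
proof
  show "gasket \<subseteq> (\<Union>w\<in>words n. cell w)"
    using hutchinson_fixed_wordE[OF gasket(3), of _ n] by (fastforce simp: cell_def)
  show "(\<Union>w\<in>words n. cell w) \<subseteq> gasket"
    using hutchinson_fixed_wordI[OF gasket(3), of _ n] by (auto simp: cell_def)
qed

lemma sg_map_in_gasket: "i \<in> {0,1,2} \<Longrightarrow> x \<in> gasket \<Longrightarrow> sg_map i x \<in> gasket"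
  using hutchinson_fixedI[OF gasket(3)] .

lemma word_map_in_gasket: "w \<in> words n \<Longrightarrow> x \<in> gasket \<Longrightarrow> word_map w x \<in> gasket"
  using hutchinson_fixed_wordI[OF gasket(3)] .

lemma gasket_sg_mapE:
  assumes "x \<in> gasket"
  obtains i y where "i \<in> {0,1,2}" "y \<in> gasket" "x = sg_map i y"
  using hutchinson_fixedE[OF gasket(3) assms] .

lemma cell_Nil [simp]: "cell [] = gasket"
  by (simp add: cell_def)

lemma cell_append: "cell (v @ w) = word_map v ` cell w"
  by (simp add: cell_def word_map_append image_comp)

lemma cell_subset_gasket: "w \<in> words n \<Longrightarrow> cell w \<subseteq> gasket"
  by (auto simp: cell_def word_map_in_gasket)

lemma cell_append_subset: "w \<in> words n \<Longrightarrow> cell (v @ w) \<subseteq> cell v"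
  unfolding cell_append using cell_subset_gasket[of w n] by (auto simp: cell_def)

lemma compact_cell: "compact (cell w)"
  unfolding cell_def by (intro compact_continuous_image continuous_on_word_map gasket)

lemma cell_nonempty: "cell w \<noteq> {}"
  using gasket by (simp add: cell_def)

text \<open>Iterating \<open>sg_map i\<close> on any point of the gasket converges to its fixed
  point, and the gasket is closed.\<close>

lemma vertex_in_gasket: "i \<in> {0,1,2} \<Longrightarrow> sg_vertex i \<in> gasket"
proof -
  assume i: "i \<in> {0,1,2}"
  obtain y where y: "y \<in> gasket" using gasket by blast
  have "(\<lambda>n. dist y (sg_vertex i) / 2 ^ n) \<longlonglongrightarrow> 0" by (rule LIMSEQ_divide_pow2)
  moreover have "dist (word_map (replicate n i) y) (sg_vertex i) = dist y (sg_vertex i) / 2 ^ n" for n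
    using dist_word_map[of "replicate n i" y "sg_vertex i"] by simp
  ultimately have lim: "(\<lambda>n. word_map (replicate n i) y) \<longlonglongrightarrow> sg_vertex i"
    by (subst tendsto_dist_iff) (simp only:)
  show "sg_vertex i \<in> gasket"
    by (rule closed_sequentially[OF compact_imp_closed[OF gasket(1)] _ lim])
       (rule word_map_in_gasket[OF replicate_in_words[OF i] y])
qed

text \<open>At a point m of maximal norm, m = \<open>sg_map i y\<close> gives norm m <= (norm m + 1)
  / 2.\<close>

lemma gasket_norm_le: "x \<in> gasket \<Longrightarrow> norm x \<le> 1"
proof -
  assume x: "x \<in> gasket"
  obtain m where m: "m \<in> gasket" "\<And>y. y \<in> gasket \<Longrightarrow> norm y \<le> norm m"
    using continuous_attains_sup[OF gasket(1,2), of norm] by (auto intro: continuous_intros)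
  obtain i y where "m = sg_map i y" "y \<in> gasket" using gasket_sg_mapE[OF m(1)] by metis
  hence "norm m \<le> 1" using norm_sg_map_le[of i y] m(2)[of y] by simp
  thus ?thesis using m(2)[OF x] by simp
qed

lemma dist_gasket_le: "x \<in> gasket \<Longrightarrow> y \<in> gasket \<Longrightarrow> dist x y \<le> 2"
  using norm_triangle_ineq4[of x y] gasket_norm_le[of x] gasket_norm_le[of y] by (simp add: dist_norm)

lemma dist_cell_le: "w \<in> words n \<Longrightarrow> x \<in> cell w \<Longrightarrow> y \<in> cell w \<Longrightarrow> dist x y \<le> 2 / 2 ^ n"
  by (auto simp: cell_def dist_word_map dist_gasket_le length_words divide_right_mono)

text \<open>The same extremal argument: at a point m minimizing the coordinate, m =
  \<open>sg_map j y\<close> shows that the minimum is at least half of itself.\<close>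

lemma bary_nonneg: "x \<in> gasket \<Longrightarrow> i \<in> {0,1,2} \<Longrightarrow> 0 \<le> bary i x"
proof -
  assume x: "x \<in> gasket" and i: "i \<in> {0,1,2}"
  obtain m where m: "m \<in> gasket" "\<And>y. y \<in> gasket \<Longrightarrow> bary i m \<le> bary i y"
    using continuous_attains_inf[OF gasket(1,2) continuous_on_bary] by blast
  obtain j y where "m = sg_map j y" "y \<in> gasket" "j \<in> {0,1,2}" using gasket_sg_mapE[OF m(1)] by metis
  hence "0 \<le> bary i m" using m(2)[of y] bary_sg_map[OF i, of j y] by (simp split: if_splits)
  thus ?thesis using m(2)[OF x] by simp
qed

lemma bary_le_1: "x \<in> gasket \<Longrightarrow> i \<in> {0,1,2} \<Longrightarrow> bary i x \<le> 1"
  using bary_sum[of x] bary_nonneg[of x 0] bary_nonneg[of x 1] bary_nonneg[of x 2] by auto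

lemma bary_eq_1:
  assumes "x \<in> gasket" "i \<in> {0,1,2}" "bary i x = 1"
  shows "x = sg_vertex i"
proof (rule bary_eqI)
  have "bary 0 x = (if i = 0 then 1 else 0) \<and> bary 1 x = (if i = 1 then 1 else 0) \<and> bary 2 x = (if i = 2 then 1 else 0)"
    using bary_sum[of x] bary_nonneg[of x 0] bary_nonneg[of x 1] bary_nonneg[of x 2] assms by auto
  thus "bary 1 x = bary 1 (sg_vertex i)" "bary 2 x = bary 2 (sg_vertex i)"
    using assms(2) by (auto simp: bary_vertex)
qed

subsection \<open>Adjacent cells\<close>

text \<open>Coordinate b equals 1 at vertex b and is at most 1 on the gasket. By
  \<open>bary_sg_map\<close> this forces the first letter to be b and coordinate b of the preimage
  to be 1 again.\<close>

lemma vertex_in_cell: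
  assumes "w \<in> words n" "b \<in> {0,1,2}" "sg_vertex b \<in> cell w"
  shows "w = replicate n b"
  using assms
proof (induction n arbitrary: w)
  case (Suc n)
  then obtain c v where v: "w = c # v" "c \<in> {0,1,2}" "v \<in> words n" by (elim words_SucE)
  then obtain y where y: "y \<in> gasket" "sg_vertex b = sg_map c (word_map v y)"
    using Suc.prems by (auto simp: cell_def)
  have z: "word_map v y \<in> gasket" using y v word_map_in_gasket by blast
  have "1 = (bary b (word_map v y) + (if b = c then 1 else 0)) / 2"
    using bary_sg_map[of b c "word_map v y"] bary_vertex[of b b] y v Suc.prems by simp
  moreover have "bary b (word_map v y) \<le> 1" using z Suc.prems bary_le_1 by blast
  ultimately have bc: "b = c" "bary b (word_map v y) = 1" by (auto split: if_splits)
  hence "word_map v y = sg_vertex b" using z Suc.prems bary_eq_1 by blast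
  hence "sg_vertex b \<in> cell v" using y by (auto simp: cell_def)
  thus ?case using Suc.IH[of v] v bc Suc.prems by simp
qed auto

text \<open>The cells u a and u b meet at the image of vertex b of the first, which is the image of
  vertex a of the second. Appending b k times selects the subcell of u a that still contains this
  point, since \<open>sg_map b\<close> fixes vertex b.\<close>

definition touching :: "nat list \<Rightarrow> nat \<Rightarrow> nat \<Rightarrow> nat \<Rightarrow> nat list" where
  "touching u a b k = u @ a # replicate k b"

text \<open>A common first letter is stripped off by injectivity. At the first differing letters a
  and b, the coordinates a and b of x are both at least 1/2, so the two preimages of x have
  coordinate b, respectively a, equal to 1 and are vertices; \<open>vertex_in_cell\<close> then
  determines the rest of both words.\<close>

lemma cell_Int_cell:
  assumes "v \<in> words n" "w \<in> words n" "v \<noteq> w" "x \<in> cell v" "x \<in> cell w"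
  shows "\<exists>u a b k. a \<in> {0,1,2} \<and> b \<in> {0,1,2} \<and> a \<noteq> b \<and> v = touching u a b k \<and> w = touching u b a k
           \<and> x = word_map v (sg_vertex b)"
  using assms
proof (induction n arbitrary: v w x)
  case (Suc n)
  from Suc.prems obtain a v' where v: "v = a # v'" "a \<in> {0,1,2}" "v' \<in> words n" by (elim words_SucE)
  from Suc.prems obtain b w' where w: "w = b # w'" "b \<in> {0,1,2}" "w' \<in> words n" by (elim words_SucE)
  obtain y where y: "x = sg_map a y" "y \<in> cell v'" using Suc.prems v by (auto simp: cell_def)
  obtain z where z: "x = sg_map b z" "z \<in> cell w'" using Suc.prems w by (auto simp: cell_def)
  have yz: "y \<in> gasket" "z \<in> gasket" using y z v w cell_subset_gasket by blast+
  show ?case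
  proof (cases "a = b")
    case True
    hence "y = z" using y z inj_sg_map[of a] by (simp add: inj_eq)
    moreover have "v' \<noteq> w'" using Suc.prems v w True by auto
    ultimately obtain u c d k where *: "c \<in> {0,1,2}" "d \<in> {0,1,2}" "c \<noteq> d" "v' = touching u c d k"
      "w' = touching u d c k" "y = word_map v' (sg_vertex d)"
      using Suc.IH[of v' w' y] v w y z by blast
    hence "v = touching (a # u) c d k" "w = touching (a # u) d c k" "x = word_map v (sg_vertex d)"
      using v w y True by (auto simp: touching_def)
    thus ?thesis using * by blast
  next
    case False
    have 1: "bary a x \<ge> 1/2" "bary b x \<ge> 1/2"
      using bary_sg_map[of a a y] bary_sg_map[of b b z] bary_nonneg[of y a] bary_nonneg[of z b] v w y z yz
      by auto
    have x: "x \<in> gasket" using y yz v sg_map_in_gasket by blast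
    have vert: "q = sg_vertex d" if q: "q \<in> gasket" and x_eq: "x = sg_map c q"
      and c: "c \<in> {0,1,2}" and d: "d \<in> {0,1,2}" and cd: "{a, b} = {c, d}" for q c d
    proof (rule bary_eq_1[OF q d])
      have "bary d x \<ge> 1/2" "c \<noteq> d" using 1 cd False by (auto simp: doubleton_eq_iff)
      hence "bary d q \<ge> 1" using bary_sg_map[OF d c, of q] x_eq by auto
      thus "bary d q = 1" using bary_le_1[OF q d] by simp
    qed
    have "y = sg_vertex b" using vert[of y a b] y yz v w by auto
    moreover have "z = sg_vertex a" using vert[of z b a] z yz v w by auto
    ultimately have "v' = replicate n b" "w' = replicate n a"
      using vertex_in_cell[of v' n b] vertex_in_cell[of w' n a] y z v w by auto
    hence "v = touching [] a b n" "w = touching [] b a n" "x = word_map v (sg_vertex b)"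
      using v w y \<open>y = sg_vertex b\<close> by (auto simp: touching_def)
    thus ?thesis using False v w by blast
  qed
qed auto

lemma word_map_touching: "word_map (touching u a b k) (sg_vertex b) = word_map (touching u b a k) (sg_vertex a)"
  by (simp add: touching_def word_map_append sg_map_vertex_swap)

lemma touching_in_words:
  assumes "touching u a b k \<in> words n"
  shows "u \<in> words (length u)" "a \<in> {0,1,2}" "n = length u + Suc k" "k > 0 \<Longrightarrow> b \<in> {0,1,2}"
  using assms by (auto simp: words_def touching_def)

lemma adjacent_iff:
  assumes "v \<in> words n" "w \<in> words n"
  shows "adjacent v w \<longleftrightarrow> (\<exists>u a b k. a \<in> {0,1,2} \<and> b \<in> {0,1,2} \<and> a \<noteq> b \<and> v = touching u a b k \<and> w = touching u b a k)"
proof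
  assume "adjacent v w"
  then obtain x where "v \<noteq> w" "x \<in> cell v" "x \<in> cell w" by (auto simp: adjacent_def)
  from cell_Int_cell[OF assms this]
  show "\<exists>u a b k. a \<in> {0,1,2} \<and> b \<in> {0,1,2} \<and> a \<noteq> b \<and> v = touching u a b k \<and> w = touching u b a k"
    by (elim exE conjE) (intro exI conjI)
next
  assume "\<exists>u a b k. a \<in> {0,1,2} \<and> b \<in> {0,1,2} \<and> a \<noteq> b \<and> v = touching u a b k \<and> w = touching u b a k"
  then obtain u a b k where *: "a \<in> {0,1,2}" "b \<in> {0,1,2}" "a \<noteq> b" "v = touching u a b k" "w = touching u b a k"
    by blast
  have "word_map v (sg_vertex b) \<in> cell v" "word_map w (sg_vertex a) \<in> cell w"
    using *(1,2) vertex_in_gasket by (auto simp: cell_def)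
  hence "cell v \<inter> cell w \<noteq> {}" using word_map_touching[of u a b k] * by auto
  moreover have "v \<noteq> w" using * by (auto simp: touching_def)
  ultimately show "adjacent v w" by (simp add: adjacent_def)
qed

lemma finite_cell_Int_cell:
  assumes "v \<in> words n" "w \<in> words n" "v \<noteq> w"
  shows "finite (cell v \<inter> cell w)"
proof (rule finite_subset)
  show "cell v \<inter> cell w \<subseteq> (\<lambda>b. word_map v (sg_vertex b)) ` {0,1,2}"
    using cell_Int_cell[OF assms] by blast
qed auto

subsection \<open>The Hausdorff measure of the gasket\<close>

lemma half_power_powr_dim: "((1/2) ^ n) powr (ln 3 / ln 2) = (1/3 :: real) ^ n"
proof -
  have "((1/2) ^ n) powr (ln 3 / ln 2) = exp (ln 3 / ln 2 * (real n * ln (1/2)))"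
    by (simp add: powr_def ln_realpow)
  also have "ln 3 / ln 2 * (real n * ln (1/2)) = real n * ln (1/3 :: real)"
    by (simp add: ln_div)
  also have "exp (real n * ln (1/3)) = (1/3 :: real) ^ n"
    by (subst exp_of_nat_mult) simp
  finally show ?thesis .
qed

lemma dim_pos: "0 < ln 3 / ln (2::real)"
  by simp

lemma diameter_cell_le: "w \<in> words n \<Longrightarrow> diameter (cell w) \<le> 2 * (1/2) ^ n"
  using dist_cell_le cell_nonempty[of w] by (intro diameter_le_dist) (auto simp: power_divide)

text \<open>The 3^n cells of level n have diameter at most 2 / 2^n. In dimension ln 3 / ln 2 each
  costs at most 2^s / 3^n, so the total 2^s does not depend on n.\<close>

lemma hausdorff_outer_gasket_le:
  "hausdorff_outer (ln 3 / ln 2) gasket \<le> ennreal (2 powr (ln 3 / ln 2))"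
  unfolding hausdorff_outer_def
proof (rule SUP_least)
  let ?s = "ln 3 / ln (2::real)"
  fix \<delta> :: real assume "\<delta> \<in> {0<..}"
  then obtain n where n: "2 / 2 ^ n < \<delta>"
    using order_tendstoD(2)[OF LIMSEQ_divide_pow2[of 2], of \<delta>] by (auto simp: eventually_sequentially)
  obtain f where f: "bij_betw f {0..<3 ^ n :: nat} (words n)"
    using ex_bij_betw_nat_finite[OF finite_words, of n] by (auto simp: card_words)
  have fw: "f i \<in> words n" if "i < 3 ^ n" for i
    using bij_betwE[OF f] that by auto
  define U where "U i = (if i < 3 ^ n then cell (f i) else {})" for i
  have diam: "diameter (U i) \<le> 2 * (1/2) ^ n" for i
    using diameter_cell_le[OF fw[of i]] by (auto simp: U_def)
  have bd: "bounded (U i)" for i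
    by (auto simp: U_def compact_imp_bounded[OF compact_cell])
  have "hausdorff_content ?s \<delta> gasket \<le> (\<Sum>i. ennreal (diameter (U i) powr ?s))"
  proof (rule hausdorff_content_le)
    show "gasket \<subseteq> (\<Union>i. U i)"
    proof
      fix x assume "x \<in> gasket"
      then obtain w where w: "w \<in> words n" "x \<in> cell w" using gasket_eq_UN_cell[of n] by auto
      have "w \<in> f ` {0..<3 ^ n}" using f w(1) by (simp add: bij_betw_def)
      then obtain i where i: "i < 3 ^ n" "w = f i" by auto
      hence "x \<in> U i" using w by (simp add: U_def)
      thus "x \<in> (\<Union>i. U i)" by (rule UN_I[OF UNIV_I])
    qed
    show "diameter (U i) \<le> \<delta>" for i using diam[of i] n by (simp add: power_divide)
  qed (rule bd)
  also have "\<dots> = (\<Sum>i<3 ^ n. ennreal (diameter (U i) powr ?s))"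
    by (intro suminf_finite) (auto simp: U_def)
  also have "\<dots> \<le> (\<Sum>i<3 ^ n::nat. ennreal (2 powr ?s * (1/3) ^ n))"
  proof (intro sum_mono ennreal_leI)
    fix i
    have "diameter (U i) powr ?s \<le> (2 * (1/2) ^ n) powr ?s"
      using diam[of i] diameter_ge_0[OF bd[of i]] dim_pos by (intro powr_mono2) auto
    also have "\<dots> = 2 powr ?s * (1/3) ^ n"
      by (subst powr_mult) (simp_all add: half_power_powr_dim del: power_one_over)
    finally show "diameter (U i) powr ?s \<le> 2 powr ?s * (1/3) ^ n" .
  qed
  also have "\<dots> = ennreal (\<Sum>i<3 ^ n::nat. 2 powr ?s * (1/3) ^ n)"
    by (rule sum_ennreal) auto
  also have "(\<Sum>i<3 ^ n::nat. 2 powr ?s * (1/3) ^ n) = 2 powr ?s"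
    by (simp add: power_divide)
  finally show "hausdorff_content ?s \<delta> gasket \<le> ennreal (2 powr ?s)" .
qed

section \<open>Positivity of the Hausdorff measure by counting cells\<close>

text \<open>The number whose binary digits mark the occurrences of the letter i; divided by 2^n it
  is the shift that \<open>word_map w\<close> adds to the barycentric coordinate i.\<close>

fun word_digit :: "nat \<Rightarrow> nat list \<Rightarrow> int" where
  "word_digit i [] = 0"
| "word_digit i (a # w) = word_digit i w + (if i = a then 2 ^ length w else 0)"

lemma bary_word_map:
  assumes "i \<in> {0,1,2}" "w \<in> words n"
  shows "bary i (word_map w x) = (bary i x + of_int (word_digit i w)) / 2 ^ n"
  using assms(2)
proof (induction n arbitrary: w)
  case (Suc n)
  then obtain a v where v: "w = a # v" "a \<in> {0,1,2}" "v \<in> words n" by (elim words_SucE)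
  thus ?case using bary_sg_map[OF assms(1) v(2), of "word_map v x"] Suc.IH[OF v(3)] length_words[OF v(3)]
    by (simp add: field_simps)
qed simp

text \<open>Equal digits send vertex 0 to the same point under both words. If the words differ,
  \<open>cell_Int_cell\<close> makes this point the image of vertex b under one and of vertex a
  under the other, with a and b distinct; by injectivity both would be 0.\<close>

lemma word_digit_inject:
  assumes v: "v \<in> words n" and w: "w \<in> words n"
    and eq: "word_digit 1 v = word_digit 1 w" "word_digit 2 v = word_digit 2 w"
  shows "v = w"
proof (rule ccontr)
  assume ne: "v \<noteq> w"
  let ?x = "word_map v (sg_vertex 0)"
  have x: "?x = word_map w (sg_vertex 0)"
    by (rule bary_eqI) (use bary_word_map[OF _ v] bary_word_map[OF _ w] eq in auto)
  have "?x \<in> cell v" using vertex_in_gasket[of 0] by (simp add: cell_def)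
  moreover have "?x \<in> cell w" unfolding x using vertex_in_gasket[of 0] by (simp add: cell_def)
  ultimately have "?x \<in> cell v" "?x \<in> cell w" .
  from cell_Int_cell[OF v w ne this] obtain u a b k where
    *: "a \<in> {0,1,2}" "b \<in> {0,1,2}" "a \<noteq> b" "v = touching u a b k" "w = touching u b a k"
      "?x = word_map v (sg_vertex b)" by (elim exE conjE)
  have inj_vertex: "i = j" if "sg_vertex i = sg_vertex j" "i \<in> {0,1,2}" "j \<in> {0,1,2}" for i j
    using bary_vertex[of i j] bary_vertex[of i i] that by (simp split: if_splits)
  have "sg_vertex 0 = sg_vertex b" using *(6) inj_word_map[of v] by (simp add: inj_eq)
  hence "b = 0" using inj_vertex[of 0 b] *(2) by simp
  have "word_map w (sg_vertex 0) = word_map w (sg_vertex a)"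
    using x *(4-6) word_map_touching[of u a b k] by metis
  hence "sg_vertex 0 = sg_vertex a" using inj_word_map[of w] by (simp add: inj_eq)
  hence "a = 0" using inj_vertex[of 0 a] *(1) by simp
  thus False using \<open>b = 0\<close> *(3) by simp
qed

lemma card_int_near: "finite {j. \<bar>of_int j - c\<bar> \<le> (8::real)}" "card {j. \<bar>of_int j - c\<bar> \<le> (8::real)} \<le> 18"
proof -
  have sub: "{j. \<bar>of_int j - c\<bar> \<le> 8} \<subseteq> {\<lfloor>c\<rfloor> - 8..\<lfloor>c\<rfloor> + 9}" by (auto; linarith)
  thus "finite {j. \<bar>of_int j - c\<bar> \<le> (8::real)}" by (rule finite_subset) auto
  have "card {j. \<bar>of_int j - c\<bar> \<le> 8} \<le> card {\<lfloor>c\<rfloor> - 8..\<lfloor>c\<rfloor> + 9}"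
    using sub by (intro card_mono) auto
  thus "card {j. \<bar>of_int j - c\<bar> \<le> (8::real)} \<le> 18" by simp
qed

text \<open>Distinct cells of generation \<open>k\<close> sit at distinct points of a lattice of mesh \<open>2\<^sup>-\<^sup>k\<close>.\<close>

lemma card_cells_near_le:
  assumes "\<And>x. x \<in> V \<Longrightarrow> dist x z \<le> 2 / 2 ^ k"
  shows "card {w \<in> words k. cell w \<inter> V \<noteq> {}} \<le> 324"
proof -
  let ?S = "{w \<in> words k. cell w \<inter> V \<noteq> {}}"
  let ?I = "\<lambda>i. {j. \<bar>of_int j - bary i z * 2 ^ k\<bar> \<le> (8::real)}"
  have "word_digit i w \<in> ?I i" if w: "w \<in> ?S" and i: "i \<in> {1, 2}" for w i
  proof -
    obtain x where x: "x \<in> cell w" "x \<in> V" using w by blast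
    have wk: "w \<in> words k" using w by simp
    have "word_map w (sg_vertex 0) \<in> cell w" using vertex_in_gasket[of 0] by (simp add: cell_def)
    hence "dist (word_map w (sg_vertex 0)) x \<le> 2 / 2 ^ k" using dist_cell_le[OF wk] x by blast
    hence d: "dist (word_map w (sg_vertex 0)) z \<le> 4 / 2 ^ k"
      using assms[OF x(2)] dist_triangle[of "word_map w (sg_vertex 0)" z x] by simp
    \<comment> \<open>The distance 4 / 2^k is one cell diameter plus the assumed distance to z, and
      the coordinates are 2-Lipschitz. A digit error of at most 8 leaves at most 18 values, and two
      digits determine the word: 18 * 18 = 324.\<close>
    have "\<bar>bary i (word_map w (sg_vertex 0)) - bary i z\<bar> \<le> 8 / 2 ^ k"
      using bary_lipschitz[of i "word_map w (sg_vertex 0)" z] d by simp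
    moreover have "bary i (word_map w (sg_vertex 0)) = of_int (word_digit i w) / 2 ^ k"
      using bary_word_map[OF _ wk, of i "sg_vertex 0"] bary_vertex[of i 0] i by auto
    ultimately have "\<bar>of_int (word_digit i w) / 2 ^ k - bary i z\<bar> * 2 ^ k \<le> (8 / 2 ^ k) * 2 ^ k"
      by (intro mult_right_mono) auto
    moreover have "\<bar>of_int (word_digit i w) / 2 ^ k - bary i z\<bar> * 2 ^ k = \<bar>of_int (word_digit i w) - bary i z * 2 ^ k\<bar>"
    proof -
      have "\<bar>of_int (word_digit i w) / 2 ^ k - bary i z\<bar> * \<bar>2 ^ k\<bar> = \<bar>of_int (word_digit i w) - bary i z * 2 ^ k\<bar>"
        unfolding abs_mult[symmetric] by (simp add: left_diff_distrib)
      thus ?thesis by simp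
    qed
    ultimately show ?thesis by simp
  qed
  hence sub: "(\<lambda>w. (word_digit 1 w, word_digit 2 w)) ` ?S \<subseteq> ?I 1 \<times> ?I 2" by auto
  have "inj_on (\<lambda>w. (word_digit 1 w, word_digit 2 w)) ?S"
    by (rule inj_onI) (use word_digit_inject in auto)
  hence "card ?S \<le> card (?I 1 \<times> ?I 2)"
    by (rule card_inj_on_le[OF _ sub]) (intro finite_cartesian_product card_int_near)
  also have "\<dots> \<le> 18 * 18" unfolding card_cartesian_product by (intro mult_mono card_int_near) auto
  finally show ?thesis by simp
qed

text \<open>For d > 0 take the dyadic scale with 2^-(k+1) <= d < 2^-k, so that 3^-k <= 3 d^s. The
  bound d <= 1/2 guarantees that such a k is a natural number. For d = 0 no scale is distinguished,
  and the slack e allows any sufficiently large k.\<close>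

lemma ex_scale:
  fixes d e :: real
  assumes d: "0 \<le> d" "d \<le> 1/2" and e: "0 < e"
  shows "\<exists>k. d < (1/2) ^ k \<and> (1/3) ^ k \<le> 3 * d powr (ln 3 / ln 2) + e"
proof (cases "d = 0")
  case True
  obtain k where "(1/3 :: real) ^ k < e" using real_arch_pow_inv[OF e, of "1/3"] by auto
  thus ?thesis using True by (intro exI[of _ k]) auto
next
  case False
  obtain m where m: "(1/2 :: real) ^ m < d" using real_arch_pow_inv[of d "1/2"] d False by auto
  define n where "n = (LEAST n. (1/2 :: real) ^ n \<le> d)"
  have n: "(1/2) ^ n \<le> d" unfolding n_def by (rule LeastI[of _ m]) (use m in simp)
  have "n \<noteq> 0"
  proof
    assume "n = 0"
    thus False using n d by simp
  qed
  then obtain k where k: "n = Suc k" by (cases n) auto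
  have "\<not> (1/2) ^ k \<le> d" using not_less_Least[of k "\<lambda>n. (1/2 :: real) ^ n \<le> d"] k by (simp add: n_def)
  moreover have "(1/3) ^ n \<le> d powr (ln 3 / ln 2)"
    unfolding half_power_powr_dim[symmetric] using n by (intro powr_mono2) auto
  ultimately show ?thesis using e k by (intro exI[of _ k]) auto
qed

text \<open>From a cheap cover, each \<open>U i\<close> is fattened to an open set
  \<open>V i\<close> at its own scale 2^-(k i). Compactness leaves finitely many of them, and each
  meets at most 324 cells of level \<open>k i\<close>. Counting their descendants at a common level
  \<open>N\<close> gives 1 <= 324 * (sum of the 3^-(k i)), while cheapness makes this sum too
  small.\<close>

lemma hausdorff_content_gasket_pos: "ennreal (1/2000) \<le> hausdorff_content (ln 3 / ln 2) (1/2) gasket"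
proof (rule ccontr)
  let ?s = "ln 3 / ln (2::real)"
  assume "\<not> ?thesis"
  hence "hausdorff_content ?s (1/2) gasket < ennreal (1/2000)" by simp
  then obtain U :: "nat \<Rightarrow> (real^2) set" where U: "gasket \<subseteq> (\<Union>i. U i)" "\<And>i. bounded (U i)"
    "\<And>i. diameter (U i) \<le> 1/2" "(\<Sum>i. ennreal (diameter (U i) powr ?s)) < ennreal (1/2000)"
    by (rule hausdorff_content_cover) blast
  have "\<exists>k. diameter (U i) < (1/2) ^ k \<and> (1/3) ^ k \<le> 3 * diameter (U i) powr ?s + (1/2000) * (1/2) ^ Suc i" for i
    using diameter_ge_0[OF U(2)] U(3) by (intro ex_scale) auto
  then obtain k where k: "\<And>i. diameter (U i) < (1/2) ^ k i"
      "\<And>i. (1/3) ^ k i \<le> 3 * diameter (U i) powr ?s + (1/2000) * (1/2) ^ Suc i"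
    by metis
  define V where "V i = (\<Union>x\<in>U i. ball x ((1/2) ^ k i))" for i
  have near: "card {w \<in> words (k i). cell w \<inter> V i \<noteq> {}} \<le> 324" for i
  proof (cases "U i = {}")
    case False
    then obtain z where z: "z \<in> U i" by blast
    show ?thesis
    proof (rule card_cells_near_le)
      fix x assume "x \<in> V i"
      then obtain y where y: "y \<in> U i" "dist y x < (1/2) ^ k i" by (auto simp: V_def)
      have "dist y z \<le> diameter (U i)" by (rule diameter_bounded_bound[OF U(2) y(1) z])
      hence "dist x z \<le> (1/2) ^ k i + (1/2) ^ k i"
        using k(1)[of i] y(2) dist_triangle[of x z y] by (simp add: dist_commute)
      thus "dist x z \<le> 2 / 2 ^ k i" by (simp add: power_divide)
    qed
  qed (simp add: V_def)
  have "\<And>i. i \<in> UNIV \<Longrightarrow> open (V i)" by (auto simp: V_def)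
  moreover have "gasket \<subseteq> (\<Union>i\<in>UNIV. V i)"
  proof
    fix x assume "x \<in> gasket"
    then obtain i where "x \<in> U i" using U(1) by auto
    hence "x \<in> V i" by (auto simp: V_def intro!: bexI[of _ x])
    thus "x \<in> (\<Union>i. V i)" by (rule UN_I[OF UNIV_I])
  qed
  ultimately obtain I where I: "finite I" "gasket \<subseteq> (\<Union>i\<in>I. V i)"
    using compactE_image[OF gasket(1), of UNIV V] by metis
  \<comment> \<open>The sum is only a convenient level that is at least every \<open>k i\<close>;
    each cell of level \<open>k i\<close> has 3^(N - k i) descendants there.\<close>
  define N where "N = (\<Sum>i\<in>I. k i)"
  have kN: "k i \<le> N" if "i \<in> I" for i unfolding N_def using that I(1) by (intro member_le_sum) auto
  let ?W = "\<lambda>i. {w \<in> words (k i). cell w \<inter> V i \<noteq> {}}"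
  have "words N \<subseteq> (\<Union>i\<in>I. (\<lambda>(v, u). v @ u) ` (?W i \<times> words (N - k i)))"
  proof
    fix w assume w: "w \<in> words N"
    obtain x where x: "x \<in> cell w" using cell_nonempty by blast
    hence "x \<in> gasket" using cell_subset_gasket[OF w] by blast
    then obtain i where i: "i \<in> I" "x \<in> V i" using I by blast
    obtain v u where vu: "w = v @ u" "v \<in> words (k i)" "u \<in> words (N - k i)"
      using w words_add[of "k i" "N - k i"] kN[OF i(1)] by auto
    have "x \<in> cell v" using x vu cell_append_subset[OF vu(3)] by blast
    hence "v \<in> ?W i" using vu i by blast
    thus "w \<in> (\<Union>i\<in>I. (\<lambda>(v, u). v @ u) ` (?W i \<times> words (N - k i)))"
      using i vu by (intro UN_I[OF i(1)] image_eqI[of _ _ "(v, u)"]) auto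
  qed
  hence "card (words N) \<le> card (\<Union>i\<in>I. (\<lambda>(v, u). v @ u) ` (?W i \<times> words (N - k i)))"
    by (intro card_mono finite_UN_I finite_imageI finite_cartesian_product I) auto
  also have "\<dots> \<le> (\<Sum>i\<in>I. card ((\<lambda>(v, u). v @ u) ` (?W i \<times> words (N - k i))))"
    by (rule card_UN_le[OF I(1)])
  also have "\<dots> \<le> (\<Sum>i\<in>I. 324 * 3 ^ (N - k i))"
  proof (rule sum_mono)
    fix i assume "i \<in> I"
    have "card ((\<lambda>(v, u). v @ u) ` (?W i \<times> words (N - k i))) \<le> card (?W i \<times> words (N - k i))"
      by (intro card_image_le finite_cartesian_product) auto
    also have "\<dots> \<le> 324 * 3 ^ (N - k i)" using near by (simp add: card_cartesian_product card_words)
    finally show "card ((\<lambda>(v, u). v @ u) ` (?W i \<times> words (N - k i))) \<le> 324 * 3 ^ (N - k i)" .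
  qed
  finally have "3 ^ N \<le> (\<Sum>i\<in>I. 324 * 3 ^ (N - k i) :: nat)" by (simp add: card_words)
  hence "real (3 ^ N) \<le> real (\<Sum>i\<in>I. 324 * 3 ^ (N - k i))" by (rule of_nat_mono)
  also have "\<dots> = (\<Sum>i\<in>I. 3 ^ N * (324 * (1/3) ^ k i))"
    unfolding of_nat_sum
  proof (intro sum.cong refl)
    fix i assume "i \<in> I"
    hence "(3 :: real) ^ (N - k i) = 3 ^ N / 3 ^ k i" by (simp add: power_diff kN)
    thus "real (324 * 3 ^ (N - k i)) = 3 ^ N * (324 * (1/3) ^ k i)" by (simp add: power_divide)
  qed
  also have "\<dots> = 3 ^ N * (324 * (\<Sum>i\<in>I. (1/3) ^ k i))" by (simp add: sum_distrib_left)
  finally have ge: "1 \<le> 324 * (\<Sum>i\<in>I. (1/3 :: real) ^ k i)" by simp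
  have sums: "summable (\<lambda>i. diameter (U i) powr ?s)"
    using U(4) by (intro summable_suminf_not_top) auto
  have tot: "(\<Sum>i. diameter (U i) powr ?s) < 1/2000"
  proof -
    have "ennreal (\<Sum>i. diameter (U i) powr ?s) = (\<Sum>i. ennreal (diameter (U i) powr ?s))"
      by (rule suminf_ennreal2[symmetric]) (use sums in auto)
    hence "ennreal (\<Sum>i. diameter (U i) powr ?s) < ennreal (1/2000)" using U(4) by (simp only:)
    thus ?thesis by (subst (asm) ennreal_less_iff) (auto intro: suminf_nonneg sums)
  qed
  have "(\<Sum>i\<in>I. (1/3 :: real) ^ k i) \<le> (\<Sum>i\<in>I. 3 * diameter (U i) powr ?s + (1/2000) * (1/2) ^ Suc i)"
    by (intro sum_mono k(2))
  also have "\<dots> = 3 * (\<Sum>i\<in>I. diameter (U i) powr ?s) + (1/2000) * (\<Sum>i\<in>I. (1/2) ^ Suc i)"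
    by (simp only: sum.distrib sum_distrib_left)
  also have "\<dots> \<le> 3 * (\<Sum>i. diameter (U i) powr ?s) + (1/2000) * (\<Sum>i. (1/2) ^ Suc i)"
    using I(1) sums sums_summable[OF power_half_series]
    by (intro add_mono mult_left_mono sum_le_suminf) auto
  also have "(\<Sum>i. (1/2 :: real) ^ Suc i) = 1" using sums_unique[OF power_half_series] by simp
  \<comment> \<open>The sum is below 3/2000 + 1/2000, the second summand being the total slack, and
    324 * 4/2000 < 1.\<close>
  finally show False using ge tot by simp
qed

lemma hausdorff_outer_gasket_pos: "0 < hausdorff_outer (ln 3 / ln 2) gasket"
proof -
  have "0 < ennreal (1/2000)" by simp
  also have "\<dots> \<le> hausdorff_outer (ln 3 / ln 2) gasket"
    by (rule order_trans[OF hausdorff_content_gasket_pos hausdorff_content_le_outer]) simp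
  finally show ?thesis .
qed

text \<open>Both inequalities are Lipschitz estimates: one for \<open>word_map w\<close> with ratio
  2^-n, the other for its inverse on the whole plane with ratio 2^n.\<close>

lemma hausdorff_outer_word_map:
  "hausdorff_outer (ln 3 / ln 2) (word_map w ` A) = ennreal ((1/3) ^ length w) * hausdorff_outer (ln 3 / ln 2) A"
proof (rule antisym)
  let ?s = "ln 3 / ln (2::real)" and ?n = "length w"
  have p: "(1/3 :: real) ^ ?n = (1/2 ^ ?n) powr ?s"
    using half_power_powr_dim[of ?n] by (simp add: power_divide)
  show "hausdorff_outer ?s (word_map w ` A) \<le> ennreal ((1/3) ^ ?n) * hausdorff_outer ?s A"
    unfolding p by (rule hausdorff_outer_image_le) (use dim_pos in \<open>auto simp: dist_word_map\<close>)
  let ?g = "inv_into UNIV (word_map w)"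
  have surj: "\<exists>x. y = sg_map i x" for i y
    by (intro exI[of _ "2 *\<^sub>R y - sg_vertex i"]) (simp add: sg_map_def)
  have "\<exists>x. y = word_map w x" for y
  proof (induction w arbitrary: y)
    case (Cons a w)
    obtain x where "y = sg_map a x" using surj by blast
    moreover obtain z where "x = word_map w z" using Cons by blast
    ultimately show ?case by auto
  qed auto
  hence "surj (word_map w)" unfolding surj_def by blast
  hence wg: "word_map w (?g y) = y" for y by (rule surj_f_inv_f)
  have gw: "?g (word_map w x) = x" for x using inj_word_map by (rule inv_f_f)
  have dg: "dist (?g x) (?g y) \<le> 2 ^ ?n * dist x y" for x y
    using dist_word_map[of w "?g x" "?g y"] by (simp add: wg)
  have "hausdorff_outer ?s (?g ` (word_map w ` A)) \<le> ennreal ((2 ^ ?n) powr ?s) * hausdorff_outer ?s (word_map w ` A)"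
    by (rule hausdorff_outer_image_le) (use dg dim_pos in auto)
  moreover have "?g ` (word_map w ` A) = A" by (simp add: image_comp gw o_def)
  moreover have "(2 ^ ?n) powr ?s = (3 :: real) ^ ?n"
  proof -
    have "(2 ^ ?n) powr ?s * (1/2 ^ ?n) powr ?s = (1 :: real)" by (subst powr_mult[symmetric]) auto
    thus ?thesis unfolding p[symmetric] by (simp add: power_divide field_simps)
  qed
  ultimately have "hausdorff_outer ?s A \<le> ennreal (3 ^ ?n) * hausdorff_outer ?s (word_map w ` A)" by simp
  hence "ennreal ((1/3) ^ ?n) * hausdorff_outer ?s A \<le> ennreal ((1/3) ^ ?n) * (ennreal (3 ^ ?n) * hausdorff_outer ?s (word_map w ` A))"
    by (intro mult_left_mono) auto
  also have "\<dots> = ennreal ((1/3) ^ ?n * 3 ^ ?n) * hausdorff_outer ?s (word_map w ` A)"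
    by (simp add: mult.assoc[symmetric] flip: ennreal_mult)
  also have "(1/3) ^ ?n * 3 ^ ?n = (1 :: real)" by (simp flip: power_mult_distrib)
  finally show "ennreal ((1/3) ^ ?n) * hausdorff_outer ?s A \<le> hausdorff_outer ?s (word_map w ` A)" by simp
qed

subsection \<open>The normalized measure\<close>

lemma gasket_borel [measurable]: "gasket \<in> sets borel"
  using compact_imp_closed[OF gasket(1)] by (rule borel_closed)

lemma space_sg_measure [simp]: "space sg_measure = gasket"
  by (simp add: sg_measure_def Let_def space_scale_measure space_restrict_space)

lemma sets_sg_measure: "sets sg_measure = sets (restrict_space borel gasket)"
  by (simp add: sg_measure_def Let_def cong: sets_restrict_space_cong)

lemma in_sets_sg_measure: "A \<in> sets sg_measure \<longleftrightarrow> A \<in> sets borel \<and> A \<subseteq> gasket"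
  unfolding sets_sg_measure by (subst sets_restrict_space_iff) auto

lemma emeasure_sg_measure:
  assumes "A \<in> sets sg_measure"
  shows "emeasure sg_measure A = hausdorff_outer (ln 3 / ln 2) A / hausdorff_outer (ln 3 / ln 2) gasket"
proof -
  have A: "A \<in> sets borel" "A \<subseteq> gasket" using assms by (auto simp: in_sets_sg_measure)
  let ?H = "hausdorff_measure (ln 3 / ln 2) :: (real^2) measure"
  have "emeasure sg_measure A = (1 / emeasure ?H gasket) * emeasure (restrict_space ?H gasket) A"
    by (simp add: sg_measure_def Let_def)
  also have "emeasure (restrict_space ?H gasket) A = emeasure ?H A"
    using A by (intro emeasure_restrict_space) auto
  finally show ?thesis
    using A by (simp add: emeasure_hausdorff_measure ennreal_times_divide mult.commute)
qed

lemma emeasure_sg_measure_gasket: "emeasure sg_measure gasket = 1"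
proof -
  have "hausdorff_outer (ln 3 / ln 2) gasket < top"
    using hausdorff_outer_gasket_le by (rule order.strict_trans1) simp
  thus ?thesis using hausdorff_outer_gasket_pos
    by (subst emeasure_sg_measure) (auto simp: in_sets_sg_measure)
qed

interpretation sg: finite_measure sg_measure
  by (rule finite_measureI) (simp add: emeasure_sg_measure_gasket)

lemma measure_sg_measure_gasket [simp]: "measure sg_measure gasket = 1"
  by (simp add: measure_def emeasure_sg_measure_gasket)

lemma word_map_image_sets:
  assumes "A \<in> sets sg_measure" "w \<in> words n"
  shows "word_map w ` A \<in> sets sg_measure"
proof -
  have A: "A \<in> sets borel" "A \<subseteq> gasket" using assms by (auto simp: in_sets_sg_measure)
  have "word_map w ` A \<in> sets borel"
  proof (induction w)
    case (Cons a w)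
    \<comment> \<open>Written as a preimage under the affine inverse map, the image is visibly
      Borel.\<close>
    have "sg_map a ` word_map w ` A = (\<lambda>x. 2 *\<^sub>R x - sg_vertex a) -` (word_map w ` A) \<inter> space borel"
    proof (intro set_eqI iffI)
      fix y assume "y \<in> (\<lambda>x. 2 *\<^sub>R x - sg_vertex a) -` (word_map w ` A) \<inter> space borel"
      hence "2 *\<^sub>R y - sg_vertex a \<in> word_map w ` A" by simp
      moreover have "y = sg_map a (2 *\<^sub>R y - sg_vertex a)" by (simp add: sg_map_def)
      ultimately show "y \<in> sg_map a ` word_map w ` A" by (metis imageI)
    qed (auto simp: sg_map_def)
    also have "\<dots> \<in> sets borel" by (rule measurable_sets[OF _ Cons.IH]) measurable
    finally show ?case by (simp add: image_comp)
  qed (use A in simp)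
  moreover have "word_map w ` A \<subseteq> gasket" using A word_map_in_gasket[OF assms(2)] by blast
  ultimately show ?thesis by (simp add: in_sets_sg_measure)
qed

lemma emeasure_word_map_image:
  assumes "A \<in> sets sg_measure" "w \<in> words n"
  shows "emeasure sg_measure (word_map w ` A) = ennreal ((1/3) ^ n) * emeasure sg_measure A"
  using emeasure_sg_measure[OF word_map_image_sets[OF assms]] emeasure_sg_measure[OF assms(1)]
  by (simp add: hausdorff_outer_word_map length_words[OF assms(2)] ennreal_times_divide)

lemma cell_sets [measurable]: "w \<in> words n \<Longrightarrow> cell w \<in> sets sg_measure"
  unfolding cell_def by (rule word_map_image_sets) (auto simp: in_sets_sg_measure)

lemma measure_cell: "w \<in> words n \<Longrightarrow> measure sg_measure (cell w) = (1/3) ^ n"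
  unfolding cell_def measure_def
  by (subst emeasure_word_map_image) (auto simp: in_sets_sg_measure emeasure_sg_measure_gasket)

lemma finite_null_sets:
  assumes "finite A" "A \<subseteq> gasket"
  shows "A \<in> null_sets sg_measure"
proof (rule null_setsI)
  show A: "A \<in> sets sg_measure"
    using assms by (auto simp: in_sets_sg_measure intro: finite_imp_closed borel_closed)
  show "emeasure sg_measure A = 0"
    using assms by (subst emeasure_sg_measure[OF A]) (simp add: hausdorff_outer_finite)
qed

lemma measurable_word_map: "w \<in> words n \<Longrightarrow> word_map w \<in> sg_measure \<rightarrow>\<^sub>M sg_measure"
proof -
  assume w: "w \<in> words n"
  have "word_map w \<in> restrict_space borel gasket \<rightarrow>\<^sub>M restrict_space borel gasket"
    using word_map_in_gasket[OF w]
    by (intro measurable_restrict_space3 borel_measurable_continuous_onI continuous_on_word_map) auto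
  thus ?thesis by (simp add: measurable_cong_sets[OF sets_sg_measure sets_sg_measure])
qed

lemma borel_measurable_continuous_gasket:
  "continuous_on gasket g \<Longrightarrow> g \<in> borel_measurable sg_measure"
  unfolding measurable_cong_sets[OF sets_sg_measure refl]
  by (rule borel_measurable_continuous_on_restrict)

text \<open>Self-similarity of the measure as a change of variables: the density 3^n cancels the
  factor (1/3)^n by which \<open>word_map w\<close> scales measures. Integrals over a cell thereby
  become integrals over the whole gasket.\<close>

lemma distr_word_map:
  assumes w: "w \<in> words n"
  shows "distr sg_measure sg_measure (word_map w) = density sg_measure (\<lambda>x. ennreal (3 ^ n * indicator (cell w) x))"
proof (rule measure_eqI)
  fix A assume "A \<in> sets (distr sg_measure sg_measure (word_map w))"
  hence A: "A \<in> sets sg_measure" by simp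
  let ?B = "word_map w -` A \<inter> gasket"
  have B: "?B \<in> sets sg_measure" using measurable_sets[OF measurable_word_map[OF w] A] by simp
  have im: "word_map w ` ?B = cell w \<inter> A" by (auto simp: cell_def)
  have "emeasure (density sg_measure (\<lambda>x. ennreal (3 ^ n * indicator (cell w) x))) A
     = (\<integral>\<^sup>+x. ennreal (3 ^ n * indicator (cell w) x) * indicator A x \<partial>sg_measure)"
    using A cell_sets[OF w] by (intro emeasure_density) auto
  also have "\<dots> = (\<integral>\<^sup>+x. ennreal (3 ^ n) * indicator (cell w \<inter> A) x \<partial>sg_measure)"
    by (intro nn_integral_cong) (auto simp: indicator_def)
  also have "\<dots> = ennreal (3 ^ n) * emeasure sg_measure (word_map w ` ?B)"
    unfolding im using A cell_sets[OF w] by (subst nn_integral_cmult_indicator) auto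
  also have "\<dots> = ennreal (3 ^ n * (1/3) ^ n) * emeasure sg_measure ?B"
    unfolding emeasure_word_map_image[OF B w] by (simp add: mult.assoc[symmetric] flip: ennreal_mult)
  also have "3 ^ n * (1/3) ^ n = (1 :: real)" by (simp flip: power_mult_distrib)
  also have "ennreal 1 * emeasure sg_measure ?B = emeasure (distr sg_measure sg_measure (word_map w)) A"
    using A by (subst emeasure_distr) (auto simp: measurable_word_map[OF w])
  finally show "emeasure (distr sg_measure sg_measure (word_map w)) A =
    emeasure (density sg_measure (\<lambda>x. ennreal (3 ^ n * indicator (cell w) x))) A" by simp
qed simp

lemma integrable_comp_word_map:
  assumes u: "integrable sg_measure u" and w: "w \<in> words n"
  shows "integrable sg_measure (\<lambda>x. u (word_map w x) :: real)"
proof -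
  have [measurable]: "u \<in> borel_measurable sg_measure" using u by auto
  have "integrable (distr sg_measure sg_measure (word_map w)) u"
    unfolding distr_word_map[OF w]
  proof (subst integrable_density)
    have "integrable sg_measure (\<lambda>x. 3 ^ n * (indicator (cell w) x *\<^sub>R u x))"
      using u cell_sets[OF w] by (intro integrable_mult_right integrable_mult_indicator)
    thus "integrable sg_measure (\<lambda>x. (3 ^ n * indicator (cell w) x) *\<^sub>R u x)" by (simp add: mult.assoc)
  qed (use cell_sets[OF w] in auto)
  thus ?thesis by (subst (asm) integrable_distr_eq) (auto intro: measurable_word_map[OF w])
qed

lemma cell_average_eq:
  assumes u: "integrable sg_measure u" and w: "w \<in> words n"
  shows "cell_average u w = (\<integral>x. u (word_map w x) \<partial>sg_measure)"
proof -
  have [measurable]: "u \<in> borel_measurable sg_measure" using u by auto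
  have "(\<integral>x. u (word_map w x) \<partial>sg_measure) = (\<integral>x. u x \<partial>distr sg_measure sg_measure (word_map w))"
    by (rule integral_distr[symmetric]) (auto intro: measurable_word_map[OF w])
  also have "\<dots> = (\<integral>x. (3 ^ n * indicator (cell w) x) *\<^sub>R u x \<partial>sg_measure)"
    unfolding distr_word_map[OF w] by (rule integral_density) (use cell_sets[OF w] in auto)
  also have "\<dots> = 3 ^ n * (LINT x:cell w|sg_measure. u x)"
    unfolding set_lebesgue_integral_def by (subst integral_mult_right_zero[symmetric]) (simp add: mult_ac)
  finally show ?thesis unfolding cell_average_def measure_cell[OF w] by (simp add: power_divide)
qed

text \<open>Two distinct cells of one level share finitely many points. Outside the union of these
  finite null sets, at most one cell of \<open>S\<close> contains x.\<close>

lemma AE_indicator_cells: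
  assumes "S \<subseteq> words n"
  shows "AE x in sg_measure. indicator (\<Union>w\<in>S. cell w) x = (\<Sum>w\<in>S. indicator (cell w) x :: real)"
proof -
  let ?N = "\<Union>(v, w)\<in>{(v, w). v \<in> words n \<and> w \<in> words n \<and> v \<noteq> w}. cell v \<inter> cell w"
  have "finite ?N"
    by (rule finite_UN_I, rule finite_subset[of _ "words n \<times> words n"]) (auto intro: finite_cell_Int_cell)
  moreover have "?N \<subseteq> gasket" using cell_subset_gasket by blast
  ultimately have "AE x in sg_measure. x \<notin> ?N" by (intro AE_not_in finite_null_sets)
  thus ?thesis
  proof (rule AE_mp, intro AE_I2 impI)
    fix x assume x: "x \<notin> ?N"
    have fin: "finite S" using finite_subset[OF assms] by simp
    show "indicator (\<Union>w\<in>S. cell w) x = (\<Sum>w\<in>S. indicator (cell w) x :: real)"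
    proof (cases "\<exists>w\<in>S. x \<in> cell w")
      case True
      then obtain w where w: "w \<in> S" "x \<in> cell w" by blast
      have "(\<Sum>v\<in>S. indicator (cell v) x :: real) = (\<Sum>v\<in>S. if v = w then 1 else 0)"
      proof (intro sum.cong refl)
        fix v assume v: "v \<in> S"
        show "indicator (cell v) x = (if v = w then 1 else 0 :: real)"
          using x v w assms by (auto simp: indicator_def)
      qed
      thus ?thesis using w fin by (auto simp: indicator_def)
    qed (auto simp: indicator_def)
  qed
qed

lemma integral_cells:
  assumes u: "integrable sg_measure u" and S: "S \<subseteq> words n"
  shows "(\<integral>x. indicator (\<Union>w\<in>S. cell w) x * u x \<partial>sg_measure) = (\<Sum>w\<in>S. cell_average u w) / 3 ^ n"
proof -
  have fin: "finite S" using finite_subset[OF S] by simp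
  have cs: "cell w \<in> sets sg_measure" if "w \<in> S" for w using S that cell_sets by blast
  have [measurable]: "u \<in> borel_measurable sg_measure" using u by auto
  have i: "integrable sg_measure (\<lambda>x. indicator (cell w) x * u x)" if "w \<in> S" for w
    using integrable_mult_indicator[OF cs[OF that] u] by simp
  have "(\<integral>x. indicator (\<Union>w\<in>S. cell w) x * u x \<partial>sg_measure)
      = (\<integral>x. (\<Sum>w\<in>S. indicator (cell w) x * u x) \<partial>sg_measure)"
  proof (rule integral_cong_AE)
    show "AE x in sg_measure. indicator (\<Union>w\<in>S. cell w) x * u x = (\<Sum>w\<in>S. indicator (cell w) x * u x)"
      using AE_indicator_cells[OF S] by eventually_elim (simp add: sum_distrib_right)
    have "(\<Union>w\<in>S. cell w) \<in> sets sg_measure" using fin cs by (intro sets.finite_UN) auto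
    thus "(\<lambda>x. indicator (\<Union>w\<in>S. cell w) x * u x) \<in> borel_measurable sg_measure" by measurable
    show "(\<lambda>x. \<Sum>w\<in>S. indicator (cell w) x * u x) \<in> borel_measurable sg_measure"
      using i by (intro borel_measurable_sum) auto
  qed
  also have "\<dots> = (\<Sum>w\<in>S. \<integral>x. indicator (cell w) x * u x \<partial>sg_measure)"
    by (rule Bochner_Integration.integral_sum) (rule i)
  also have "\<dots> = (\<Sum>w\<in>S. cell_average u w / 3 ^ n)"
  proof (intro sum.cong refl)
    fix w assume "w \<in> S"
    thus "(\<integral>x. indicator (cell w) x * u x \<partial>sg_measure) = cell_average u w / 3 ^ n"
      using measure_cell[of w n] S
      by (auto simp: cell_average_def set_lebesgue_integral_def power_divide)
  qed
  finally show ?thesis by (simp add: sum_divide_distrib)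
qed

lemma integral_gasket_eq:
  assumes "integrable sg_measure u"
  shows "(\<integral>x. u x \<partial>sg_measure) = (\<Sum>w\<in>words n. cell_average u w) / 3 ^ n"
proof -
  have "(\<integral>x. u x \<partial>sg_measure) = (\<integral>x. indicator (\<Union>w\<in>words n. cell w) x * u x \<partial>sg_measure)"
    by (intro Bochner_Integration.integral_cong refl) (simp add: gasket_eq_UN_cell[of n, symmetric])
  thus ?thesis using integral_cells[OF assms order.refl] by simp
qed

lemma cell_average_mean:
  assumes u: "integrable sg_measure u" and w: "w \<in> words n"
  shows "cell_average u w = (\<Sum>a\<in>{0,1,2}. cell_average u (w @ [a])) / 3"
proof -
  let ?v = "\<lambda>x. u (word_map w x)"
  have v: "integrable sg_measure ?v" by (rule integrable_comp_word_map[OF u w])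
  have "cell_average ?v [a] = cell_average u (w @ [a])" if "a \<in> {0,1,2}" for a
  proof -
    have "[a] \<in> words (Suc 0)" "w @ [a] \<in> words (Suc n)" using that w by auto
    thus ?thesis using cell_average_eq[OF v, of "[a]" "Suc 0"] cell_average_eq[OF u, of "w @ [a]" "Suc n"]
      by (simp add: word_map_append)
  qed
  moreover have "cell_average u w = (\<Sum>a\<in>{0,1,2}. cell_average ?v [a]) / 3"
    unfolding cell_average_eq[OF u w] using integral_gasket_eq[OF v, of "Suc 0"] by (simp add: words_1)
  ultimately show ?thesis by simp
qed

lemma L2_integrable:
  assumes "u \<in> L2 sg_measure"
  shows "integrable sg_measure u"
proof (rule Bochner_Integration.integrable_bound)
  show "integrable sg_measure (\<lambda>x. 1 + (u x)\<^sup>2)" using assms by (auto simp: L2_def)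
  show "u \<in> borel_measurable sg_measure" using assms by (auto simp: L2_def)
  have "\<bar>t\<bar> \<le> 1 + t\<^sup>2" for t :: real
  proof -
    have "0 \<le> (\<bar>t\<bar> - 1)\<^sup>2" "0 \<le> t\<^sup>2" by auto
    thus ?thesis by (simp add: power2_diff) 
  qed
  thus "AE x in sg_measure. norm (u x) \<le> norm (1 + (u x)\<^sup>2)" by simp
qed

subsection \<open>Energies of functions on words\<close>

definition adj_pairs :: "nat \<Rightarrow> (nat list \<times> nat list) set" where
  "adj_pairs n = {(v, w). v \<in> words n \<and> w \<in> words n \<and> adjacent v w}"

definition pair_energy :: "nat \<Rightarrow> (nat list \<Rightarrow> real) \<Rightarrow> real" where
  "pair_energy n A = (\<Sum>(v, w)\<in>adj_pairs n. (A v - A w)\<^sup>2)"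

text \<open>The polarized graph energy of the complete graph on three vertices.\<close>

definition cell_form :: "(nat \<Rightarrow> real) \<Rightarrow> (nat \<Rightarrow> real) \<Rightarrow> real" where
  "cell_form x y = (x 0 - x 1) * (y 0 - y 1) + (x 0 - x 2) * (y 0 - y 2) + (x 1 - x 2) * (y 1 - y 2)"

text \<open>\<open>T w i\<close> stands for the value at the \<open>i\<close>-th vertex of the cell \<open>w\<close>.\<close>

definition vertex_energy :: "nat \<Rightarrow> (nat list \<Rightarrow> nat \<Rightarrow> real) \<Rightarrow> (nat list \<Rightarrow> nat \<Rightarrow> real) \<Rightarrow> real" where
  "vertex_energy n S T = (5/3) ^ n * (\<Sum>w\<in>words n. cell_form (S w) (T w))"

text \<open>These are the coincidences of vertex points: \<open>sg_map a\<close> fixes vertex a, and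
  the maps a and b exchange their vertices by \<open>sg_map_vertex_swap\<close>.\<close>

definition compatible :: "(nat list \<Rightarrow> nat \<Rightarrow> real) \<Rightarrow> bool" where
  "compatible T \<longleftrightarrow> (\<forall>n. \<forall>u\<in>words n. \<forall>a\<in>{0,1,2}. T (u @ [a]) a = T u a \<and>
     (\<forall>b\<in>{0,1,2}. T (u @ [a]) b = T (u @ [b]) a))"

definition has_means :: "(nat list \<Rightarrow> real) \<Rightarrow> bool" where
  "has_means A \<longleftrightarrow> (\<forall>n. \<forall>w\<in>words n. A w = (\<Sum>a\<in>{0,1,2}. A (w @ [a])) / 3)"

text \<open>Vertex 0 alone is tested: for vertex values of bounded energy, the three values at a
  cell differ by a quantity that vanishes with its level (\<open>vertex_osc\<close>).\<close>

definition asymptotic_to :: "(nat list \<Rightarrow> real) \<Rightarrow> (nat list \<Rightarrow> nat \<Rightarrow> real) \<Rightarrow> bool" where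
  "asymptotic_to A T \<longleftrightarrow> (\<forall>e>0. \<exists>N. \<forall>n\<ge>N. \<forall>w\<in>words n. \<bar>A w - T w 0\<bar> \<le> e)"

lemma cell_form_nonneg: "0 \<le> cell_form x x"
  by (simp add: cell_form_def)

lemma cell_form_edge: "i \<in> {0,1,2} \<Longrightarrow> j \<in> {0,1,2} \<Longrightarrow> (x i - x j)\<^sup>2 \<le> cell_form x x"
  by (auto simp: cell_form_def power2_eq_square algebra_simps)
     (use zero_le_power2[of "x 0 - x 1"] zero_le_power2[of "x 0 - x 2"] zero_le_power2[of "x 1 - x 2"]
       in \<open>simp_all add: power2_eq_square algebra_simps\<close>)

lemma vertex_energy_nonneg: "0 \<le> vertex_energy n T T"
  unfolding vertex_energy_def by (intro mult_nonneg_nonneg sum_nonneg cell_form_nonneg) auto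

lemma compatibleD:
  assumes "compatible T" "u \<in> words n" "a \<in> {0,1,2}"
  shows "T (u @ [a]) a = T u a" "b \<in> {0,1,2} \<Longrightarrow> T (u @ [a]) b = T (u @ [b]) a"
  using assms unfolding compatible_def by blast+

text \<open>
  The difference of the two sides is a sum of squares in the deviations of the three midpoint
  values from those of the harmonic extension.
\<close>

lemma cell_form_refine:
  fixes x0 x1 x2 y01 y02 y12 :: real
  shows "(x0 - x1)\<^sup>2 + (x0 - x2)\<^sup>2 + (x1 - x2)\<^sup>2 \<le>
    5/3 * ((x0 - y01)\<^sup>2 + (x0 - y02)\<^sup>2 + (y01 - y02)\<^sup>2 + (y01 - x1)\<^sup>2 + (y01 - y12)\<^sup>2 + (x1 - y12)\<^sup>2
      + (y02 - y12)\<^sup>2 + (y02 - x2)\<^sup>2 + (y12 - x2)\<^sup>2)"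
proof -
  define z01 where "z01 = y01 - (2 * x0 + 2 * x1 + x2) / 5"
  define z02 where "z02 = y02 - (2 * x0 + x1 + 2 * x2) / 5"
  define z12 where "z12 = y12 - (x0 + 2 * x1 + 2 * x2) / 5"
  have y: "y01 = z01 + (2 * x0 + 2 * x1 + x2) / 5" "y02 = z02 + (2 * x0 + x1 + 2 * x2) / 5"
    "y12 = z12 + (x0 + 2 * x1 + 2 * x2) / 5" by (simp_all add: z01_def z02_def z12_def)
  have "5/3 * ((x0 - y01)\<^sup>2 + (x0 - y02)\<^sup>2 + (y01 - y02)\<^sup>2 + (y01 - x1)\<^sup>2 + (y01 - y12)\<^sup>2 + (x1 - y12)\<^sup>2
      + (y02 - y12)\<^sup>2 + (y02 - x2)\<^sup>2 + (y12 - x2)\<^sup>2)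
     - ((x0 - x1)\<^sup>2 + (x0 - x2)\<^sup>2 + (x1 - x2)\<^sup>2) =
     5/3 * ((z01 - z02)\<^sup>2 + (z01 - z12)\<^sup>2 + (z02 - z12)\<^sup>2 + 2 * (z01\<^sup>2 + z02\<^sup>2 + z12\<^sup>2))"
    unfolding y by (simp add: power2_eq_square field_simps)
  also have "\<dots> \<ge> 0" by simp
  finally show ?thesis by linarith
qed

lemma cell_form_le_children:
  assumes "compatible T" "u \<in> words n"
  shows "cell_form (T u) (T u) \<le> 5/3 * (\<Sum>a\<in>{0,1,2}. cell_form (T (u @ [a])) (T (u @ [a])))"
proof -
  note c = compatibleD[OF assms]
  have e: "T (u @ [0]) 0 = T u 0" "T (u @ [1]) 1 = T u 1" "T (u @ [2]) 2 = T u 2"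
    "T (u @ [1]) 0 = T (u @ [0]) 1" "T (u @ [2]) 0 = T (u @ [0]) 2" "T (u @ [2]) 1 = T (u @ [1]) 2"
    using c(1)[of 0] c(1)[of 1] c(1)[of 2] c(2)[of 1 0] c(2)[of 2 0] c(2)[of 2 1] by auto
  show ?thesis
    using cell_form_refine[of "T u 0" "T u 1" "T u 2" "T (u @ [0]) 1" "T (u @ [0]) 2" "T (u @ [1]) 2"]
    by (simp add: cell_form_def e[unfolded One_nat_def] power2_eq_square add_ac)
qed

lemma vertex_energy_Suc:
  assumes "compatible T"
  shows "vertex_energy n T T \<le> vertex_energy (Suc n) T T"
proof -
  have "(\<Sum>w\<in>words n. cell_form (T w) (T w)) \<le>
     (\<Sum>w\<in>words n. 5/3 * (\<Sum>a\<in>{0,1,2}. cell_form (T (w @ [a])) (T (w @ [a]))))"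
    by (intro sum_mono cell_form_le_children[OF assms])
  hence "vertex_energy n T T \<le> (5/3) ^ n * (\<Sum>w\<in>words n. 5/3 * (\<Sum>a\<in>{0,1,2}. cell_form (T (w @ [a])) (T (w @ [a]))))"
    unfolding vertex_energy_def by (intro mult_left_mono) auto
  also have "\<dots> = vertex_energy (Suc n) T T"
    unfolding vertex_energy_def sum_words_snoc sum_distrib_left[symmetric] by simp
  finally show ?thesis .
qed

lemma vertex_energy_mono: "compatible T \<Longrightarrow> m \<le> n \<Longrightarrow> vertex_energy m T T \<le> vertex_energy n T T"
  by (rule lift_Suc_mono_le[of "\<lambda>n. vertex_energy n T T"]) (rule vertex_energy_Suc)

section \<open>Oscillation bounds from vertex energies\<close>

definition shift :: "nat list \<Rightarrow> (nat list \<Rightarrow> nat \<Rightarrow> real) \<Rightarrow> nat list \<Rightarrow> nat \<Rightarrow> real" where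
  "shift w T v = T (w @ v)"

lemma compatible_shift: "compatible T \<Longrightarrow> w \<in> words n \<Longrightarrow> compatible (shift w T)"
  unfolding compatible_def shift_def using append_words[of w n] by (metis append_assoc)

lemma vertex_energy_add:
  "vertex_energy (n + m) S T = (5/3) ^ n * (\<Sum>w\<in>words n. vertex_energy m (shift w S) (shift w T))"
  by (simp add: vertex_energy_def sum_words_add shift_def power_add sum_distrib_left mult_ac)

lemma power_four_fifths: "((4/5 :: real) ^ n)\<^sup>2 = (16/25) ^ n"
  by (simp add: power2_eq_square flip: power_mult_distrib)

text \<open>A single edge carries at most the whole unscaled energy B (3/5)^n. The ratio 3/5 is
  weakened to 16/25 so that its square root 4/5 is rational.\<close>

lemma vertex_osc:
  assumes B: "vertex_energy n T T \<le> B" and w: "w \<in> words n" and ij: "i \<in> {0,1,2}" "j \<in> {0,1,2}"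
  shows "\<bar>T w i - T w j\<bar> \<le> sqrt B * (4/5) ^ n"
proof -
  have B0: "0 \<le> B" using B vertex_energy_nonneg[of n T] by linarith
  have "(T w i - T w j)\<^sup>2 \<le> cell_form (T w) (T w)" using ij by (rule cell_form_edge)
  also have "\<dots> \<le> (\<Sum>w\<in>words n. cell_form (T w) (T w))"
    using w by (intro member_le_sum) (auto intro: cell_form_nonneg)
  also have "\<dots> = vertex_energy n T T * (3/5) ^ n"
    by (simp add: vertex_energy_def flip: power_mult_distrib)
  also have "\<dots> \<le> B * (16/25) ^ n" using B B0 by (intro mult_mono power_mono) auto
  also have "\<dots> = (sqrt B * (4/5) ^ n)\<^sup>2"
    using B0 by (simp add: power_mult_distrib power_four_fifths)
  finally have "\<bar>T w i - T w j\<bar>\<^sup>2 \<le> (sqrt B * (4/5) ^ n)\<^sup>2" by simp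
  thus ?thesis by (rule power2_le_imp_le) (use B0 in auto)
qed

text \<open>Descending from v to v a keeps the value at vertex a. Going through that vertex costs
  one oscillation at each of the two levels, together 9/5 * sqrt B * (4/5)^n, while 10 * sqrt B * (1
  - (4/5)^n) grows by 2 * sqrt B * (4/5)^n. The eleventh sqrt B changes the vertex at the
  root.\<close>

lemma vertex_osc_root:
  assumes T: "compatible T" and B: "\<And>n. vertex_energy n T T \<le> B"
    and w: "w \<in> words n" and ij: "i \<in> {0,1,2}" "j \<in> {0,1,2}"
  shows "\<bar>T w i - T [] j\<bar> \<le> 11 * sqrt B"
proof -
  have B0: "0 \<le> B" using B[of 0] vertex_energy_nonneg[of 0 T] by linarith
  have "\<bar>T w i - T [] i\<bar> \<le> 10 * sqrt B * (1 - (4/5) ^ n)" using w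
  proof (induction n arbitrary: w)
    case (Suc n)
    from Suc.prems obtain v a where v: "w = v @ [a]" "v \<in> words n" "a \<in> {0,1,2}"
      by (cases w rule: rev_cases) auto
    have "\<bar>T w i - T w a\<bar> \<le> sqrt B * (4/5) ^ Suc n"
      using vertex_osc[OF B Suc.prems ij(1) v(3)] .
    moreover have "\<bar>T v a - T v i\<bar> \<le> sqrt B * (4/5) ^ n"
      using vertex_osc[OF B v(2) v(3) ij(1)] .
    moreover have "T w a = T v a" using compatibleD(1)[OF T v(2,3)] v by simp
    moreover have "\<bar>T v i - T [] i\<bar> \<le> 10 * sqrt B * (1 - (4/5) ^ n)" using Suc.IH[OF v(2)] .
    ultimately have "\<bar>T w i - T [] i\<bar> \<le> sqrt B * (4/5) ^ Suc n + sqrt B * (4/5) ^ n + 10 * sqrt B * (1 - (4/5) ^ n)"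
      by linarith
    moreover have "0 \<le> sqrt B * (4/5) ^ n" using B0 by simp
    ultimately show ?case by (simp add: algebra_simps)
  qed auto
  moreover have "\<bar>T [] i - T [] j\<bar> \<le> sqrt B" using vertex_osc[OF B[of 0], of "[]" i j] ij by simp
  moreover have "10 * sqrt B * (1 - (4/5) ^ n) \<le> 10 * sqrt B * 1"
    using B0 by (intro mult_left_mono) auto
  ultimately show ?thesis by linarith
qed

section \<open>From vertex energies to energies of means\<close>

lemma has_means_iter:
  assumes "has_means A" "w \<in> words n"
  shows "A w = (\<Sum>v\<in>words m. A (w @ v)) / 3 ^ m"
proof (induction m)
  case (Suc m)
  have "(\<Sum>v\<in>words m. A (w @ v)) = (\<Sum>v\<in>words m. (\<Sum>a\<in>{0,1,2}. A (w @ v @ [a])) / 3)"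
  proof (intro sum.cong refl)
    fix v assume "v \<in> words m"
    hence "w @ v \<in> words (n + m)" using assms append_words by blast
    hence "A (w @ v) = (\<Sum>a\<in>{0,1,2}. A ((w @ v) @ [a])) / 3"
      using assms(1) unfolding has_means_def by blast
    thus "A (w @ v) = (\<Sum>a\<in>{0,1,2}. A (w @ v @ [a])) / 3" by simp
  qed
  thus ?case using Suc by (simp only: sum_words_snoc sum_divide_distrib[symmetric]) simp
qed simp

text \<open>The mean at w is the average of the means at its descendants of depth \<open>N\<close>.
  These are within e of vertex values inside w, all of which lie within 11 sqrt B of
  \<open>T w j\<close>. Only energy inside the cell w enters.\<close>

lemma mean_vertex_diff:
  assumes A: "has_means A" and AT: "asymptotic_to A T" and T: "compatible T"
    and w: "w \<in> words n" and B: "\<And>m. vertex_energy m (shift w T) (shift w T) \<le> B" and j: "j \<in> {0,1,2}"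
  shows "\<bar>A w - T w j\<bar> \<le> 11 * sqrt B"
proof (rule field_le_epsilon)
  fix e :: real assume "0 < e"
  then obtain N where N: "\<And>n w. n \<ge> N \<Longrightarrow> w \<in> words n \<Longrightarrow> \<bar>A w - T w 0\<bar> \<le> e"
    using AT unfolding asymptotic_to_def by blast
  have "A w - T w j = (\<Sum>v\<in>words N. A (w @ v) - T w j) / 3 ^ N"
    using has_means_iter[OF A w, of N] by (simp add: sum_subtractf card_words diff_divide_distrib)
  hence "\<bar>A w - T w j\<bar> = \<bar>\<Sum>v\<in>words N. A (w @ v) - T w j\<bar> / 3 ^ N" by simp
  also have "\<dots> \<le> (\<Sum>v\<in>words N. \<bar>A (w @ v) - T w j\<bar>) / 3 ^ N"
    by (intro divide_right_mono sum_abs) auto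
  also have "\<dots> \<le> (\<Sum>v\<in>words N. 11 * sqrt B + e) / 3 ^ N"
  proof (intro divide_right_mono sum_mono)
    fix v assume v: "v \<in> words N"
    have "\<bar>A (w @ v) - T (w @ v) 0\<bar> \<le> e" using append_words[OF w v] by (intro N[of "n + N"]) auto
    moreover have "\<bar>T (w @ v) 0 - T w j\<bar> \<le> 11 * sqrt B"
      using vertex_osc_root[OF compatible_shift[OF T w] B v _ j, of 0] by (simp add: shift_def)
    ultimately show "\<bar>A (w @ v) - T w j\<bar> \<le> 11 * sqrt B + e" by linarith
  qed auto
  also have "\<dots> = 11 * sqrt B + e" by (simp add: card_words)
  finally show "\<bar>A w - T w j\<bar> \<le> 11 * sqrt B + e" .
qed

lemma compatible_replicate:
  assumes "compatible T" "u \<in> words n" "b \<in> {0,1,2}"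
  shows "T (u @ replicate k b) b = T u b"
proof (induction k)
  case (Suc k)
  have "u @ replicate k b \<in> words (n + k)" using assms append_words replicate_in_words by blast
  from compatibleD(1)[OF assms(1) this assms(3)] Suc show ?case
    by (simp flip: replicate_append_same)
qed simp

lemma compatible_touching:
  assumes "compatible T" "u \<in> words n" "a \<in> {0,1,2}" "b \<in> {0,1,2}"
  shows "T (touching u a b k) b = T (touching u b a k) a"
proof -
  have "T (touching u a b k) b = T (u @ [a]) b" "T (touching u b a k) a = T (u @ [b]) a"
    using compatible_replicate[OF assms(1), of "u @ [a]" "Suc n" b k]
      compatible_replicate[OF assms(1), of "u @ [b]" "Suc n" a k] assms by (auto simp: touching_def)
  thus ?thesis using compatibleD(2)[OF assms(1-4)] by simp
qed

lemma finite_adj_pairs [simp]: "finite (adj_pairs n)"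
  by (rule finite_subset[of _ "words n \<times> words n"]) (auto simp: adj_pairs_def)

lemma replicate_Cons_inject:
  "replicate k b @ a # x = replicate k' b @ a' # x' \<Longrightarrow> a \<noteq> b \<Longrightarrow> a' \<noteq> b \<Longrightarrow> k = k' \<and> a = a' \<and> x = x'"
proof (induction k arbitrary: k')
  case 0
  thus ?case by (cases k') auto
next
  case (Suc k)
  thus ?case by (cases k') auto
qed

text \<open>Read backwards, k is the length of the final run of b, and the run stops at the first
  letter different from b.\<close>

lemma touching_inject:
  assumes "touching u a b k = touching u' a' b k'" "a \<noteq> b" "a' \<noteq> b"
  shows "u = u' \<and> a = a' \<and> k = k'"
proof -
  have "rev (touching u a b k) = rev (touching u' a' b k')" using assms by simp
  hence "replicate k b @ a # rev u = replicate k' b @ a' # rev u'" by (simp add: touching_def)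
  from replicate_Cons_inject[OF this assms(2,3)] show ?thesis by simp
qed

text \<open>A neighbour touches v at the vertex named by a letter b, and by
  \<open>touching_inject\<close> v and b determine it; there are three letters.\<close>

lemma card_adjacent_le:
  assumes "v \<in> words n"
  shows "card {w \<in> words n. adjacent v w} \<le> 3"
proof -
  let ?S = "{w \<in> words n. adjacent v w}"
  let ?P = "\<lambda>w b. \<exists>u a k. a \<in> {0,1,2} \<and> b \<in> {0,1,2} \<and> a \<noteq> b \<and> v = touching u a b k \<and> w = touching u b a k"
  have "\<forall>w\<in>?S. \<exists>b. ?P w b"
  proof
    fix w assume "w \<in> ?S"
    hence "\<exists>u a b k. a \<in> {0,1,2} \<and> b \<in> {0,1,2} \<and> a \<noteq> b \<and> v = touching u a b k \<and> w = touching u b a k"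
      using adjacent_iff[OF assms, of w] by simp
    thus "\<exists>b. ?P w b" by blast
  qed
  from bchoice[OF this] obtain c where c: "\<And>w. w \<in> ?S \<Longrightarrow> ?P w (c w)" by blast
  have "inj_on c ?S"
  proof (rule inj_onI)
    fix w w' assume w: "w \<in> ?S" "w' \<in> ?S" "c w = c w'"
    obtain u a k where 1: "a \<noteq> c w" "v = touching u a (c w) k" "w = touching u (c w) a k" using c[OF w(1)] by blast
    obtain u' a' k' where 2: "a' \<noteq> c w'" "v = touching u' a' (c w') k'" "w' = touching u' (c w') a' k'" using c[OF w(2)] by blast
    from touching_inject[of u a "c w" k u' a' k'] 1 2 w(3) show "w = w'" by auto
  qed
  moreover have "c ` ?S \<subseteq> {0,1,2}"
  proof (rule image_subsetI)
    fix w assume "w \<in> ?S"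
    from c[OF this] show "c w \<in> {0,1,2}" by (elim exE conjE)
  qed
  ultimately have "card ?S \<le> card {0,1,2::nat}" by (intro card_inj_on_le[of c]) auto
  thus ?thesis by simp
qed

lemma adj_pairs_sym: "(v, w) \<in> adj_pairs n \<longleftrightarrow> (w, v) \<in> adj_pairs n"
  by (auto simp: adj_pairs_def adjacent_def)

text \<open>Each word occurs in at most three pairs as first and, by symmetry, at most three as
  second component.\<close>

lemma sum_adj_pairs_le:
  assumes "\<And>v. v \<in> words n \<Longrightarrow> 0 \<le> g v"
  shows "(\<Sum>(v, w)\<in>adj_pairs n. g v + g w) \<le> 6 * (\<Sum>v\<in>words n. g v :: real)"
proof -
  have 1: "(\<Sum>(v, w)\<in>adj_pairs n. g v) \<le> 3 * (\<Sum>v\<in>words n. g v)"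
  proof -
    have "adj_pairs n = Sigma (words n) (\<lambda>v. {w \<in> words n. adjacent v w})"
      by (auto simp: adj_pairs_def)
    hence "(\<Sum>(v, w)\<in>adj_pairs n. g v) = (\<Sum>v\<in>words n. \<Sum>w\<in>{w \<in> words n. adjacent v w}. g v)"
      by (simp only:) (rule sum.Sigma[symmetric], auto)
    also have "\<dots> = (\<Sum>v\<in>words n. real (card {w \<in> words n. adjacent v w}) * g v)" by simp
    also have "\<dots> \<le> (\<Sum>v\<in>words n. 3 * g v)"
    proof (intro sum_mono mult_right_mono assms)
      fix v assume "v \<in> words n"
      hence "real (card {w \<in> words n. adjacent v w}) \<le> real 3"
        using card_adjacent_le by (simp only: of_nat_le_iff)
      thus "real (card {w \<in> words n. adjacent v w}) \<le> 3" by simp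
    qed
    finally show ?thesis by (simp add: sum_distrib_left)
  qed
  have "(\<Sum>(v, w)\<in>adj_pairs n. g w) = (\<Sum>(v, w)\<in>adj_pairs n. g v)"
    by (rule sum.reindex_bij_witness[of _ "\<lambda>(v, w). (w, v)" "\<lambda>(v, w). (w, v)"])
       (auto intro: adj_pairs_sym[THEN iffD1])
  thus ?thesis using 1 by (simp add: case_prod_unfold sum.distrib)
qed

text \<open>Adjacent cells share a vertex value, so their means differ by at most 11 sqrt (L v) + 11
  sqrt (L w), where L is the limiting energy inside a cell. Squaring gives the factor 2 * 11^2 =
  242, and the six occurrences of each cell give 1452.\<close>

lemma pair_energy_le:
  assumes A: "has_means A" and AT: "asymptotic_to A T" and T: "compatible T"
    and B: "\<And>m. vertex_energy m T T \<le> B"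
  shows "(5/3) ^ n * pair_energy n A \<le> 1452 * B"
proof -
  define b where "b w m = vertex_energy m (shift w T) (shift w T)" for w m
  have b_le: "(5/3) ^ n * (\<Sum>w\<in>words n. b w m) \<le> B" for m
    using B[of "n + m"] vertex_energy_add[of n m T T] by (simp add: b_def)
  have b0: "0 \<le> b w m" for w m by (simp add: b_def vertex_energy_nonneg)
  have b_bd: "b w m \<le> B" if "w \<in> words n" for w m
  proof -
    have "b w m \<le> (\<Sum>w\<in>words n. b w m)" using that b0 by (intro member_le_sum) auto
    also have "\<dots> \<le> (5/3) ^ n * (\<Sum>w\<in>words n. b w m)"
      using mult_right_mono[of 1 "(5/3::real)^n" "\<Sum>w\<in>words n. b w m"] b0 by (simp add: sum_nonneg)
    finally show ?thesis using b_le[of m] by linarith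
  qed
  \<comment> \<open>The uniform bound B on each cell would be useless in a sum over 3^n cells. The
    individual limits, which exist by monotonicity, satisfy (5/3)^n * (sum of the L w) <= B.\<close>
  have "\<exists>L. b w \<longlonglongrightarrow> L \<and> (\<forall>m. b w m \<le> L)" if "w \<in> words n" for w
  proof (rule incseq_convergent)
    show "incseq (b w)" unfolding incseq_def b_def
      using vertex_energy_mono[OF compatible_shift[OF T that]] by blast
    show "\<forall>m. b w m \<le> B" using b_bd[OF that] by blast
  qed blast
  then obtain L where L: "\<And>w. w \<in> words n \<Longrightarrow> b w \<longlonglongrightarrow> L w" "\<And>w m. w \<in> words n \<Longrightarrow> b w m \<le> L w"
    by metis
  have L0: "0 \<le> L w" if "w \<in> words n" for w using order_trans[OF b0[of w 0] L(2)[OF that, of 0]] .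
  have "(\<lambda>m. (5/3) ^ n * (\<Sum>w\<in>words n. b w m)) \<longlonglongrightarrow> (5/3) ^ n * (\<Sum>w\<in>words n. L w)"
    by (intro tendsto_intros L)
  from LIMSEQ_le_const2[OF this] b_le have sumL: "(5/3) ^ n * (\<Sum>w\<in>words n. L w) \<le> B" by blast
  have diff: "\<bar>A w - T w j\<bar> \<le> 11 * sqrt (L w)" if "w \<in> words n" "j \<in> {0,1,2}" for w j
    using mean_vertex_diff[OF A AT T that(1) _ that(2), of "L w"] L(2)[OF that(1)] by (simp add: b_def)
  have "pair_energy n A \<le> (\<Sum>(v, w)\<in>adj_pairs n. 242 * L v + 242 * L w)"
    unfolding pair_energy_def
  proof (intro sum_mono, clarify)
    fix v w assume "(v, w) \<in> adj_pairs n"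
    hence vw: "v \<in> words n" "w \<in> words n" "adjacent v w" by (auto simp: adj_pairs_def)
    then obtain u a b k where *: "a \<in> {0,1,2}" "b \<in> {0,1,2}" "a \<noteq> b" "v = touching u a b k" "w = touching u b a k"
      using adjacent_iff[OF vw(1,2)] by blast
    have "T v b = T w a"
      using compatible_touching[OF T _ *(1,2)] touching_in_words(1)[of u a b k n] vw(1) * by blast
    hence "\<bar>A v - A w\<bar> \<le> 11 * sqrt (L v) + 11 * sqrt (L w)"
      using diff[OF vw(1) *(2)] diff[OF vw(2) *(1)] by linarith
    hence "(A v - A w)\<^sup>2 \<le> (11 * sqrt (L v) + 11 * sqrt (L w))\<^sup>2"
      using abs_le_square_iff[of "A v - A w" "11 * sqrt (L v) + 11 * sqrt (L w)"] by linarith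
    also have "\<dots> \<le> 2 * (11 * sqrt (L v))\<^sup>2 + 2 * (11 * sqrt (L w))\<^sup>2"
    proof -
      have "(p + q)\<^sup>2 \<le> 2 * p\<^sup>2 + 2 * q\<^sup>2" for p q :: real
        using zero_le_power2[of "p - q"] by (simp add: power2_eq_square algebra_simps)
      thus ?thesis .
    qed
    also have "\<dots> = 242 * L v + 242 * L w"
      using L0 vw by (simp add: power_mult_distrib)
    finally show "(A v - A w)\<^sup>2 \<le> 242 * L v + 242 * L w" .
  qed
  also have "\<dots> \<le> 6 * (\<Sum>v\<in>words n. 242 * L v)" by (rule sum_adj_pairs_le) (use L0 in auto)
  finally have "pair_energy n A \<le> 1452 * (\<Sum>v\<in>words n. L v)" by (simp add: sum_distrib_left[symmetric])
  hence "(5/3) ^ n * pair_energy n A \<le> (5/3) ^ n * (1452 * (\<Sum>v\<in>words n. L v))"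
    by (intro mult_left_mono) auto
  also have "\<dots> = 1452 * ((5/3) ^ n * (\<Sum>v\<in>words n. L v))" by (simp only: mult.left_commute)
  also have "\<dots> \<le> 1452 * B" using sumL by simp
  finally show ?thesis .
qed

subsection \<open>Vertex values as limits of means\<close>

definition vertex_limit :: "(nat list \<Rightarrow> real) \<Rightarrow> nat list \<Rightarrow> nat \<Rightarrow> real" where
  "vertex_limit A w i = lim (\<lambda>m. A (w @ replicate m i))"

lemma pair_energy_nonneg: "0 \<le> pair_energy n A"
  unfolding pair_energy_def by (intro sum_nonneg) auto

text \<open>A child differs from its parent by one third of the sum of its differences to the two
  siblings. Siblings are adjacent, with k = 0 in \<open>touching\<close>, so these squares are
  distinct terms of the energy of the next level.\<close>

lemma sum_child_diff_le:
  assumes A: "has_means A" and i: "i \<in> {0,1,2}"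
  shows "(\<Sum>w\<in>words n. (A (w @ [i]) - A w)\<^sup>2) \<le> pair_energy (Suc n) A"
proof -
  have "(A (w @ [i]) - A w)\<^sup>2 \<le> (\<Sum>k\<in>{0,1,2} - {i}. (A (w @ [i]) - A (w @ [k]))\<^sup>2)" if "w \<in> words n" for w
  proof -
    have sq: "((p + q) / 3)\<^sup>2 \<le> p\<^sup>2 + q\<^sup>2" for p q :: real
    proof -
      have "p\<^sup>2 + q\<^sup>2 - ((p + q) / 3)\<^sup>2 = (7 * p\<^sup>2 + 7 * q\<^sup>2 + (p - q)\<^sup>2) / 9"
        by (simp add: power2_eq_square field_simps)
      moreover have "\<dots> \<ge> 0" by simp
      ultimately show ?thesis by linarith
    qed
    have Aw: "A w = (A (w @ [0]) + A (w @ [1]) + A (w @ [2])) / 3"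
      using A that unfolding has_means_def by (simp add: add.assoc)
    consider "i = 0" | "i = 1" | "i = 2" using i by auto
    thus ?thesis
    proof cases
      case 1
      have e: "A (w @ [0]) - A w = ((A (w @ [0]) - A (w @ [1])) + (A (w @ [0]) - A (w @ [2]))) / 3"
        unfolding Aw by (simp add: field_simps)
      have "(A (w @ [0]) - A w)\<^sup>2 \<le> (A (w @ [0]) - A (w @ [1]))\<^sup>2 + (A (w @ [0]) - A (w @ [2]))\<^sup>2"
        unfolding e by (rule sq)
      moreover have "{0,1,2} - {i} = {1,2::nat}" using 1 by auto
      ultimately show ?thesis using 1 by simp
    next
      case 2
      have e: "A (w @ [1]) - A w = ((A (w @ [1]) - A (w @ [0])) + (A (w @ [1]) - A (w @ [2]))) / 3"
        unfolding Aw by (simp add: field_simps)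
      have "(A (w @ [1]) - A w)\<^sup>2 \<le> (A (w @ [1]) - A (w @ [0]))\<^sup>2 + (A (w @ [1]) - A (w @ [2]))\<^sup>2"
        unfolding e by (rule sq)
      moreover have "{0,1,2} - {i} = {0,2::nat}" using 2 by auto
      ultimately show ?thesis using 2 by simp
    next
      case 3
      have e: "A (w @ [2]) - A w = ((A (w @ [2]) - A (w @ [0])) + (A (w @ [2]) - A (w @ [1]))) / 3"
        unfolding Aw by (simp add: field_simps)
      have "(A (w @ [2]) - A w)\<^sup>2 \<le> (A (w @ [2]) - A (w @ [0]))\<^sup>2 + (A (w @ [2]) - A (w @ [1]))\<^sup>2"
        unfolding e by (rule sq)
      moreover have "{0,1,2} - {i} = {0,1::nat}" using 3 by auto
      ultimately show ?thesis using 3 by simp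
    qed
  qed
  hence "(\<Sum>w\<in>words n. (A (w @ [i]) - A w)\<^sup>2) \<le>
      (\<Sum>w\<in>words n. \<Sum>k\<in>{0,1,2} - {i}. (A (w @ [i]) - A (w @ [k]))\<^sup>2)"
    by (rule sum_mono)
  also have "\<dots> = (\<Sum>(w, k)\<in>words n \<times> ({0,1,2} - {i}). (A (w @ [i]) - A (w @ [k]))\<^sup>2)"
    by (rule sum.cartesian_product)
  also have "\<dots> = (\<Sum>(v, w)\<in>(\<lambda>(w, k). (w @ [i], w @ [k])) ` (words n \<times> ({0,1,2} - {i})). (A v - A w)\<^sup>2)"
    by (subst sum.reindex) (auto simp: inj_on_def case_prod_unfold)
  also have "\<dots> \<le> pair_energy (Suc n) A"
    unfolding pair_energy_def
  proof (rule sum_mono2)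
    show "(\<lambda>(w, k). (w @ [i], w @ [k])) ` (words n \<times> ({0,1,2} - {i})) \<subseteq> adj_pairs (Suc n)"
    proof
      fix p assume "p \<in> (\<lambda>(w, k). (w @ [i], w @ [k])) ` (words n \<times> ({0,1,2} - {i}))"
      then obtain q where q: "q \<in> words n \<times> ({0,1,2} - {i})" "p = (case q of (w, k) \<Rightarrow> (w @ [i], w @ [k]))"
        by (rule imageE)
      obtain w k where "q = (w, k)" by (cases q)
      hence w: "w \<in> words n" and k: "k \<in> {0,1,2::nat}" "k \<noteq> i" and p: "p = (w @ [i], w @ [k])"
        using q by auto
      have ws: "w @ [i] \<in> words (Suc n)" "w @ [k] \<in> words (Suc n)" using w k(1) i by simp_all
      have "w @ [i] = touching w i k 0" "w @ [k] = touching w k i 0" by (simp_all add: touching_def)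
      hence "adjacent (w @ [i]) (w @ [k])" unfolding adjacent_iff[OF ws]
        by (intro exI[of _ w] exI[of _ i] exI[of _ k] exI[of _ 0] conjI i k not_sym[OF k(2)])
      thus "p \<in> adj_pairs (Suc n)" using ws p by (simp add: adj_pairs_def)
    qed
  qed auto
  finally show ?thesis .
qed

text \<open>Cauchy-Schwarz with weights (4/3)^m; the constant 4 is the sum of all (3/4)^m. The
  weight grows slowly enough to leave the ratio 4/3 * 3/5 = 4/5 when the squares decay like
  (3/5)^m.\<close>

lemma square_sum_le_geometric:
  fixes d :: "nat \<Rightarrow> real"
  shows "(\<Sum>m<M. d m)\<^sup>2 \<le> 4 * (\<Sum>m<M. (4/3) ^ m * (d m)\<^sup>2)"
proof (induction M arbitrary: d)
  case (Suc M)
  define R where "R = (\<Sum>m<M. d (Suc m))"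
  have "(\<Sum>m<Suc M. d m)\<^sup>2 = (d 0 + R)\<^sup>2" by (simp add: R_def sum.lessThan_Suc_shift del: sum.lessThan_Suc)
  \<comment> \<open>The difference of the two sides is (3 d 0 - R)^2 / 3.\<close>
  also have "\<dots> \<le> 4 * (d 0)\<^sup>2 + 4/3 * R\<^sup>2"
    using zero_le_power2[of "3 * d 0 - R"] by (simp add: power2_eq_square algebra_simps)
  also have "R\<^sup>2 \<le> 4 * (\<Sum>m<M. (4/3) ^ m * (d (Suc m))\<^sup>2)" unfolding R_def by (rule Suc.IH)
  finally have "(\<Sum>m<Suc M. d m)\<^sup>2 \<le> 4 * (d 0)\<^sup>2 + 4 * (\<Sum>m<M. (4/3) ^ Suc m * (d (Suc m))\<^sup>2)"
    by (simp add: sum_distrib_left mult_ac)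
  thus ?case by (simp add: sum.lessThan_Suc_shift distrib_left del: power_Suc sum.lessThan_Suc)
qed simp

section \<open>Consequences of a uniform bound on the energies of means\<close>

context
  fixes A :: "nat list \<Rightarrow> real" and S :: real
  assumes A: "has_means A" and S: "\<And>n. n \<ge> 1 \<Longrightarrow> (5/3) ^ n * pair_energy n A \<le> S"
begin

lemma bound_nonneg: "0 \<le> S"
  using S[of 1] pair_energy_nonneg[of 1 A] by simp

lemma pair_energy_decay: "pair_energy (Suc n) A \<le> S * (3/5) ^ Suc n"
proof -
  have "pair_energy (Suc n) A = ((5/3) ^ Suc n * pair_energy (Suc n) A) * (3/5) ^ Suc n"
    by (simp flip: power_mult_distrib del: power_Suc)
  also have "\<dots> \<le> S * (3/5) ^ Suc n" by (intro mult_right_mono S) auto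
  finally show ?thesis .
qed

text \<open>The words w i^m with w of length n are distinct words of length n + m, so this is part
  of the parent-child sum at that level.\<close>

lemma sum_descend_diff_le:
  assumes i: "i \<in> {0,1,2}"
  shows "(\<Sum>w\<in>words n. (A (w @ replicate (Suc m) i) - A (w @ replicate m i))\<^sup>2) \<le> S * (3/5) ^ Suc (n + m)"
proof -
  have "(\<Sum>w\<in>words n. (A (w @ replicate (Suc m) i) - A (w @ replicate m i))\<^sup>2) =
     (\<Sum>v\<in>(\<lambda>w. w @ replicate m i) ` words n. (A (v @ [i]) - A v)\<^sup>2)"
    by (subst sum.reindex) (auto simp: inj_on_def simp flip: replicate_append_same)
  also have "\<dots> \<le> (\<Sum>v\<in>words (n + m). (A (v @ [i]) - A v)\<^sup>2)"
    by (rule sum_mono2) (use append_words replicate_in_words[OF i] in auto)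
  also have "\<dots> \<le> pair_energy (Suc (n + m)) A" by (rule sum_child_diff_le[OF A i])
  also have "\<dots> \<le> S * (3/5) ^ Suc (n + m)" by (rule pair_energy_decay)
  finally show ?thesis .
qed

text \<open>A single squared increment is at most S (3/5)^m, hence the increments are dominated by
  sqrt S * (4/5)^m and their telescoping series converges.\<close>

lemma vertex_limit_tendsto:
  assumes i: "i \<in> {0,1,2}" and w: "w \<in> words n"
  shows "(\<lambda>m. A (w @ replicate m i)) \<longlonglongrightarrow> vertex_limit A w i"
proof -
  define d where "d m = A (w @ replicate (Suc m) i) - A (w @ replicate m i)" for m
  have d_le: "norm (d m) \<le> sqrt S * (4/5) ^ m" for m
  proof -
    have "(d m)\<^sup>2 \<le> (\<Sum>w\<in>words n. (A (w @ replicate (Suc m) i) - A (w @ replicate m i))\<^sup>2)"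
      unfolding d_def using w by (intro member_le_sum) auto
    also have "\<dots> \<le> S * (3/5) ^ Suc (n + m)" by (rule sum_descend_diff_le[OF i])
    also have "\<dots> \<le> S * (3/5) ^ m"
      using bound_nonneg by (intro mult_left_mono power_decreasing) auto
    also have "\<dots> \<le> S * (16/25) ^ m" using bound_nonneg by (intro mult_left_mono power_mono) auto
    also have "\<dots> = (sqrt S * (4/5) ^ m)\<^sup>2"
      using bound_nonneg by (simp add: power_mult_distrib power_four_fifths)
    finally have "\<bar>d m\<bar>\<^sup>2 \<le> (sqrt S * (4/5) ^ m)\<^sup>2" by simp
    hence "\<bar>d m\<bar> \<le> sqrt S * (4/5) ^ m" by (rule power2_le_imp_le) (use bound_nonneg in auto)
    thus ?thesis by simp
  qed
  have "summable (\<lambda>m. sqrt S * (4/5::real) ^ m)"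
    by (intro summable_mult summable_geometric) auto
  hence "summable d" by (rule summable_comparison_test'[of _ 0]) (rule d_le)
  hence "(\<lambda>M. A w + (\<Sum>m<M. d m)) \<longlonglongrightarrow> A w + suminf d"
    by (intro tendsto_intros summable_LIMSEQ)
  moreover have "(\<Sum>m<M. d m) = A (w @ replicate M i) - A w" for M
    unfolding d_def using sum_lessThan_telescope[of "\<lambda>m. A (w @ replicate m i)" M] by simp
  ultimately have "(\<lambda>m. A (w @ replicate m i)) \<longlonglongrightarrow> A w + suminf d" by simp
  thus ?thesis unfolding vertex_limit_def by (simp add: limI)
qed

text \<open>Telescoping and the weighted Cauchy-Schwarz inequality leave a geometric series of ratio
  4/5, so 12 = 4 * 3/5 * 5. Estimating word by word would lose the rate (3/5)^n; the sum over words
  is therefore taken before the limit in M.\<close>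

lemma sum_vertex_limit_diff_le:
  assumes i: "i \<in> {0,1,2}"
  shows "(\<Sum>w\<in>words n. (vertex_limit A w i - A w)\<^sup>2) \<le> 12 * S * (3/5) ^ n"
proof (rule LIMSEQ_le_const2)
  show "(\<lambda>M. \<Sum>w\<in>words n. (A (w @ replicate M i) - A w)\<^sup>2) \<longlonglongrightarrow> (\<Sum>w\<in>words n. (vertex_limit A w i - A w)\<^sup>2)"
    by (intro tendsto_intros vertex_limit_tendsto[OF i])
  have "(\<Sum>w\<in>words n. (A (w @ replicate M i) - A w)\<^sup>2) \<le> 12 * S * (3/5) ^ n" for M
  proof -
    let ?d = "\<lambda>w m. A (w @ replicate (Suc m) i) - A (w @ replicate m i)"
    have "A (w @ replicate M i) - A w = (\<Sum>m<M. ?d w m)" for w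
      using sum_lessThan_telescope[of "\<lambda>m. A (w @ replicate m i)" M] by simp
    hence "(\<Sum>w\<in>words n. (A (w @ replicate M i) - A w)\<^sup>2) = (\<Sum>w\<in>words n. (\<Sum>m<M. ?d w m)\<^sup>2)" by simp
    also have "\<dots> \<le> (\<Sum>w\<in>words n. 4 * (\<Sum>m<M. (4/3) ^ m * (?d w m)\<^sup>2))"
      by (intro sum_mono square_sum_le_geometric)
    also have "\<dots> = 4 * (\<Sum>m<M. (4/3) ^ m * (\<Sum>w\<in>words n. (?d w m)\<^sup>2))"
      unfolding sum_distrib_left[symmetric] by (subst sum.swap) (simp add: sum_distrib_left)
    also have "\<dots> \<le> 4 * (\<Sum>m<M. (4/3) ^ m * (S * (3/5) ^ Suc (n + m)))"
      by (intro mult_left_mono sum_mono sum_descend_diff_le[OF i]) auto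
    also have "\<dots> = 4 * (\<Sum>m<M. S * (3/5) ^ Suc n * (4/5) ^ m)"
    proof -
      have e1: "(4/3) ^ m * (S * (3/5) ^ Suc (n + m)) = S * (3/5) ^ Suc n * ((4/3) ^ m * (3/5) ^ m)" for m
        by (simp add: power_add)
      have e2: "(4/3) ^ m * (3/5) ^ m = (4/5 :: real) ^ m" for m
        by (simp flip: power_mult_distrib)
      show ?thesis by (simp only: e1 e2)
    qed
    also have "\<dots> = 12/5 * (S * (3/5) ^ n * (\<Sum>m<M. (4/5) ^ m))"
      unfolding sum_distrib_left[symmetric] by simp
    also have "(\<Sum>m<M. (4/5) ^ m) = 5 - 5 * (4/5 :: real) ^ M"
      by (induction M) auto
    also have "12/5 * (S * (3/5) ^ n * (5 - 5 * (4/5 :: real) ^ M)) \<le> 12/5 * (S * (3/5) ^ n * 5)"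
      using bound_nonneg by (intro mult_left_mono) auto
    finally show ?thesis by simp
  qed
  thus "\<exists>N. \<forall>M\<ge>N. (\<Sum>w\<in>words n. (A (w @ replicate M i) - A w)\<^sup>2) \<le> 12 * S * (3/5) ^ n" by blast
qed

text \<open>The first relation compares a sequence with its shift. For the second, u a b^m and u b
  a^m are adjacent for every m, so the square of the difference of their means is one term of an
  energy that tends to 0.\<close>

lemma compatible_vertex_limit: "compatible (vertex_limit A)"
  unfolding compatible_def
proof (intro allI ballI conjI)
  fix n u a assume u: "u \<in> words n" and a: "a \<in> {0,1,2::nat}"
  have "(\<lambda>m. A (u @ replicate (Suc m) a)) \<longlonglongrightarrow> vertex_limit A u a"
    using LIMSEQ_Suc[OF vertex_limit_tendsto[OF a u]] .
  moreover have "(\<lambda>m. A ((u @ [a]) @ replicate m a)) \<longlonglongrightarrow> vertex_limit A (u @ [a]) a"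
    using u a by (intro vertex_limit_tendsto[OF a, of _ "Suc n"]) simp
  ultimately show "vertex_limit A (u @ [a]) a = vertex_limit A u a"
    by (auto intro: LIMSEQ_unique)
  fix b assume b: "b \<in> {0,1,2::nat}"
  show "vertex_limit A (u @ [a]) b = vertex_limit A (u @ [b]) a"
  proof (cases "a = b")
    case False
    have 1: "(\<lambda>m. A ((u @ [a]) @ replicate m b)) \<longlonglongrightarrow> vertex_limit A (u @ [a]) b"
      using u a by (intro vertex_limit_tendsto[OF b, of _ "Suc n"]) simp
    have 2: "(\<lambda>m. A ((u @ [b]) @ replicate m a)) \<longlonglongrightarrow> vertex_limit A (u @ [b]) a"
      using u b by (intro vertex_limit_tendsto[OF a, of _ "Suc n"]) simp
    have "(\<lambda>m. (A ((u @ [a]) @ replicate m b) - A ((u @ [b]) @ replicate m a))\<^sup>2) \<longlonglongrightarrow> 0"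
    proof (rule tendsto_sandwich[OF _ _ tendsto_const])
      show "\<forall>\<^sub>F m in sequentially. (A ((u @ [a]) @ replicate m b) - A ((u @ [b]) @ replicate m a))\<^sup>2 \<le> S * (3/5) ^ (Suc (n + m))"
      proof (intro always_eventually allI)
        fix m
        have ws: "touching u a b m \<in> words (n + Suc m)" "touching u b a m \<in> words (n + Suc m)"
          unfolding touching_def using u a b
          by (auto intro!: append_words simp: replicate_in_words simp del: add_Suc_right)
        have "adjacent (touching u a b m) (touching u b a m)"
          unfolding adjacent_iff[OF ws] using a b False by blast
        hence "(touching u a b m, touching u b a m) \<in> adj_pairs (Suc (n + m))"
          using ws by (simp add: adj_pairs_def)
        hence "(case (touching u a b m, touching u b a m) of (v, w) \<Rightarrow> (A v - A w)\<^sup>2) \<le> pair_energy (Suc (n + m)) A"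
          unfolding pair_energy_def by (intro member_le_sum) auto
        thus "(A ((u @ [a]) @ replicate m b) - A ((u @ [b]) @ replicate m a))\<^sup>2 \<le> S * (3/5) ^ (Suc (n + m))"
          using pair_energy_decay[of "n + m"] by (simp add: touching_def)
      qed
      have "(\<lambda>m. S * (3/5) ^ Suc n * (3/5) ^ m) \<longlonglongrightarrow> S * (3/5) ^ Suc n * 0"
        by (intro tendsto_intros LIMSEQ_realpow_zero) auto
      thus "(\<lambda>m. S * (3/5) ^ Suc (n + m)) \<longlonglongrightarrow> 0" by (simp add: power_add mult_ac)
    qed auto
    moreover have "(\<lambda>m. (A ((u @ [a]) @ replicate m b) - A ((u @ [b]) @ replicate m a))\<^sup>2) \<longlonglongrightarrow>
        (vertex_limit A (u @ [a]) b - vertex_limit A (u @ [b]) a)\<^sup>2"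
      by (intro tendsto_intros 1 2)
    ultimately have "(vertex_limit A (u @ [a]) b - vertex_limit A (u @ [b]) a)\<^sup>2 = 0"
      by (rule LIMSEQ_unique[rotated])
    thus ?thesis by simp
  qed simp
qed

text \<open>The three vertex values are compared with c = \<open>A w\<close>, each contributing 12 S
  (3/5)^n in total, and 4 * 3 * 12 = 144.\<close>

lemma vertex_energy_vertex_limit_le: "vertex_energy n (vertex_limit A) (vertex_limit A) \<le> 144 * S"
proof -
  let ?T = "vertex_limit A"
  have cf: "cell_form x x \<le> 4 * ((x 0 - c)\<^sup>2 + (x 1 - c)\<^sup>2 + (x 2 - c)\<^sup>2)" for x :: "nat \<Rightarrow> real" and c
  proof -
    have "4 * ((x 0 - c)\<^sup>2 + (x 1 - c)\<^sup>2 + (x 2 - c)\<^sup>2) - cell_form x x =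
        (x 0 - c)\<^sup>2 + (x 1 - c)\<^sup>2 + (x 2 - c)\<^sup>2 + ((x 0 - c) + (x 1 - c) + (x 2 - c))\<^sup>2"
      by (simp add: cell_form_def power2_eq_square algebra_simps)
    moreover have "\<dots> \<ge> 0" by simp
    ultimately show ?thesis by linarith
  qed
  have "(\<Sum>w\<in>words n. cell_form (?T w) (?T w)) \<le>
     (\<Sum>w\<in>words n. 4 * ((?T w 0 - A w)\<^sup>2 + (?T w 1 - A w)\<^sup>2 + (?T w 2 - A w)\<^sup>2))"
    by (intro sum_mono cf)
  also have "\<dots> = 4 * ((\<Sum>w\<in>words n. (?T w 0 - A w)\<^sup>2) + (\<Sum>w\<in>words n. (?T w 1 - A w)\<^sup>2) + (\<Sum>w\<in>words n. (?T w 2 - A w)\<^sup>2))"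
    by (simp add: sum.distrib sum_distrib_left)
  also have "\<dots> \<le> 4 * (12 * S * (3/5) ^ n + 12 * S * (3/5) ^ n + 12 * S * (3/5) ^ n)"
    by (intro mult_left_mono add_mono sum_vertex_limit_diff_le) auto
  finally have "vertex_energy n ?T ?T \<le> (5/3) ^ n * (144 * S * (3/5) ^ n)"
    unfolding vertex_energy_def by (intro mult_left_mono) auto
  also have "\<dots> = 144 * S" by (simp flip: power_mult_distrib)
  finally show ?thesis .
qed

lemma asymptotic_to_vertex_limit: "asymptotic_to A (vertex_limit A)"
  unfolding asymptotic_to_def
proof (intro allI impI)
  fix e :: real assume e: "0 < e"
  have "(\<lambda>n. 12 * S * (3/5) ^ n) \<longlonglongrightarrow> 12 * S * 0" by (intro tendsto_intros LIMSEQ_realpow_zero) auto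
  hence "\<forall>\<^sub>F n in sequentially. 12 * S * (3/5) ^ n < e\<^sup>2"
    using e by (intro order_tendstoD(2)) auto
  then obtain N where N: "\<And>n. n \<ge> N \<Longrightarrow> 12 * S * (3/5) ^ n < e\<^sup>2" by (auto simp: eventually_sequentially)
  show "\<exists>N. \<forall>n\<ge>N. \<forall>w\<in>words n. \<bar>A w - vertex_limit A w 0\<bar> \<le> e"
  proof (intro exI allI impI ballI)
    fix n w assume n: "N \<le> n" and w: "w \<in> words n"
    have "(vertex_limit A w 0 - A w)\<^sup>2 \<le> (\<Sum>w\<in>words n. (vertex_limit A w 0 - A w)\<^sup>2)"
      using w by (intro member_le_sum) auto
    also have "\<dots> \<le> e\<^sup>2" using sum_vertex_limit_diff_le[of 0 n] N[OF n] by simp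
    finally show "\<bar>A w - vertex_limit A w 0\<bar> \<le> e"
      using e abs_le_square_iff[of "vertex_limit A w 0 - A w" e] by (simp add: abs_minus_commute)
  qed
qed

end

subsection \<open>Extension of vertex values to continuous functions\<close>

definition vertex_values :: "(real^2 \<Rightarrow> real) \<Rightarrow> nat list \<Rightarrow> nat \<Rightarrow> real" where
  "vertex_values g w i = g (word_map w (sg_vertex i))"

lemma compatible_vertex_values: "compatible (vertex_values g)"
  unfolding compatible_def vertex_values_def
proof (intro allI ballI conjI)
  fix u a b
  show "g (word_map (u @ [a]) (sg_vertex a)) = g (word_map u (sg_vertex a))"
    by (simp add: word_map_append)
  show "g (word_map (u @ [a]) (sg_vertex b)) = g (word_map (u @ [b]) (sg_vertex a))"
    by (simp add: word_map_append sg_map_vertex_swap[of a b])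
qed

lemma word_map_vertex_in_cell: "i \<in> {0,1,2} \<Longrightarrow> word_map w (sg_vertex i) \<in> cell w"
  unfolding cell_def by (intro imageI vertex_in_gasket)

lemma word_map_vertex_in_gasket: "w \<in> words n \<Longrightarrow> i \<in> {0,1,2} \<Longrightarrow> word_map w (sg_vertex i) \<in> gasket"
  using word_map_in_gasket vertex_in_gasket by blast

lemma vertex_energy_shift_le:
  assumes B: "\<And>m. vertex_energy m T T \<le> B" and w: "w \<in> words n"
  shows "vertex_energy m (shift w T) (shift w T) \<le> B * (3/5) ^ n"
proof -
  have "vertex_energy m (shift w T) (shift w T) \<le> (\<Sum>w\<in>words n. vertex_energy m (shift w T) (shift w T))"
    using w by (intro member_le_sum) (auto simp: vertex_energy_nonneg)
  also have "\<dots> = vertex_energy (n + m) T T * (3/5) ^ n"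
    by (simp add: vertex_energy_add flip: power_mult_distrib)
  also have "\<dots> \<le> B * (3/5) ^ n" by (intro mult_right_mono B) auto
  finally show ?thesis .
qed

text \<open>The finitely many cells of level n that miss x form a closed set. Hence any cell of a
  point near x contains x too, which gives the two points a common cell.\<close>

lemma cell_neighbourhood:
  assumes x: "x \<in> gasket"
  shows "\<exists>d>0. \<forall>y. dist y x < d \<longrightarrow> (\<forall>w\<in>words n. y \<in> cell w \<longrightarrow> x \<in> cell w)"
proof -
  define C where "C = (\<Union>w\<in>{w \<in> words n. x \<notin> cell w}. cell w)"
  have "closed C" unfolding C_def
    by (intro closed_UN) (auto simp: compact_imp_closed[OF compact_cell])
  moreover have "x \<in> - C" by (auto simp: C_def)
  ultimately obtain d where d: "d > 0" "\<And>y. dist y x < d \<Longrightarrow> y \<in> - C"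
    unfolding closed_def open_dist by blast
  show ?thesis
  proof (intro exI conjI allI impI ballI)
    fix y w assume "dist y x < d" "w \<in> words n" "y \<in> cell w"
    thus "x \<in> cell w" using d(2)[of y] by (auto simp: C_def)
  qed (rule d(1))
qed

lemma ex_cell: "x \<in> gasket \<Longrightarrow> \<exists>w. w \<in> words n \<and> x \<in> cell w"
  using gasket_eq_UN_cell[of n] by auto

text \<open>\<omega> n bounds the oscillation of T inside a cell of level n, and
  \<open>share\<close> extends this to two cells with a common point. The chosen cells
  \<open>c n x\<close> need not be nested; \<open>step\<close> goes through the prefix of length n
  of \<open>c m x\<close> instead. \<open>close\<close> holds for every cell that contains x, so the
  choice leaves no trace in the limit g.\<close>

proposition continuous_extension:
  assumes T: "compatible T" and B: "\<And>n. vertex_energy n T T \<le> B"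
  shows "\<exists>g. continuous_on gasket g \<and> (\<forall>n. \<forall>w\<in>words n. \<forall>i\<in>{0,1,2}. g (word_map w (sg_vertex i)) = T w i)"
proof -
  define \<omega> where "\<omega> n = 11 * sqrt (B * (3/5) ^ n)" for n
  have "\<omega> \<longlonglongrightarrow> 11 * sqrt (B * 0)" unfolding \<omega>_def by (intro tendsto_intros LIMSEQ_realpow_zero) auto
  hence \<omega>_lim: "\<omega> \<longlonglongrightarrow> 0" by simp
  have B0: "0 \<le> B" using B[of 0] vertex_energy_nonneg[of 0 T] by linarith
  have \<omega>0: "0 \<le> \<omega> n" for n using B0 by (simp add: \<omega>_def)
  have osc: "\<bar>T (w @ v) i - T w j\<bar> \<le> \<omega> n"
    if "w \<in> words n" "v \<in> words m" "i \<in> {0,1,2}" "j \<in> {0,1,2}" for w v n m i j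
    using vertex_osc_root[OF compatible_shift[OF T that(1)] vertex_energy_shift_le[OF B that(1)] that(2-4)]
    by (simp add: \<omega>_def shift_def)
  have osc0: "\<bar>T w i - T w j\<bar> \<le> \<omega> n"
    if "w \<in> words n" "i \<in> {0,1,2}" "j \<in> {0,1,2}" for w n i j
    using osc[of w n "[]" 0 i j] that by simp
  have share: "\<bar>T v i - T w j\<bar> \<le> 2 * \<omega> n"
    if v: "v \<in> words n" and w: "w \<in> words n" and ij: "i \<in> {0,1,2}" "j \<in> {0,1,2}"
      and x: "x \<in> cell v" "x \<in> cell w" for v w n i j x
  proof (cases "v = w")
    case True
    thus ?thesis using osc0[OF v ij] \<omega>0[of n] by simp
  next
    case False
    from cell_Int_cell[OF v w this x] obtain u a b k where
      *: "a \<in> {0,1,2}" "b \<in> {0,1,2}" "v = touching u a b k" "w = touching u b a k" by (elim exE conjE)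
    have "T v b = T w a"
      using compatible_touching[OF T _ *(1,2)] touching_in_words(1)[of u a b k n] v * by blast
    thus ?thesis using osc0[OF v ij(1) *(2)] osc0[OF w ij(2) *(1)] by linarith
  qed
  define c where "c n x = (SOME w. w \<in> words n \<and> x \<in> cell w)" for n x
  have c: "c n x \<in> words n" "x \<in> cell (c n x)" if "x \<in> gasket" for n x
    using someI_ex[OF ex_cell[OF that, of n]] by (auto simp: c_def)
  have step: "\<bar>T (c m x) 0 - T (c n x) 0\<bar> \<le> 3 * \<omega> n" if x: "x \<in> gasket" and nm: "n \<le> m" for n m x
  proof -
    obtain v u where vu: "c m x = v @ u" "v \<in> words n" "u \<in> words (m - n)"
      using c(1)[OF x, of m] words_add[of n "m - n"] nm by auto
    have "x \<in> cell v" using c(2)[OF x, of m] vu cell_append_subset[OF vu(3)] by auto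
    hence "\<bar>T v 0 - T (c n x) 0\<bar> \<le> 2 * \<omega> n" using share[OF vu(2) c(1)[OF x] _ _ _ c(2)[OF x]] by simp
    moreover have "\<bar>T (c m x) 0 - T v 0\<bar> \<le> \<omega> n" using osc[OF vu(2,3), of 0 0] vu(1) by simp
    ultimately show ?thesis by linarith
  qed
  define g where "g x = lim (\<lambda>n. T (c n x) 0)" for x
  have lim: "(\<lambda>n. T (c n x) 0) \<longlonglongrightarrow> g x" if x: "x \<in> gasket" for x
  proof -
    have "Cauchy (\<lambda>n. T (c n x) 0)"
    proof (rule metric_CauchyI)
      fix e :: real assume "0 < e"
      hence "\<forall>\<^sub>F n in sequentially. \<omega> n < e / 6" using \<omega>_lim by (intro order_tendstoD(2)) auto
      then obtain N where N: "\<omega> N < e / 6" by (auto simp: eventually_sequentially)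
      show "\<exists>M. \<forall>m\<ge>M. \<forall>n\<ge>M. dist (T (c m x) 0) (T (c n x) 0) < e"
      proof (intro exI allI impI)
        fix m n assume "N \<le> m" "N \<le> n"
        thus "dist (T (c m x) 0) (T (c n x) 0) < e"
          using step[OF x, of N m] step[OF x, of N n] N by (simp add: dist_real_def)
      qed
    qed
    thus ?thesis unfolding g_def by (simp add: Cauchy_convergent_iff convergent_LIMSEQ_iff)
  qed
  have close: "\<bar>g x - T w i\<bar> \<le> 5 * \<omega> n"
    if x: "x \<in> gasket" and w: "w \<in> words n" "x \<in> cell w" and i: "i \<in> {0,1,2}" for x w n i
  proof -
    have "(\<lambda>m. \<bar>T (c m x) 0 - T (c n x) 0\<bar>) \<longlonglongrightarrow> \<bar>g x - T (c n x) 0\<bar>"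
      by (intro tendsto_intros lim[OF x])
    from LIMSEQ_le_const2[OF this] step[OF x] have "\<bar>g x - T (c n x) 0\<bar> \<le> 3 * \<omega> n" by blast
    moreover have "\<bar>T (c n x) 0 - T w i\<bar> \<le> 2 * \<omega> n"
      using share[OF c(1)[OF x] w(1) _ i c(2)[OF x] w(2)] by simp
    ultimately show ?thesis by linarith
  qed
  have vert: "g (word_map w (sg_vertex i)) = T w i" if w: "w \<in> words n" and i: "i \<in> {0,1,2}" for w n i
  proof -
    let ?x = "word_map w (sg_vertex i)"
    \<comment> \<open>The words w i^m name shrinking cells with the same point as vertex i and, by
      compatibility, the same value of T there.\<close>
    have "\<bar>g ?x - T w i\<bar> \<le> 5 * \<omega> (n + m)" for m
    proof -
      have wm: "w @ replicate m i \<in> words (n + m)" using append_words[OF w replicate_in_words[OF i]] .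
      have "?x = word_map (w @ replicate m i) (sg_vertex i)" by (simp add: word_map_append)
      hence "?x \<in> cell (w @ replicate m i)" using word_map_vertex_in_cell[OF i] by metis
      from close[OF word_map_vertex_in_gasket[OF w i] wm this i] show ?thesis
        using compatible_replicate[OF T w i] by simp
    qed
    moreover have lim0: "(\<lambda>m. 5 * \<omega> (n + m)) \<longlonglongrightarrow> 5 * 0"
      using LIMSEQ_ignore_initial_segment[OF \<omega>_lim, of n] by (intro tendsto_intros) (simp add: add.commute)
    ultimately have "\<bar>g ?x - T w i\<bar> \<le> 5 * 0" by (intro LIMSEQ_le_const[OF lim0]) blast
    thus ?thesis by simp
  qed
  have "continuous_on gasket g"
    unfolding continuous_on_iff
  proof (intro ballI allI impI)
    fix x and e :: real assume x: "x \<in> gasket" and "0 < e"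
    hence "\<forall>\<^sub>F n in sequentially. \<omega> n < e / 10" using \<omega>_lim by (intro order_tendstoD(2)) auto
    then obtain n where n: "\<omega> n < e / 10" by (auto simp: eventually_sequentially)
    obtain d where d: "d > 0" "\<And>y w. dist y x < d \<Longrightarrow> w \<in> words n \<Longrightarrow> y \<in> cell w \<Longrightarrow> x \<in> cell w"
      using cell_neighbourhood[OF x, of n] by blast
    show "\<exists>d>0. \<forall>y\<in>gasket. dist y x < d \<longrightarrow> dist (g y) (g x) < e"
    proof (intro exI conjI ballI impI)
      fix y assume y: "y \<in> gasket" "dist y x < d"
      have "x \<in> cell (c n y)" using d(2)[OF y(2) c[OF y(1)]] .
      hence "\<bar>g x - T (c n y) 0\<bar> \<le> 5 * \<omega> n" "\<bar>g y - T (c n y) 0\<bar> \<le> 5 * \<omega> n"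
        using close[OF x c(1)[OF y(1)]] close[OF y(1) c[OF y(1)]] by auto
      thus "dist (g y) (g x) < e" using n by (simp add: dist_real_def)
    qed (rule d(1))
  qed
  thus ?thesis using vert by blast
qed

subsection \<open>Means of continuous functions\<close>

lemma continuous_gasket_bounded:
  assumes "continuous_on gasket g"
  obtains M where "\<And>x. x \<in> gasket \<Longrightarrow> \<bar>g x :: real\<bar> \<le> M"
proof -
  have "bounded (g ` gasket)"
    by (rule compact_imp_bounded[OF compact_continuous_image[OF assms gasket(1)]])
  thus ?thesis using that by (auto simp: bounded_iff)
qed

lemma continuous_L2:
  assumes g: "continuous_on gasket g"
  shows "g \<in> L2 sg_measure"
proof -
  have m [measurable]: "g \<in> borel_measurable sg_measure" by (rule borel_measurable_continuous_gasket[OF g])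
  obtain M where M: "\<And>x. x \<in> gasket \<Longrightarrow> \<bar>g x\<bar> \<le> M" by (rule continuous_gasket_bounded[OF g]) blast
  have "integrable sg_measure (\<lambda>x. (g x)\<^sup>2)"
  proof (rule sg.integrable_const_bound)
    show "AE x in sg_measure. norm ((g x)\<^sup>2) \<le> M\<^sup>2"
    proof (rule AE_I2)
      fix x assume "x \<in> space sg_measure"
      hence "\<bar>g x\<bar> \<le> M" using M by simp
      thus "norm ((g x)\<^sup>2) \<le> M\<^sup>2" by (simp add: abs_le_square_iff[symmetric])
    qed
  qed measurable
  thus ?thesis using m by (simp add: L2_def)
qed

lemma cell_average_near:
  assumes u: "integrable sg_measure u" and w: "w \<in> words n"
    and near: "AE x in sg_measure. x \<in> cell w \<longrightarrow> \<bar>u x - c\<bar> \<le> e"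
  shows "\<bar>cell_average u w - c\<bar> \<le> e"
proof -
  have cw: "cell w \<in> sets sg_measure" by (rule cell_sets[OF w])
  have si: "integrable sg_measure (\<lambda>x. indicator (cell w) x * u x)"
    using integrable_mult_indicator[OF cw u] by simp
  have ic: "integrable sg_measure (\<lambda>x. indicator (cell w) x :: real)"
    using cw by (simp add: sg.emeasure_eq_measure)
  have m: "measure sg_measure (cell w) = (1/3) ^ n" by (rule measure_cell[OF w])
  have int: "cell w \<inter> gasket = cell w" using cell_subset_gasket[OF w] by blast
  have eq: "(1/3) ^ n * (cell_average u w - c) = (\<integral>x. indicator (cell w) x * u x - c * indicator (cell w) x \<partial>sg_measure)"
  proof -
    have "(\<integral>x. indicator (cell w) x * u x - c * indicator (cell w) x \<partial>sg_measure)
        = (\<integral>x. indicator (cell w) x * u x \<partial>sg_measure) - c * measure sg_measure (cell w)"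
      using cw si ic by (subst Bochner_Integration.integral_diff) (auto simp: int)
    also have "(\<integral>x. indicator (cell w) x * u x \<partial>sg_measure) = (1/3) ^ n * cell_average u w"
      unfolding cell_average_def set_lebesgue_integral_def m by simp
    finally show ?thesis by (simp add: m algebra_simps)
  qed
  have "\<bar>(1/3) ^ n * (cell_average u w - c)\<bar> \<le> (\<integral>x. \<bar>indicator (cell w) x * u x - c * indicator (cell w) x\<bar> \<partial>sg_measure)"
    unfolding eq by (rule integral_abs_bound)
  also have "\<dots> \<le> (\<integral>x. e * indicator (cell w) x \<partial>sg_measure)"
  proof (rule integral_mono_AE)
    show "AE x in sg_measure. \<bar>indicator (cell w) x * u x - c * indicator (cell w) x\<bar> \<le> e * indicator (cell w) x"
      using near by eventually_elim (auto simp: indicator_def)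
  qed (use si ic in auto)
  also have "\<dots> = (1/3) ^ n * e" using cw m by (simp add: int)
  finally have "(1/3) ^ n * \<bar>cell_average u w - c\<bar> \<le> (1/3) ^ n * e" by (simp add: abs_mult)
  thus ?thesis by simp
qed

lemma cell_average_cong_AE:
  assumes u: "integrable sg_measure u" and v: "v \<in> borel_measurable sg_measure" and w: "w \<in> words n"
    and eq: "AE x in sg_measure. x \<in> cell w \<longrightarrow> u x = v x"
  shows "cell_average u w = cell_average v w"
proof -
  have [measurable]: "u \<in> borel_measurable sg_measure" "cell w \<in> sets sg_measure"
    using u cell_sets[OF w] by auto
  note v [measurable]
  have "(LINT x:cell w|sg_measure. u x) = (LINT x:cell w|sg_measure. v x)"
    unfolding set_lebesgue_integral_def
  proof (rule integral_cong_AE)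
    show "AE x in sg_measure. indicator (cell w) x *\<^sub>R u x = indicator (cell w) x *\<^sub>R v x"
      using eq by eventually_elim (auto simp: indicator_def)
  qed measurable
  thus ?thesis by (simp add: cell_average_def)
qed

lemma continuous_osc_cell:
  assumes g: "continuous_on gasket g" and e: "0 < (e :: real)"
  shows "\<exists>N. \<forall>n\<ge>N. \<forall>w\<in>words n. \<forall>x\<in>cell w. \<forall>y\<in>cell w. \<bar>g x - g y :: real\<bar> \<le> e"
proof -
  have "uniformly_continuous_on gasket g" by (rule compact_uniformly_continuous[OF g gasket(1)])
  then obtain d where d: "d > 0" "\<And>x y. x \<in> gasket \<Longrightarrow> y \<in> gasket \<Longrightarrow> dist x y < d \<Longrightarrow> dist (g x) (g y) < e"
    using e unfolding uniformly_continuous_on_def by metis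
  have "\<forall>\<^sub>F n in sequentially. 2 / 2 ^ n < d" using order_tendstoD(2)[OF LIMSEQ_divide_pow2 d(1)] .
  then obtain N where N: "\<And>n. n \<ge> N \<Longrightarrow> 2 / 2 ^ n < d" by (auto simp: eventually_sequentially)
  show ?thesis
  proof (intro exI allI impI ballI)
    fix n w x y assume n: "N \<le> n" and w: "w \<in> words n" and xy: "x \<in> cell w" "y \<in> cell w"
    have "dist x y < d" using dist_cell_le[OF w xy] N[OF n] by linarith
    moreover have "x \<in> gasket" "y \<in> gasket" using cell_subset_gasket[OF w] xy by auto
    ultimately have "dist (g x) (g y) < e" using d(2) by blast
    thus "\<bar>g x - g y\<bar> \<le> e" by (simp add: dist_real_def)
  qed
qed

lemma cell_average_continuous_near:
  assumes g: "continuous_on gasket g" and e: "0 < (e :: real)"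
  shows "\<exists>N. \<forall>n\<ge>N. \<forall>w\<in>words n. \<forall>x\<in>cell w. \<bar>cell_average g w - g x\<bar> \<le> e"
proof -
  obtain N where N: "\<And>n w x y. N \<le> n \<Longrightarrow> w \<in> words n \<Longrightarrow> x \<in> cell w \<Longrightarrow> y \<in> cell w \<Longrightarrow> \<bar>g x - g y\<bar> \<le> e"
    using continuous_osc_cell[OF g e] by metis
  show ?thesis
  proof (intro exI allI impI ballI)
    fix n w x assume n: "N \<le> n" and w: "w \<in> words n" and x: "x \<in> cell w"
    show "\<bar>cell_average g w - g x\<bar> \<le> e"
      by (rule cell_average_near[OF L2_integrable[OF continuous_L2[OF g]] w])
         (intro AE_I2 impI, rule N[OF n w _ x])
  qed
qed

lemma asymptotic_to_vertex_values: "continuous_on gasket g \<Longrightarrow> asymptotic_to (cell_average g) (vertex_values g)"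
  unfolding asymptotic_to_def
proof (intro allI impI)
  fix e :: real assume g: "continuous_on gasket g" and "0 < e"
  then obtain N where N: "\<And>n w x. N \<le> n \<Longrightarrow> w \<in> words n \<Longrightarrow> x \<in> cell w \<Longrightarrow> \<bar>cell_average g w - g x\<bar> \<le> e"
    using cell_average_continuous_near by metis
  show "\<exists>N. \<forall>n\<ge>N. \<forall>w\<in>words n. \<bar>cell_average g w - vertex_values g w 0\<bar> \<le> e"
  proof (intro exI allI impI ballI)
    fix n w assume "N \<le> n" "w \<in> words n"
    thus "\<bar>cell_average g w - vertex_values g w 0\<bar> \<le> e"
      unfolding vertex_values_def by (rule N) (rule word_map_vertex_in_cell, simp)
  qed
qed

lemma has_means_cell_average: "integrable sg_measure u \<Longrightarrow> has_means (cell_average u)"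
  unfolding has_means_def using cell_average_mean by blast

text \<open>A mean is the average of means at arbitrarily deep descendants, and these are
  asymptotically prescribed by T.\<close>

lemma means_unique:
  assumes A: "has_means A" "asymptotic_to A T" and A': "has_means A'" "asymptotic_to A' T" and w: "w \<in> words n"
  shows "A w = A' w"
proof -
  have "\<bar>A w - A' w\<bar> \<le> 0"
  proof (rule field_le_epsilon)
    fix e :: real assume "0 < e"
    hence "0 < e / 2" by simp
    obtain N where N: "\<And>n w. N \<le> n \<Longrightarrow> w \<in> words n \<Longrightarrow> \<bar>A w - T w 0\<bar> \<le> e / 2"
      using A(2) \<open>0 < e / 2\<close> unfolding asymptotic_to_def by blast
    obtain N' where N': "\<And>n w. N' \<le> n \<Longrightarrow> w \<in> words n \<Longrightarrow> \<bar>A' w - T w 0\<bar> \<le> e / 2"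
      using A'(2) \<open>0 < e / 2\<close> unfolding asymptotic_to_def by blast
    let ?m = "max N N'"
    have "A w - A' w = (\<Sum>v\<in>words ?m. A (w @ v) - A' (w @ v)) / 3 ^ ?m"
      using has_means_iter[OF A(1) w, of ?m] has_means_iter[OF A'(1) w, of ?m]
      by (simp add: sum_subtractf diff_divide_distrib)
    hence "\<bar>A w - A' w\<bar> = \<bar>\<Sum>v\<in>words ?m. A (w @ v) - A' (w @ v)\<bar> / 3 ^ ?m" by simp
    also have "\<dots> \<le> (\<Sum>v\<in>words ?m. \<bar>A (w @ v) - A' (w @ v)\<bar>) / 3 ^ ?m"
      by (intro divide_right_mono sum_abs) auto
    also have "\<dots> \<le> (\<Sum>v\<in>words ?m. e) / 3 ^ ?m"
    proof (intro divide_right_mono sum_mono)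
      fix v assume "v \<in> words ?m"
      hence "w @ v \<in> words (n + ?m)" using append_words[OF w] by blast
      hence "\<bar>A (w @ v) - T (w @ v) 0\<bar> \<le> e / 2" "\<bar>A' (w @ v) - T (w @ v) 0\<bar> \<le> e / 2"
        using N[OF trans_le_add2[OF max.cobounded1]] N'[OF trans_le_add2[OF max.cobounded2]] by blast+
      thus "\<bar>A (w @ v) - A' (w @ v)\<bar> \<le> e" by linarith
    qed auto
    also have "\<dots> = e" by (simp add: card_words)
    finally show "\<bar>A w - A' w\<bar> \<le> 0 + e" by simp
  qed
  thus ?thesis by simp
qed

section \<open>Functions with vanishing cell means\<close>

lemma sets_sg_measure_closed: "sets sg_measure = sigma_sets gasket {C. closed C \<and> C \<subseteq> gasket}"
proof -
  have b: "sets borel = sigma_sets UNIV {C :: (real^2) set. closed C}" by (simp add: borel_eq_closed)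
  have "(\<inter>) gasket ` sigma_sets UNIV {C. closed C} = sigma_sets gasket ((\<inter>) gasket ` {C. closed C})"
    by (rule sigma_sets_Int) (use gasket_borel b in auto)
  moreover have "(\<inter>) gasket ` {C. closed C} = {C. closed C \<and> C \<subseteq> gasket}"
    using compact_imp_closed[OF gasket(1)] by (auto intro!: image_eqI)
  ultimately show ?thesis by (simp only: sets_sg_measure sets_restrict_space b)
qed

text \<open>The union \<open>D n\<close> of the level n cells that meet C tends to C, because a
  small cell around a point outside C misses C. The integral over \<open>D n\<close> is a
  combination of cell means, and dominated convergence passes to C.\<close>

lemma integral_closed_eq_0:
  assumes u: "integrable sg_measure u" and 0: "\<And>n w. w \<in> words n \<Longrightarrow> cell_average u w = 0"
    and C: "closed C" "C \<subseteq> gasket"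
  shows "(\<integral>x. indicator C x * u x \<partial>sg_measure) = 0"
proof -
  define S where "S n = {w \<in> words n. cell w \<inter> C \<noteq> {}}" for n
  define D where "D n = (\<Union>w\<in>S n. cell w)" for n
  have Dm: "D n \<in> sets sg_measure" for n
    unfolding D_def S_def by (intro sets.finite_UN) (auto intro: cell_sets)
  have Cm: "C \<in> sets sg_measure" using C by (simp add: in_sets_sg_measure)
  have um [measurable]: "u \<in> borel_measurable sg_measure" using u by auto
  have "(\<lambda>n. \<integral>x. indicator (D n) x * u x \<partial>sg_measure) \<longlonglongrightarrow> (\<integral>x. indicator C x * u x \<partial>sg_measure)"
  proof (rule integral_dominated_convergence[where w="\<lambda>x. \<bar>u x\<bar>"])
    show "AE x in sg_measure. (\<lambda>n. indicator (D n) x * u x) \<longlonglongrightarrow> indicator C x * u x"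
    proof (rule AE_I2)
      fix x assume "x \<in> space sg_measure"
      hence x: "x \<in> gasket" by simp
      have "\<forall>\<^sub>F n in sequentially. x \<in> D n \<longleftrightarrow> x \<in> C"
      proof (cases "x \<in> C")
        case True
        have "x \<in> D n" for n
        proof -
          obtain w where "w \<in> words n" "x \<in> cell w" using ex_cell[OF x] by blast
          thus ?thesis using True by (auto simp: D_def S_def)
        qed
        thus ?thesis using True by simp
      next
        case False
        then obtain d where d: "d > 0" "\<And>y. dist y x < d \<Longrightarrow> y \<in> - C"
          using C(1) unfolding closed_def open_dist by blast
        have "\<forall>\<^sub>F n in sequentially. 2 / 2 ^ n < d" using order_tendstoD(2)[OF LIMSEQ_divide_pow2 d(1)] .
        thus ?thesis
        proof eventually_elim
          case (elim n)
          have "x \<notin> D n"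
          proof
            assume "x \<in> D n"
            then obtain w y where w: "w \<in> words n" "x \<in> cell w" "y \<in> cell w" "y \<in> C" by (auto simp: D_def S_def)
            hence "dist y x < d" using dist_cell_le[OF w(1) w(3) w(2)] elim by simp
            thus False using d(2)[of y] w(4) by simp
          qed
          thus ?case using False by simp
        qed
      qed
      hence "\<forall>\<^sub>F n in sequentially. indicator (D n) x * u x = indicator C x * u x"
        by eventually_elim (simp add: indicator_def)
      thus "(\<lambda>n. indicator (D n) x * u x) \<longlonglongrightarrow> indicator C x * u x" by (rule tendsto_eventually)
    qed
    show "AE x in sg_measure. norm (indicator (D n) x * u x) \<le> \<bar>u x\<bar>" for n
      by (rule AE_I2) (simp add: indicator_def)
  qed (use u Cm Dm in auto)
  moreover have "(\<integral>x. indicator (D n) x * u x \<partial>sg_measure) = 0" for n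
  proof -
    have "(\<integral>x. indicator (D n) x * u x \<partial>sg_measure) = (\<Sum>w\<in>S n. cell_average u w) / 3 ^ n"
      unfolding D_def by (rule integral_cells[OF u]) (simp add: S_def)
    also have "(\<Sum>w\<in>S n. cell_average u w) = 0"
      by (intro sum.neutral ballI 0[of _ n]) (simp add: S_def)
    finally show ?thesis by simp
  qed
  ultimately show ?thesis by (simp add: LIMSEQ_const_iff)
qed

text \<open>The positive and the negative part of u, taken as densities, give measures that agree on
  closed sets. These are stable under intersection and generate the sigma-algebra, so the measures
  and then the densities agree.\<close>

lemma AE_eq_0_if_cell_averages_0:
  assumes u: "integrable sg_measure u" and 0: "\<And>n w. w \<in> words n \<Longrightarrow> cell_average u w = 0"
  shows "AE x in sg_measure. u x = 0"
proof -
  have um [measurable]: "u \<in> borel_measurable sg_measure" using u by auto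
  let ?M = "density sg_measure (\<lambda>x. ennreal (u x))" and ?N = "density sg_measure (\<lambda>x. ennreal (- u x))"
  have ind: "integrable sg_measure (\<lambda>x. indicator C x * max 0 (v x) :: real)"
    if C: "C \<in> sets sg_measure" and v: "integrable sg_measure v" for C v
    using integrable_mult_indicator[OF C integrable_max[OF integrable_zero v]] by simp
  note pos = ind[OF _ u] and neg = ind[OF _ Bochner_Integration.integrable_minus[OF u]]
  have eP: "emeasure ?M C = ennreal (\<integral>x. indicator C x * max 0 (u x) \<partial>sg_measure)"
    and eN: "emeasure ?N C = ennreal (\<integral>x. indicator C x * max 0 (- u x) \<partial>sg_measure)"
    if C: "C \<in> sets sg_measure" for C
  proof -
    have "emeasure ?M C = (\<integral>\<^sup>+x. ennreal (indicator C x * max 0 (u x)) \<partial>sg_measure)"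
      using C by (subst emeasure_density) (auto intro!: nn_integral_cong simp: indicator_def max_def ennreal_neg)
    thus "emeasure ?M C = ennreal (\<integral>x. indicator C x * max 0 (u x) \<partial>sg_measure)"
      using nn_integral_eq_integral[OF pos[OF C]] by simp
    have "emeasure ?N C = (\<integral>\<^sup>+x. ennreal (indicator C x * max 0 (- u x)) \<partial>sg_measure)"
      using C by (subst emeasure_density) (auto intro!: nn_integral_cong simp: indicator_def max_def ennreal_neg)
    thus "emeasure ?N C = ennreal (\<integral>x. indicator C x * max 0 (- u x) \<partial>sg_measure)"
      using nn_integral_eq_integral[OF neg[OF C]] by simp
  qed
  let ?E = "{C. closed C \<and> C \<subseteq> gasket}"
  have "?M = ?N"
  proof (rule measure_eqI_generator_eq[where \<Omega>=gasket and E="?E" and A="\<lambda>_. gasket"])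
    show "Int_stable ?E" by (auto simp: Int_stable_def)
    fix C assume C: "C \<in> ?E"
    hence Cm: "C \<in> sets sg_measure" by (simp add: in_sets_sg_measure)
    have "(\<integral>x. indicator C x * max 0 (u x) \<partial>sg_measure) - (\<integral>x. indicator C x * max 0 (- u x) \<partial>sg_measure)
      = (\<integral>x. indicator C x * max 0 (u x) - indicator C x * max 0 (- u x) \<partial>sg_measure)"
      by (rule Bochner_Integration.integral_diff[symmetric]) (intro pos neg Cm)+
    also have "\<dots> = (\<integral>x. indicator C x * u x \<partial>sg_measure)"
      by (intro Bochner_Integration.integral_cong) (auto simp: indicator_def)
    also have "\<dots> = 0" using C by (intro integral_closed_eq_0[OF u 0]) auto
    finally show "emeasure ?M C = emeasure ?N C" by (simp add: eP[OF Cm] eN[OF Cm])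
  next
    show "emeasure ?M gasket \<noteq> \<infinity>" using eP[of gasket] by (simp add: in_sets_sg_measure)
  qed (use compact_imp_closed[OF gasket(1)] in \<open>auto simp: sets_sg_measure_closed\<close>)
  \<comment> \<open>\<open>ennreal\<close> sends negative numbers to 0, so one of the two sides
    vanishes at every point and equality forces u x = 0.\<close>
  hence "AE x in sg_measure. ennreal (u x) = ennreal (- u x)"
    by (subst (asm) sg.density_unique_iff) auto
  thus ?thesis
  proof eventually_elim
    case (elim x)
    show "u x = 0" using elim by (cases "u x" "0::real" rule: linorder_cases) (auto simp: ennreal_neg)
  qed
qed

subsection \<open>Continuous representatives\<close>

definition represents :: "(real^2 \<Rightarrow> real) \<Rightarrow> (real^2 \<Rightarrow> real) \<Rightarrow> bool" where
  "represents g u \<longleftrightarrow> continuous_on gasket g \<and> ae_eq sg_measure u g"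

abbreviation sg_energy :: "nat \<Rightarrow> (real^2 \<Rightarrow> real) \<Rightarrow> (real^2 \<Rightarrow> real) \<Rightarrow> real" where
  "sg_energy n g h \<equiv> vertex_energy n (vertex_values g) (vertex_values h)"

lemma discrete_energy_eq: "discrete_energy n u = pair_energy n (cell_average u)"
  by (simp add: discrete_energy_def pair_energy_def adj_pairs_def)

lemma continuous_eqI:
  assumes g: "continuous_on gasket g" and h: "continuous_on gasket h"
    and eq: "\<And>n w. w \<in> words n \<Longrightarrow> cell_average g w = cell_average h w" and x: "x \<in> gasket"
  shows "g x = h x"
proof -
  have "\<bar>g x - h x\<bar> \<le> 0"
  proof (rule field_le_epsilon)
    fix e :: real assume "0 < e"
    hence e: "0 < e / 2" by simp
    obtain N where N: "\<And>n w x. N \<le> n \<Longrightarrow> w \<in> words n \<Longrightarrow> x \<in> cell w \<Longrightarrow> \<bar>cell_average g w - g x\<bar> \<le> e / 2"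
      using cell_average_continuous_near[OF g e] by metis
    obtain N' where N': "\<And>n w x. N' \<le> n \<Longrightarrow> w \<in> words n \<Longrightarrow> x \<in> cell w \<Longrightarrow> \<bar>cell_average h w - h x\<bar> \<le> e / 2"
      using cell_average_continuous_near[OF h e] by metis
    obtain w where w: "w \<in> words (max N N')" "x \<in> cell w" using ex_cell[OF x] by blast
    have "\<bar>cell_average g w - g x\<bar> \<le> e / 2" "\<bar>cell_average h w - h x\<bar> \<le> e / 2"
      by (rule N[OF max.cobounded1 w], rule N'[OF max.cobounded2 w])
    thus "\<bar>g x - h x\<bar> \<le> 0 + e" using eq[OF w(1)] by linarith
  qed
  thus ?thesis by simp
qed

lemma represents_cell_average:
  assumes "represents g u" "u \<in> L2 sg_measure" "w \<in> words n"
  shows "cell_average u w = cell_average g w"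
  by (rule cell_average_cong_AE[OF L2_integrable[OF assms(2)] borel_measurable_continuous_gasket assms(3)])
     (use assms(1) in \<open>auto simp: represents_def ae_eq_def\<close>)

text \<open>Almost everywhere equality preserves cell means, and the means over shrinking cells
  recover a continuous function at every point of the gasket. Energies, which use single points,
  thus depend only on the class of u.\<close>

lemma represents_unique:
  assumes "represents g u" "represents h u" "u \<in> L2 sg_measure" "x \<in> gasket"
  shows "g x = h x"
  using assms continuous_eqI[of g h x] represents_cell_average[of g u] represents_cell_average[of h u]
  by (fastforce simp: represents_def)

lemma vertex_energy_cong:
  assumes "\<And>w i. w \<in> words n \<Longrightarrow> i \<in> {0,1,2} \<Longrightarrow> S w i = S' w i"
    and "\<And>w i. w \<in> words n \<Longrightarrow> i \<in> {0,1,2} \<Longrightarrow> T w i = T' w i"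
  shows "vertex_energy n S T = vertex_energy n S' T'"
  unfolding vertex_energy_def cell_form_def using assms by (intro arg_cong2[of _ _ _ _ "(*)"] refl sum.cong) auto

lemma sg_energy_cong:
  assumes "\<And>x. x \<in> gasket \<Longrightarrow> g x = g' x" "\<And>x. x \<in> gasket \<Longrightarrow> h x = h' x"
  shows "sg_energy n g h = sg_energy n g' h'"
  by (rule vertex_energy_cong) (auto simp: vertex_values_def intro!: assms word_map_vertex_in_gasket)

proposition ex_representative:
  assumes u: "u \<in> L2 sg_measure" and S: "\<And>n. n \<ge> 1 \<Longrightarrow> (5/3) ^ n * discrete_energy n u \<le> S"
  shows "\<exists>g. represents g u \<and> (\<forall>n. sg_energy n g g \<le> 144 * S)"
proof -
  let ?A = "cell_average u"
  let ?T = "vertex_limit ?A"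
  have ui: "integrable sg_measure u" by (rule L2_integrable[OF u])
  have A: "has_means ?A" by (rule has_means_cell_average[OF ui])
  have S': "\<And>n. n \<ge> 1 \<Longrightarrow> (5/3) ^ n * pair_energy n ?A \<le> S" using S by (simp add: discrete_energy_eq)
  obtain g where g: "continuous_on gasket g"
    and gT: "\<And>n w i. w \<in> words n \<Longrightarrow> i \<in> {0,1,2} \<Longrightarrow> g (word_map w (sg_vertex i)) = ?T w i"
    using continuous_extension[OF compatible_vertex_limit[OF A S'] vertex_energy_vertex_limit_le[OF A S']] by blast
  have vT: "vertex_values g w i = ?T w i" if "w \<in> words n" "i \<in> {0,1,2}" for n w i
    using gT[OF that] by (simp add: vertex_values_def)
  have gi: "integrable sg_measure g" by (rule L2_integrable[OF continuous_L2[OF g]])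
  have "asymptotic_to (cell_average g) ?T"
    using asymptotic_to_vertex_values[OF g] vT[of _ _ 0] unfolding asymptotic_to_def by simp
  hence eq: "?A w = cell_average g w" if "w \<in> words n" for n w
    using means_unique[OF A asymptotic_to_vertex_limit[OF A S'] has_means_cell_average[OF gi] _ that] by blast
  have "AE x in sg_measure. u x - g x = 0"
  proof (rule AE_eq_0_if_cell_averages_0)
    show d: "integrable sg_measure (\<lambda>x. u x - g x)" using ui gi by (rule Bochner_Integration.integrable_diff)
    fix n w assume w: "w \<in> words n"
    have "cell_average (\<lambda>x. u x - g x) w = cell_average u w - cell_average g w"
      unfolding cell_average_eq[OF d w] cell_average_eq[OF ui w] cell_average_eq[OF gi w]
      by (intro Bochner_Integration.integral_diff integrable_comp_word_map[OF _ w] ui gi)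
    thus "cell_average (\<lambda>x. u x - g x) w = 0" using eq[OF w] by simp
  qed
  hence "represents g u" using g by (simp add: represents_def ae_eq_def)
  moreover have "sg_energy n g g \<le> 144 * S" for n
    using vertex_energy_vertex_limit_le[OF A S', of n] vertex_energy_cong[of n "vertex_values g" ?T "vertex_values g" ?T] vT
    by simp
  ultimately show ?thesis by blast
qed

lemma discrete_energy_le:
  assumes u: "u \<in> L2 sg_measure" and g: "represents g u" and B: "\<And>n. sg_energy n g g \<le> B"
  shows "(5/3) ^ n * discrete_energy n u \<le> 1452 * B"
proof -
  have gc: "continuous_on gasket g" using g by (simp add: represents_def)
  have "discrete_energy n u = pair_energy n (cell_average g)"
    unfolding discrete_energy_eq pair_energy_def
  proof (intro sum.cong refl, clarify)
    fix v w assume "(v, w) \<in> adj_pairs n"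
    hence "v \<in> words n" "w \<in> words n" by (auto simp: adj_pairs_def)
    thus "(cell_average u v - cell_average u w)\<^sup>2 = (cell_average g v - cell_average g w)\<^sup>2"
      using represents_cell_average[OF g u] by metis
  qed
  also have "(5/3) ^ n * \<dots> \<le> 1452 * B"
    by (rule pair_energy_le[OF has_means_cell_average[OF L2_integrable[OF continuous_L2[OF gc]]]
      asymptotic_to_vertex_values[OF gc] compatible_vertex_values B])
  finally show ?thesis .
qed

subsection \<open>The bilinear form\<close>

definition sg_domain :: "(real^2 \<Rightarrow> real) set" where
  "sg_domain = {u \<in> L2 sg_measure. sup_energy u < \<infinity>}"

text \<open>The choice of representatives is harmless: \<open>sg_form_tendsto\<close> evaluates the
  form on the domain with any of them.\<close>

definition sg_form :: "(real^2 \<Rightarrow> real) \<Rightarrow> (real^2 \<Rightarrow> real) \<Rightarrow> real" where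
  "sg_form u v = lim (\<lambda>n. sg_energy n (SOME g. represents g u) (SOME h. represents h v))"

lemma cell_form_commute: "cell_form x y = cell_form y x"
  by (simp add: cell_form_def mult.commute)

lemma cell_form_add: "cell_form (\<lambda>i. x i + y i) z = cell_form x z + cell_form y z"
  by (simp add: cell_form_def algebra_simps)

lemma cell_form_scale: "cell_form (\<lambda>i. c * x i) y = c * cell_form x y"
  by (simp add: cell_form_def algebra_simps)

lemma sg_energy_commute: "sg_energy n g h = sg_energy n h g"
  unfolding vertex_energy_def by (subst cell_form_commute) (rule refl)

lemma sg_energy_add: "sg_energy n (\<lambda>x. g x + g' x) h = sg_energy n g h + sg_energy n g' h"
  unfolding vertex_energy_def vertex_values_def cell_form_add sum.distrib by (rule distrib_left)

lemma sg_energy_scale: "sg_energy n (\<lambda>x. c * g x) h = c * sg_energy n g h"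
  unfolding vertex_energy_def vertex_values_def cell_form_scale sum_distrib_left[symmetric] by simp

lemma sg_energy_uminus: "sg_energy n (\<lambda>x. - g x) h = - sg_energy n g h"
  using sg_energy_scale[of n "-1" g h] by simp

lemma sg_energy_diff: "sg_energy n (\<lambda>x. g x - g' x) h = sg_energy n g h - sg_energy n g' h"
  using sg_energy_add[of n g "\<lambda>x. - g' x" h] sg_energy_uminus[of n g' h] by simp

lemma sg_energy_add_self:
  "sg_energy n (\<lambda>x. g x + h x) (\<lambda>x. g x + h x) = sg_energy n g g + 2 * sg_energy n g h + sg_energy n h h"
  using sg_energy_add[of n g h] sg_energy_commute[of n _ "\<lambda>x. g x + h x"] sg_energy_commute[of n h g] by simp

lemma sg_energy_diff_self:
  "sg_energy n (\<lambda>x. g x - h x) (\<lambda>x. g x - h x) = sg_energy n g g - 2 * sg_energy n g h + sg_energy n h h"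
  using sg_energy_diff[of n g h] sg_energy_commute[of n _ "\<lambda>x. g x - h x"] sg_energy_commute[of n h g] by simp

text \<open>The parallelogram identity with the energy of the difference dropped.\<close>

lemma sg_energy_add_le:
  "sg_energy n (\<lambda>x. g x + h x) (\<lambda>x. g x + h x) \<le> 2 * sg_energy n g g + 2 * sg_energy n h h"
  using sg_energy_add_self[of n g h] sg_energy_diff_self[of n g h]
    vertex_energy_nonneg[of n "vertex_values (\<lambda>x. g x - h x)"] by linarith

lemma sg_energy_diff_le:
  "sg_energy n (\<lambda>x. g x - h x) (\<lambda>x. g x - h x) \<le> 2 * sg_energy n g g + 2 * sg_energy n h h"
  using sg_energy_add_self[of n g h] sg_energy_diff_self[of n g h]
    vertex_energy_nonneg[of n "vertex_values (\<lambda>x. g x + h x)"] by linarith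

lemma sg_energy_convergent_self:
  assumes B: "\<And>n. sg_energy n g g \<le> B"
  shows "convergent (\<lambda>n. sg_energy n g g)"
proof (rule Bseq_mono_convergent)
  show "Bseq (\<lambda>n. sg_energy n g g)"
  proof (rule BseqI')
    show "norm (sg_energy n g g) \<le> B" for n
      using B[of n] vertex_energy_nonneg[of n "vertex_values g"] by simp
  qed
  show "\<forall>m n. m \<le> n \<longrightarrow> sg_energy m g g \<le> sg_energy n g g"
    using vertex_energy_mono[OF compatible_vertex_values] by blast
qed

text \<open>Only diagonal energies are monotone; polarization writes the mixed one as a combination
  of three convergent diagonal sequences.\<close>

lemma sg_energy_convergent:
  assumes B: "\<And>n. sg_energy n g g \<le> B" and C: "\<And>n. sg_energy n h h \<le> C"
  shows "convergent (\<lambda>n. sg_energy n g h)"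
proof -
  have b: "sg_energy n (\<lambda>x. g x + h x) (\<lambda>x. g x + h x) \<le> 2 * B + 2 * C" for n
    using sg_energy_add_le[of n g h] B[of n] C[of n] by linarith
  have c: "convergent (\<lambda>n. sg_energy n (\<lambda>x. g x + h x) (\<lambda>x. g x + h x) - sg_energy n g g - sg_energy n h h)"
    by (intro convergent_diff sg_energy_convergent_self[OF b] sg_energy_convergent_self[OF B]
        sg_energy_convergent_self[OF C])
  have eq: "sg_energy n g h = 1/2 * (sg_energy n (\<lambda>x. g x + h x) (\<lambda>x. g x + h x) - sg_energy n g g - sg_energy n h h)" for n
    by (simp add: sg_energy_add_self)
  show ?thesis unfolding eq by (rule convergent_mult[OF convergent_const c])
qed

lemma sg_domain_L2: "u \<in> sg_domain \<Longrightarrow> u \<in> L2 sg_measure"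
  by (simp add: sg_domain_def)

lemma discrete_energy_le_sup:
  assumes "sup_energy u < \<infinity>" "n \<ge> 1"
  shows "(5/3) ^ n * discrete_energy n u \<le> enn2real (sup_energy u)"
proof -
  have "ennreal ((5/3) ^ n * discrete_energy n u) \<le> sup_energy u"
    unfolding sup_energy_def using assms(2) by (intro SUP_upper) auto
  hence "enn2real (ennreal ((5/3) ^ n * discrete_energy n u)) \<le> enn2real (sup_energy u)"
    using assms(1) by (intro enn2real_mono) auto
  moreover have "0 \<le> (5/3) ^ n * discrete_energy n u"
    by (simp add: discrete_energy_eq pair_energy_nonneg)
  ultimately show ?thesis by simp
qed

lemma sup_energy_le:
  assumes "u \<in> L2 sg_measure" "represents g u" "\<And>n. sg_energy n g g \<le> B"
  shows "sup_energy u \<le> ennreal (1452 * B)"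
  unfolding sup_energy_def by (intro SUP_least ennreal_leI discrete_energy_le[OF assms])

lemma sg_domainE:
  assumes "u \<in> sg_domain"
  obtains g where "represents g u" "\<And>n. sg_energy n g g \<le> 144 * enn2real (sup_energy u)"
  using ex_representative[of u "enn2real (sup_energy u)"] discrete_energy_le_sup[of u] assms
  unfolding sg_domain_def by blast

lemma sg_domainI:
  assumes "u \<in> L2 sg_measure" "represents g u" "\<And>n. sg_energy n g g \<le> B"
  shows "u \<in> sg_domain"
  using order.strict_trans1[OF sup_energy_le[OF assms]] assms(1) by (simp add: sg_domain_def)

lemma represents_energy_eq:
  assumes "u \<in> L2 sg_measure" "represents g u" "represents g' u" "v \<in> L2 sg_measure" "represents h v" "represents h' v"
  shows "sg_energy n g h = sg_energy n g' h'"
  by (rule sg_energy_cong) (use represents_unique assms in blast)+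

lemma sg_domain_bounded:
  assumes "u \<in> sg_domain" "represents g u"
  shows "sg_energy n g g \<le> 144 * enn2real (sup_energy u)"
proof -
  obtain h where h: "represents h u" "\<And>n. sg_energy n h h \<le> 144 * enn2real (sup_energy u)"
    by (rule sg_domainE[OF assms(1)]) blast
  thus ?thesis
    using represents_energy_eq[OF sg_domain_L2 assms(2) h(1) sg_domain_L2 assms(2) h(1), OF assms(1) assms(1), of n] by simp
qed

lemma sg_form_tendsto:
  assumes u: "u \<in> sg_domain" and v: "v \<in> sg_domain" and g: "represents g u" and h: "represents h v"
  shows "(\<lambda>n. sg_energy n g h) \<longlonglongrightarrow> sg_form u v"
proof -
  let ?g = "SOME g. represents g u" and ?h = "SOME h. represents h v"
  have r: "represents ?g u" "represents ?h v" using someI[of "\<lambda>g. represents g u", OF g] someI[of "\<lambda>g. represents g v", OF h] .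
  have eq: "sg_energy n g h = sg_energy n ?g ?h" for n
    by (rule represents_energy_eq[OF sg_domain_L2[OF u] g r(1) sg_domain_L2[OF v] h r(2)])
  have "convergent (\<lambda>n. sg_energy n g h)"
    by (rule sg_energy_convergent[OF sg_domain_bounded[OF u g] sg_domain_bounded[OF v h]])
  thus ?thesis unfolding sg_form_def eq by (simp add: convergent_LIMSEQ_iff)
qed

lemma sg_form_unique:
  assumes "u \<in> sg_domain" "v \<in> sg_domain" "represents g u" "represents h v" "(\<lambda>n. sg_energy n g h) \<longlonglongrightarrow> L"
  shows "sg_form u v = L"
  using LIMSEQ_unique[OF sg_form_tendsto[OF assms(1-4)] assms(5)] .

lemma sg_energy_le_form:
  assumes "u \<in> sg_domain" "represents g u"
  shows "sg_energy n g g \<le> sg_form u u"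
proof (rule incseq_le[OF _ sg_form_tendsto[OF assms(1,1,2,2)]])
  show "incseq (\<lambda>n. sg_energy n g g)"
    using vertex_energy_mono[OF compatible_vertex_values] by (simp add: incseq_def)
qed

lemma sg_form_le:
  assumes "u \<in> sg_domain" "represents g u" "\<And>n. sg_energy n g g \<le> B"
  shows "sg_form u u \<le> B"
  using LIMSEQ_le_const2[OF sg_form_tendsto[OF assms(1,1,2,2)]] assms(3) by blast

lemma sg_domain_repE:
  assumes "u \<in> sg_domain"
  obtains g where "represents g u"
  using sg_domainE[OF assms] by blast

lemma sg_form_nonneg: "u \<in> sg_domain \<Longrightarrow> 0 \<le> sg_form u u"
proof -
  assume u: "u \<in> sg_domain"
  obtain g where "represents g u" by (rule sg_domain_repE[OF u])
  from order_trans[OF vertex_energy_nonneg sg_energy_le_form[OF u this]] show ?thesis .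
qed

proposition sg_form_comparable:
  assumes u: "u \<in> sg_domain"
  shows "sup_energy u \<le> ennreal (1452 * sg_form u u)" "ennreal (sg_form u u) \<le> ennreal 144 * sup_energy u"
proof -
  obtain g where g: "represents g u" "\<And>n. sg_energy n g g \<le> 144 * enn2real (sup_energy u)"
    by (rule sg_domainE[OF u]) blast
  show "sup_energy u \<le> ennreal (1452 * sg_form u u)"
    by (rule sup_energy_le[OF sg_domain_L2[OF u] g(1) sg_energy_le_form[OF u g(1)]])
  have "ennreal (sg_form u u) \<le> ennreal (144 * enn2real (sup_energy u))"
    by (intro ennreal_leI sg_form_le[OF u g])
  also have "\<dots> = ennreal 144 * ennreal (enn2real (sup_energy u))" by (simp add: ennreal_mult)
  also have "ennreal (enn2real (sup_energy u)) = sup_energy u"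
    using u by (simp add: sg_domain_def)
  finally show "ennreal (sg_form u u) \<le> ennreal 144 * sup_energy u" .
qed

section \<open>Elementary estimates for square integrable functions\<close>

lemma L2_measurable: "u \<in> L2 M \<Longrightarrow> u \<in> borel_measurable M"
  by (simp add: L2_def)

lemma L2_square_integrable: "u \<in> L2 M \<Longrightarrow> integrable M (\<lambda>x. (u x)\<^sup>2)"
  by (simp add: L2_def)

lemma power2_sum_le: "(a + b)\<^sup>2 \<le> 2 * a\<^sup>2 + 2 * (b :: real)\<^sup>2"
  using zero_le_power2[of "a - b"] by (simp add: power2_eq_square algebra_simps)

lemma L2_add:
  assumes "u \<in> L2 M" "v \<in> L2 M"
  shows "(\<lambda>x. u x + v x) \<in> L2 M"
proof -
  note [measurable] = L2_measurable[OF assms(1)] L2_measurable[OF assms(2)]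
  have "integrable M (\<lambda>x. (u x + v x)\<^sup>2)"
  proof (rule Bochner_Integration.integrable_bound)
    show "integrable M (\<lambda>x. 2 * (u x)\<^sup>2 + 2 * (v x)\<^sup>2)"
      using assms by (auto simp: L2_def)
    show "AE x in M. norm ((u x + v x)\<^sup>2) \<le> norm (2 * (u x)\<^sup>2 + 2 * (v x)\<^sup>2)"
      using power2_sum_le by (intro AE_I2) (simp add: order_trans[OF _ abs_ge_self])
  qed measurable
  thus ?thesis by (simp add: L2_def)
qed

lemma L2_scale: "u \<in> L2 M \<Longrightarrow> (\<lambda>x. c * u x) \<in> L2 M"
  by (auto simp: L2_def power_mult_distrib)

lemma L2_diff:
  assumes "u \<in> L2 M" "v \<in> L2 M"
  shows "(\<lambda>x. u x - v x) \<in> L2 M"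
  using L2_add[OF assms(1) L2_scale[OF assms(2), of "-1"]] by simp

lemma L2_norm2_add_le:
  assumes "u \<in> L2 M" "v \<in> L2 M"
  shows "L2_norm2 M (\<lambda>x. u x + v x) \<le> 2 * L2_norm2 M u + 2 * L2_norm2 M v"
proof -
  have "L2_norm2 M (\<lambda>x. u x + v x) \<le> (\<integral>x. 2 * (u x)\<^sup>2 + 2 * (v x)\<^sup>2 \<partial>M)"
    unfolding L2_norm2_def using assms L2_add[OF assms]
    by (intro integral_mono power2_sum_le) (auto simp: L2_def)
  also have "\<dots> = 2 * L2_norm2 M u + 2 * L2_norm2 M v"
    using assms by (simp add: L2_norm2_def L2_def)
  finally show ?thesis .
qed

lemma L2_norm2_nonneg: "0 \<le> L2_norm2 M u"
  by (simp add: L2_norm2_def)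

lemma L2_norm2_sg_le:
  assumes u: "u \<in> L2 sg_measure" and b: "AE x in sg_measure. \<bar>u x\<bar> \<le> b"
  shows "L2_norm2 sg_measure u \<le> b\<^sup>2"
proof -
  have "L2_norm2 sg_measure u \<le> (\<integral>x. b\<^sup>2 \<partial>sg_measure)"
    unfolding L2_norm2_def
  proof (rule integral_mono_AE)
    show "AE x in sg_measure. (u x)\<^sup>2 \<le> b\<^sup>2"
      using b by eventually_elim (simp add: abs_le_square_iff[symmetric])
  qed (use u in \<open>auto simp: L2_def\<close>)
  thus ?thesis by simp
qed

section \<open>Linearity of the domain and bilinearity of the form\<close>

lemma represents_self: "continuous_on gasket g \<Longrightarrow> represents g g"
  by (simp add: represents_def ae_eq_def)

lemma represents_add: "represents g u \<Longrightarrow> represents h v \<Longrightarrow> represents (\<lambda>x. g x + h x) (\<lambda>x. u x + v x)"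
  unfolding represents_def ae_eq_def by (auto intro: continuous_on_add)

lemma represents_scale: "represents g u \<Longrightarrow> represents (\<lambda>x. c * g x) (\<lambda>x. c * u x)"
  unfolding represents_def ae_eq_def by (auto intro: continuous_intros)

lemma represents_diff: "represents g u \<Longrightarrow> represents h v \<Longrightarrow> represents (\<lambda>x. g x - h x) (\<lambda>x. u x - v x)"
  unfolding represents_def ae_eq_def by (auto intro: continuous_on_diff)

lemma represents_ae_eq: "represents g u \<Longrightarrow> ae_eq sg_measure u v \<Longrightarrow> represents g v"
  unfolding represents_def ae_eq_def by auto

lemma sg_domain_continuous:
  assumes "continuous_on gasket g" "\<And>n. sg_energy n g g \<le> B"
  shows "g \<in> sg_domain"
  by (rule sg_domainI[OF continuous_L2[OF assms(1)] represents_self[OF assms(1)] assms(2)])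

lemma sg_domain_ae_eq:
  assumes "u \<in> sg_domain" "v \<in> L2 sg_measure" "ae_eq sg_measure u v"
  shows "v \<in> sg_domain"
  by (rule sg_domain_repE[OF assms(1)])
     (blast intro: sg_domainI assms represents_ae_eq sg_domain_bounded)

lemma sg_domain_add:
  assumes "u \<in> sg_domain" "v \<in> sg_domain"
  shows "(\<lambda>x. u x + v x) \<in> sg_domain"
proof -
  obtain g h where g: "represents g u" and h: "represents h v"
    using sg_domain_repE assms by metis
  show ?thesis
  proof (rule sg_domainI[OF L2_add represents_add[OF g h]])
    fix n
    show "sg_energy n (\<lambda>x. g x + h x) (\<lambda>x. g x + h x) \<le>
        2 * (144 * enn2real (sup_energy u)) + 2 * (144 * enn2real (sup_energy v))"
      using sg_energy_add_le[of n g h] sg_domain_bounded[OF assms(1) g, of n] sg_domain_bounded[OF assms(2) h, of n]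
      by linarith
  qed (use assms sg_domain_L2 in blast)+
qed

lemma sg_domain_scale:
  assumes "u \<in> sg_domain"
  shows "(\<lambda>x. c * u x) \<in> sg_domain"
proof -
  obtain g where g: "represents g u" using sg_domain_repE assms by metis
  show ?thesis
  proof (rule sg_domainI[OF L2_scale[OF sg_domain_L2[OF assms]] represents_scale[OF g]])
    fix n
    have "sg_energy n (\<lambda>x. c * g x) (\<lambda>x. c * g x) = c\<^sup>2 * sg_energy n g g"
      using sg_energy_scale[of n c g] sg_energy_commute[of n g "\<lambda>x. c * g x"] by (simp add: power2_eq_square)
    also have "\<dots> \<le> c\<^sup>2 * (144 * enn2real (sup_energy u))"
      by (intro mult_left_mono sg_domain_bounded[OF assms g]) auto
    finally show "sg_energy n (\<lambda>x. c * g x) (\<lambda>x. c * g x) \<le> c\<^sup>2 * (144 * enn2real (sup_energy u))" .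
  qed
qed

lemma sg_domain_diff: "u \<in> sg_domain \<Longrightarrow> v \<in> sg_domain \<Longrightarrow> (\<lambda>x. u x - v x) \<in> sg_domain"
  using sg_domain_add[of u "\<lambda>x. -1 * v x"] sg_domain_scale[of v "-1"] by simp

lemma sg_form_commute:
  assumes "u \<in> sg_domain" "v \<in> sg_domain"
  shows "sg_form u v = sg_form v u"
proof -
  obtain g h where g: "represents g u" and h: "represents h v"
    using sg_domain_repE assms by metis
  have "(\<lambda>n. sg_energy n g h) \<longlonglongrightarrow> sg_form v u"
    using sg_form_tendsto[OF assms(2,1) h g] by (subst sg_energy_commute)
  thus ?thesis by (rule sg_form_unique[OF assms g h])
qed

lemma sg_form_add:
  assumes "u \<in> sg_domain" "v \<in> sg_domain" "w \<in> sg_domain"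
  shows "sg_form (\<lambda>x. u x + v x) w = sg_form u w + sg_form v w"
proof -
  obtain g h k where g: "represents g u" and h: "represents h v" and k: "represents k w"
    using sg_domain_repE assms by metis
  have "(\<lambda>n. sg_energy n (\<lambda>x. g x + h x) k) \<longlonglongrightarrow> sg_form u w + sg_form v w"
    unfolding sg_energy_add using assms g h k by (intro tendsto_add sg_form_tendsto)
  thus ?thesis by (rule sg_form_unique[OF sg_domain_add[OF assms(1,2)] assms(3) represents_add[OF g h] k])
qed

lemma sg_form_scale:
  assumes "u \<in> sg_domain" "v \<in> sg_domain"
  shows "sg_form (\<lambda>x. c * u x) v = c * sg_form u v"
proof -
  obtain g h where g: "represents g u" and h: "represents h v"
    using sg_domain_repE assms by metis
  have "(\<lambda>n. sg_energy n (\<lambda>x. c * g x) h) \<longlonglongrightarrow> c * sg_form u v"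
    unfolding sg_energy_scale using assms g h by (intro tendsto_mult_left sg_form_tendsto)
  thus ?thesis by (rule sg_form_unique[OF sg_domain_scale[OF assms(1)] assms(2) represents_scale[OF g] h])
qed

lemma sg_form_ae_eq:
  assumes "u \<in> sg_domain" "u' \<in> sg_domain" "v \<in> sg_domain" "ae_eq sg_measure u u'"
  shows "sg_form u v = sg_form u' v"
proof -
  obtain g h where g: "represents g u" and h: "represents h v"
    using sg_domain_repE assms by metis
  from sg_form_tendsto[OF assms(2,3) represents_ae_eq[OF g assms(4)] h] show ?thesis
    by (rule sg_form_unique[OF assms(1,3) g h])
qed

subsection \<open>Markov property, self-similarity and locality\<close>

text \<open>Truncation to [0,1] is 1-Lipschitz, so it shrinks every difference along an edge; the
  inequality holds at each level and survives the limit.\<close>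

proposition sg_form_markovian: "markovian_form sg_domain sg_form"
  unfolding markovian_form_def
proof (intro ballI)
  fix u assume u: "u \<in> sg_domain"
  obtain g where g: "represents g u" by (rule sg_domain_repE[OF u])
  define c where "c t = min (max t 0) 1" for t :: real
  have lip: "\<bar>c s - c t\<bar> \<le> \<bar>s - t\<bar>" for s t by (auto simp: c_def min_def max_def)
  have r: "represents (\<lambda>x. c (g x)) (\<lambda>x. c (u x))"
    using g unfolding represents_def ae_eq_def c_def
    by (auto intro!: continuous_on_min continuous_on_max continuous_on_const)
  have [measurable]: "u \<in> borel_measurable sg_measure" using L2_measurable[OF sg_domain_L2[OF u]] .
  have L: "(\<lambda>x. c (u x)) \<in> L2 sg_measure"
    unfolding L2_def
  proof (intro CollectI conjI)
    show m: "(\<lambda>x. c (u x)) \<in> borel_measurable sg_measure" unfolding c_def by measurable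
    show "integrable sg_measure (\<lambda>x. (c (u x))\<^sup>2)"
    proof (rule sg.integrable_const_bound)
      have "\<bar>c t\<bar> \<le> 1" for t by (auto simp: c_def)
      thus "AE x in sg_measure. norm ((c (u x))\<^sup>2) \<le> 1"
        by (intro AE_I2) (simp add: abs_square_le_1)
    qed (use m in measurable)
  qed
  have le: "sg_energy n (\<lambda>x. c (g x)) (\<lambda>x. c (g x)) \<le> sg_energy n g g" for n
  proof -
    have "cell_form (\<lambda>i. c (x i)) (\<lambda>i. c (x i)) \<le> cell_form x x" for x :: "nat \<Rightarrow> real"
      unfolding cell_form_def power2_eq_square[symmetric]
      by (intro add_mono) (auto simp: abs_le_square_iff[symmetric] lip)
    thus ?thesis unfolding vertex_energy_def vertex_values_def by (intro mult_left_mono sum_mono) auto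
  qed
  have "sg_energy n (\<lambda>x. c (g x)) (\<lambda>x. c (g x)) \<le> sg_form u u" for n
    using order_trans[OF le sg_energy_le_form[OF u g]] .
  note b = this
  have "(\<lambda>x. c (u x)) \<in> sg_domain" by (rule sg_domainI[OF L r b])
  moreover from this have "sg_form (\<lambda>x. c (u x)) (\<lambda>x. c (u x)) \<le> sg_form u u"
    by (rule sg_form_le[OF _ r b])
  ultimately show "(\<lambda>x. min (max (u x) 0) 1) \<in> sg_domain \<and>
      sg_form (\<lambda>x. min (max (u x) 0) 1) (\<lambda>x. min (max (u x) 0) 1) \<le> sg_form u u"
    by (simp add: c_def)
qed

text \<open>Here the first letter is split off, not the last as in \<open>vertex_energy_Suc\<close>:
  prefixing the letter a corresponds to composing with \<open>sg_map a\<close>. This is the origin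
  of the self-similarity constant 5/3.\<close>

lemma sg_energy_Suc_split:
  "sg_energy (Suc n) g g = 5/3 * (\<Sum>a\<in>{0,1,2}. sg_energy n (g \<circ> sg_map a) (g \<circ> sg_map a))"
proof -
  have "vertex_values (g \<circ> sg_map a) w = vertex_values g (a # w)" for a w
    by (rule ext) (simp add: vertex_values_def)
  thus ?thesis
    unfolding vertex_energy_def sum_words_Cons by (simp add: distrib_left)
qed

text \<open>Composition respects almost everywhere equality because the image measure under
  \<open>sg_map a\<close> has a density with respect to \<open>sg_measure\<close>.\<close>

lemma represents_comp:
  assumes g: "represents g u" and a: "a \<in> {0,1,2}"
  shows "represents (g \<circ> sg_map a) (u \<circ> sg_map a)"
proof -
  have w: "[a] \<in> words (Suc 0)" using a by simp
  have "AE x in sg_measure. u x = g x" using g by (simp add: represents_def ae_eq_def)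
  hence "AE x in distr sg_measure sg_measure (word_map [a]). u x = g x"
    unfolding distr_word_map[OF w] using cell_sets[OF w] by (subst AE_density) auto
  from AE_distrD[OF measurable_word_map[OF w] this]
  have "AE x in sg_measure. u (sg_map a x) = g (sg_map a x)" by simp
  moreover have "continuous_on gasket (g \<circ> sg_map a)"
    using g sg_map_in_gasket[OF a]
    by (intro continuous_on_compose continuous_on_sg_map)
       (auto simp: represents_def intro: continuous_on_subset)
  ultimately show ?thesis by (simp add: represents_def ae_eq_def)
qed

lemma L2_comp:
  assumes u: "u \<in> L2 sg_measure" and a: "a \<in> {0,1,2}"
  shows "u \<circ> sg_map a \<in> L2 sg_measure"
proof -
  have w: "[a] \<in> words (Suc 0)" using a by simp
  have "integrable sg_measure (\<lambda>x. (u (word_map [a] x))\<^sup>2)"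
    using integrable_comp_word_map[OF L2_square_integrable[OF u] w] .
  moreover have "u \<circ> word_map [a] \<in> borel_measurable sg_measure"
    by (rule measurable_comp[OF measurable_word_map[OF w] L2_measurable[OF u]])
  ultimately show ?thesis by (simp add: L2_def o_def)
qed

proposition sg_form_self_similar: "self_similar sg_domain sg_form"
  unfolding self_similar_def
proof (intro conjI ballI exI[of _ "5/3"])
  have dom: "u \<circ> sg_map a \<in> sg_domain" if u: "u \<in> sg_domain" and a: "a \<in> {0,1,2}" for u a
  proof -
    obtain g where g: "represents g u" by (rule sg_domain_repE[OF u])
    show ?thesis
    proof (rule sg_domainI[OF L2_comp[OF sg_domain_L2[OF u] a] represents_comp[OF g a]])
      fix n
      have "sg_energy n (g \<circ> sg_map a) (g \<circ> sg_map a) \<le> (\<Sum>a\<in>{0,1,2}. sg_energy n (g \<circ> sg_map a) (g \<circ> sg_map a))"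
        using a by (intro member_le_sum) (auto intro: vertex_energy_nonneg)
      also have "\<dots> = 3/5 * sg_energy (Suc n) g g" by (simp add: sg_energy_Suc_split)
      also have "\<dots> \<le> 3/5 * sg_form u u" by (intro mult_left_mono sg_energy_le_form[OF u g]) auto
      finally show "sg_energy n (g \<circ> sg_map a) (g \<circ> sg_map a) \<le> 3/5 * sg_form u u" .
    qed
  qed
  show "u \<circ> sg_map a \<in> sg_domain" if "u \<in> sg_domain" "a \<in> {0,1,2}" for u a by (rule dom[OF that])
  fix u assume u: "u \<in> sg_domain"
  obtain g where g: "represents g u" by (rule sg_domain_repE[OF u])
  have "(\<lambda>n. sg_energy n g g) \<longlonglongrightarrow> 5/3 * (\<Sum>a\<in>{0,1,2}. sg_form (u \<circ> sg_map a) (u \<circ> sg_map a))"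
  \<comment> \<open>Level n + 1 of u consists of level n of its three copies, and shifting the index
    does not change the limit.\<close>
  proof (subst filterlim_sequentially_Suc[symmetric], unfold sg_energy_Suc_split, intro tendsto_intros)
    fix a :: nat assume "a \<in> {0,1,2}"
    thus "(\<lambda>n. sg_energy n (g \<circ> sg_map a) (g \<circ> sg_map a)) \<longlonglongrightarrow> sg_form (u \<circ> sg_map a) (u \<circ> sg_map a)"
      by (intro sg_form_tendsto dom[OF u] represents_comp[OF g])
  qed
  thus "sg_form u u = 5/3 * (\<Sum>a\<in>{0,1,2}. sg_form (u \<circ> sg_map a) (u \<circ> sg_map a))"
    by (rule sg_form_unique[OF u u g g])
qed auto

text \<open>The vertex lies in the subcells w i^N, which shrink to it. The mean of u over each of
  them is c, and continuity of g carries this to the point itself.\<close>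

lemma vertex_value_of_constant:
  assumes u: "u \<in> L2 sg_measure" and g: "represents g u" and w: "w \<in> words n" and i: "i \<in> {0,1,2}"
    and const: "AE x in sg_measure. x \<in> cell w \<longrightarrow> u x = c"
  shows "vertex_values g w i = c"
proof -
  let ?x = "word_map w (sg_vertex i)"
  have gc: "continuous_on gasket g" using g by (simp add: represents_def)
  have "\<bar>g ?x - c\<bar> \<le> 0"
  proof (rule field_le_epsilon)
    fix e :: real assume "0 < e"
    then obtain N where N: "\<And>n w x. N \<le> n \<Longrightarrow> w \<in> words n \<Longrightarrow> x \<in> cell w \<Longrightarrow> \<bar>cell_average g w - g x\<bar> \<le> e"
      using cell_average_continuous_near[OF gc] by metis
    let ?v = "w @ replicate N i"
    have v: "?v \<in> words (n + N)" using append_words[OF w replicate_in_words[OF i]] .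
    have "?x = word_map ?v (sg_vertex i)" by (simp add: word_map_append)
    hence "?x \<in> cell ?v" using word_map_vertex_in_cell[OF i] by metis
    hence "\<bar>cell_average g ?v - g ?x\<bar> \<le> e" by (intro N[OF _ v]) auto
    moreover have "\<bar>cell_average u ?v - c\<bar> \<le> 0"
    proof (rule cell_average_near[OF L2_integrable[OF u] v])
      have "cell ?v \<subseteq> cell w" by (rule cell_append_subset[OF replicate_in_words[OF i]])
      thus "AE x in sg_measure. x \<in> cell ?v \<longrightarrow> \<bar>u x - c\<bar> \<le> 0"
        using const by (auto elim!: eventually_mono)
    qed
    ultimately show "\<bar>g ?x - c\<bar> \<le> 0 + e" using represents_cell_average[OF g u v] by linarith
  qed
  thus ?thesis by (simp add: vertex_values_def)
qed

text \<open>Once cells have diameter below the distance d that the support of u keeps inside U, each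
  cell either misses this support, so g vanishes at its vertices, or lies in U, so h is constant on
  them. Every cell form is then 0, and the energies vanish from some level on.\<close>

proposition sg_form_strongly_local: "strongly_local sg_measure sg_domain sg_form"
  unfolding strongly_local_def
proof (intro ballI impI, elim conjE exE)
  fix u v U c
  let ?S = "ess_support sg_measure u"
  assume u: "u \<in> sg_domain" and v: "v \<in> sg_domain" and S: "compact ?S" and U: "open U" "?S \<subseteq> U"
    and const: "AE x in sg_measure. x \<in> U \<longrightarrow> v x = c"
  obtain g where g: "represents g u" by (rule sg_domain_repE[OF u])
  obtain h where h: "represents h v" by (rule sg_domain_repE[OF v])
  obtain d where d: "d > 0" "(\<Union>x\<in>?S. ball x d) \<subseteq> U"
    by (rule compact_subset_open_imp_ball_epsilon_subset[OF S U]) blast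
  have "\<forall>\<^sub>F n in sequentially. 2 / 2 ^ n < d" using order_tendstoD(2)[OF LIMSEQ_divide_pow2 d(1)] .
  hence "\<forall>\<^sub>F n in sequentially. sg_energy n g h = 0"
  proof eventually_elim
    case (elim n)
    have "cell_form (vertex_values g w) (vertex_values h w) = 0" if w: "w \<in> words n" for w
    proof (cases "cell w \<inter> ?S = {}")
      case True
      define \<U> where "\<U> = {U. open U \<and> (AE x in sg_measure. x \<in> U \<longrightarrow> u x = 0)}"
      have "cell w \<subseteq> \<Union>\<U>"
        using True cell_subset_gasket[OF w] by (auto simp: ess_support_def \<U>_def)
      \<comment> \<open>Compactness of the cell reduces an uncountable union of exceptional null
        sets to a finite one.\<close>
      then obtain \<V> where V: "\<V> \<subseteq> \<U>" "finite \<V>" "cell w \<subseteq> \<Union>\<V>"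
        using compactE[OF compact_cell] by (metis (no_types, lifting) \<U>_def mem_Collect_eq)
      have "AE x in sg_measure. \<forall>V\<in>\<V>. x \<in> V \<longrightarrow> u x = 0"
        using V by (intro AE_finite_allI) (auto simp: \<U>_def)
      hence "AE x in sg_measure. x \<in> cell w \<longrightarrow> u x = 0"
        by eventually_elim (use V(3) in blast)
      hence "vertex_values g w i = 0" if "i \<in> {0,1,2}" for i
        using vertex_value_of_constant[OF sg_domain_L2[OF u] g w that] by blast
      thus ?thesis by (simp add: cell_form_def)
    next
      case False
      then obtain x where x: "x \<in> cell w" "x \<in> ?S" by blast
      have "cell w \<subseteq> U"
      proof
        fix y assume "y \<in> cell w"
        hence "dist x y < d" using dist_cell_le[OF w x(1)] elim by fastforce
        hence "y \<in> ball x d" by simp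
        thus "y \<in> U" using d(2) x(2) by blast
      qed
      hence "AE x in sg_measure. x \<in> cell w \<longrightarrow> v x = c"
        using const by (auto elim!: eventually_mono)
      hence "vertex_values h w i = c" if "i \<in> {0,1,2}" for i
        using vertex_value_of_constant[OF sg_domain_L2[OF v] h w that] by blast
      thus ?thesis by (simp add: cell_form_def)
    qed
    thus ?case by (simp add: vertex_energy_def)
  qed
  hence "(\<lambda>n. sg_energy n g h) \<longlonglongrightarrow> 0" by (rule tendsto_eventually)
  thus "sg_form u v = 0" by (rule sg_form_unique[OF u v g h])
qed

subsection \<open>Closedness\<close>

text \<open>The variance is non-negative and the total mass is 1.\<close>

lemma integral_square_le:
  assumes u: "u \<in> L2 sg_measure"
  shows "(\<integral>x. u x \<partial>sg_measure)\<^sup>2 \<le> L2_norm2 sg_measure u"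
proof -
  define m where "m = (\<integral>x. u x \<partial>sg_measure)"
  have ui: "integrable sg_measure u" and u2: "integrable sg_measure (\<lambda>x. (u x)\<^sup>2)"
    using L2_integrable[OF u] L2_square_integrable[OF u] .
  have "0 \<le> (\<integral>x. (u x - m)\<^sup>2 \<partial>sg_measure)" by (rule integral_nonneg_AE) simp
  also have "(\<integral>x. (u x - m)\<^sup>2 \<partial>sg_measure) = (\<integral>x. (u x)\<^sup>2 - (2 * m) * u x + m\<^sup>2 \<partial>sg_measure)"
    by (intro Bochner_Integration.integral_cong refl) (simp add: power2_diff)
  also have "\<dots> = L2_norm2 sg_measure u - 2 * m * m + m\<^sup>2"
    using ui u2 by (simp add: L2_norm2_def m_def)
  finally show ?thesis by (simp add: m_def power2_eq_square)
qed

lemma abs_le_on_gasket: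
  assumes g: "continuous_on gasket g"
    and b: "\<And>n w. w \<in> words n \<Longrightarrow> \<bar>g (word_map w (sg_vertex 0)) - c\<bar> \<le> (b :: real)" and x: "x \<in> gasket"
  shows "\<bar>g x - c\<bar> \<le> b"
proof (rule field_le_epsilon)
  fix e :: real assume "0 < e"
  then obtain N where N: "\<And>n w x y. N \<le> n \<Longrightarrow> w \<in> words n \<Longrightarrow> x \<in> cell w \<Longrightarrow> y \<in> cell w \<Longrightarrow> \<bar>g x - g y\<bar> \<le> e"
    using continuous_osc_cell[OF g] by metis
  obtain w where w: "w \<in> words N" "x \<in> cell w" using ex_cell[OF x] by blast
  have "\<bar>g x - g (word_map w (sg_vertex 0))\<bar> \<le> e"
    by (rule N[OF order.refl w]) (rule word_map_vertex_in_cell, simp)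
  thus "\<bar>g x - c\<bar> \<le> b + e" using b[OF w(1)] by linarith
qed

lemma sg_form_le_E1: "u \<in> sg_domain \<Longrightarrow> sg_form u u \<le> (E1_norm sg_measure sg_form u)\<^sup>2"
  using sg_form_nonneg[of u] L2_norm2_nonneg[of sg_measure u] by (simp add: E1_norm_def)

lemma E1_norm_nonneg: "u \<in> sg_domain \<Longrightarrow> 0 \<le> E1_norm sg_measure sg_form u"
  using sg_form_nonneg[of u] L2_norm2_nonneg[of sg_measure u] by (simp add: E1_norm_def)

text \<open>A Sobolev inequality: 23 = 11 + 11 + 1, for the way from a vertex value to the root
  value, from there to the overall mean, and the bound of the mean by the L2 norm. It turns
  convergence in the form norm into uniform convergence.\<close>

lemma abs_representative_le:
  assumes u: "u \<in> sg_domain" and g: "represents g u" and x: "x \<in> gasket"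
  shows "\<bar>g x\<bar> \<le> 23 * E1_norm sg_measure sg_form u"
proof -
  let ?T = "vertex_values g" and ?E = "sg_form u u" and ?L = "L2_norm2 sg_measure u"
  have gc: "continuous_on gasket g" using g by (simp add: represents_def)
  have uL: "u \<in> L2 sg_measure" by (rule sg_domain_L2[OF u])
  have B: "vertex_energy n ?T ?T \<le> ?E" for n by (rule sg_energy_le_form[OF u g])
  have shift_Nil: "shift [] ?T = ?T" by (intro ext) (simp add: shift_def)
  have mean: "\<bar>cell_average g [] - ?T [] 0\<bar> \<le> 11 * sqrt ?E"
    by (rule mean_vertex_diff[OF has_means_cell_average[OF L2_integrable[OF continuous_L2[OF gc]]]
          asymptotic_to_vertex_values[OF gc] compatible_vertex_values, of "[]" 0])
       (simp_all add: shift_Nil B)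
  have "cell_average g [] = (\<integral>x. u x \<partial>sg_measure)"
    using represents_cell_average[OF g uL, of "[]" 0] cell_average_eq[OF L2_integrable[OF uL], of "[]" 0] by simp
  hence "(cell_average g [])\<^sup>2 \<le> ?L" using integral_square_le[OF uL] by simp
  hence av: "\<bar>cell_average g []\<bar> \<le> sqrt ?L" using real_sqrt_le_mono by fastforce
  have E: "sqrt ?E \<le> E1_norm sg_measure sg_form u" "sqrt ?L \<le> E1_norm sg_measure sg_form u"
    using sg_form_nonneg[OF u] L2_norm2_nonneg[of sg_measure u] by (auto simp: E1_norm_def)
  have "\<bar>g x - 0\<bar> \<le> 23 * E1_norm sg_measure sg_form u"
  proof (rule abs_le_on_gasket[OF gc _ x])
    fix n w assume w: "w \<in> words n"
    have "\<bar>?T w 0 - ?T [] 0\<bar> \<le> 11 * sqrt ?E"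
      by (rule vertex_osc_root[OF compatible_vertex_values B w]) auto
    hence "\<bar>?T w 0\<bar> \<le> 23 * E1_norm sg_measure sg_form u" using mean av E by linarith
    thus "\<bar>g (word_map w (sg_vertex 0)) - 0\<bar> \<le> 23 * E1_norm sg_measure sg_form u"
      by (simp add: vertex_values_def)
  qed
  thus ?thesis by simp
qed

lemma sg_energy_tendsto:
  assumes "\<And>x. x \<in> gasket \<Longrightarrow> (\<lambda>k. f k x) \<longlonglongrightarrow> g x"
  shows "(\<lambda>k. sg_energy n (f k) (f k)) \<longlonglongrightarrow> sg_energy n g g"
  unfolding vertex_energy_def cell_form_def vertex_values_def
  by (intro tendsto_intros assms word_map_vertex_in_gasket) auto

text \<open>By the Sobolev inequality the representatives converge uniformly to a continuous v. The
  energy of a fixed level involves finitely many points, so the Cauchy bounds pass to the limit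
  level by level (\<open>near\<close>), uniformly in the level; this bounds the form itself.\<close>

proposition sg_form_closed: "closed_form sg_measure sg_domain sg_form"
  unfolding closed_form_def
proof (intro allI impI, elim conjE)
  fix u :: "nat \<Rightarrow> real^2 \<Rightarrow> real"
  let ?N = "E1_norm sg_measure sg_form"
  assume u: "\<forall>n. u n \<in> sg_domain"
    and cau: "\<forall>\<epsilon>>0. \<exists>N. \<forall>m\<ge>N. \<forall>n\<ge>N. ?N (\<lambda>x. u m x - u n x) < \<epsilon>"
  have ud: "u n \<in> sg_domain" for n using u by blast
  have "\<forall>n. \<exists>g. represents g (u n)" using sg_domain_repE[OF ud] by metis
  then obtain G where G: "\<And>n. represents (G n) (u n)" by metis
  have Gc: "continuous_on gasket (G n)" for n using G[of n] by (simp add: represents_def)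
  have dd: "(\<lambda>x. u m x - u n x) \<in> sg_domain" for m n by (rule sg_domain_diff[OF ud ud])
  have rd: "represents (\<lambda>x. G m x - G n x) (\<lambda>x. u m x - u n x)" for m n by (rule represents_diff[OF G G])
  have "uniformly_Cauchy_on gasket G"
  proof (rule uniformly_Cauchy_onI)
    fix e :: real assume "0 < e"
    hence "0 < e / 23" by simp
    then obtain N where N: "\<And>m n. m \<ge> N \<Longrightarrow> n \<ge> N \<Longrightarrow> ?N (\<lambda>x. u m x - u n x) < e / 23"
      using cau by metis
    show "\<exists>M. \<forall>x\<in>gasket. \<forall>m\<ge>M. \<forall>n\<ge>M. dist (G m x) (G n x) < e"
    proof (intro exI ballI allI impI)
      fix x m n assume "x \<in> gasket" "N \<le> m" "N \<le> n"
      thus "dist (G m x) (G n x) < e"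
        using abs_representative_le[OF dd rd, of x m n] N[of m n] by (simp add: dist_real_def)
    qed
  qed
  then obtain v where v: "uniform_limit gasket G v sequentially"
    using Cauchy_uniformly_convergent by (auto simp: uniformly_convergent_on_def)
  have vc: "continuous_on gasket v"
    by (rule uniform_limit_theorem[OF _ v]) (auto simp: Gc)
  have pt: "(\<lambda>k. G k x) \<longlonglongrightarrow> v x" if "x \<in> gasket" for x by (rule tendsto_uniform_limitI[OF v that])
  have near: "sg_energy m (\<lambda>x. G n x - v x) (\<lambda>x. G n x - v x) \<le> e\<^sup>2" "x \<in> gasket \<Longrightarrow> \<bar>G n x - v x\<bar> \<le> 23 * e"
    if e: "0 < e" and N: "\<And>k. k \<ge> N \<Longrightarrow> ?N (\<lambda>x. u n x - u k x) < e" for e n N m x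
  proof -
    have l1: "(\<lambda>k. sg_energy m (\<lambda>x. G n x - G k x) (\<lambda>x. G n x - G k x)) \<longlonglongrightarrow> sg_energy m (\<lambda>x. G n x - v x) (\<lambda>x. G n x - v x)"
      by (intro sg_energy_tendsto tendsto_intros pt)
    have b1: "sg_energy m (\<lambda>x. G n x - G k x) (\<lambda>x. G n x - G k x) \<le> e\<^sup>2" if k: "k \<ge> N" for k
    proof -
      have "sg_energy m (\<lambda>x. G n x - G k x) (\<lambda>x. G n x - G k x) \<le> (?N (\<lambda>x. u n x - u k x))\<^sup>2"
        using order_trans[OF sg_energy_le_form[OF dd rd] sg_form_le_E1[OF dd]] .
      also have "\<dots> \<le> e\<^sup>2"
        by (rule power_mono[OF less_imp_le[OF N[OF k]] E1_norm_nonneg[OF dd]])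
      finally show ?thesis .
    qed
    show "sg_energy m (\<lambda>x. G n x - v x) (\<lambda>x. G n x - v x) \<le> e\<^sup>2"
      by (rule LIMSEQ_le_const2[OF l1]) (blast intro: b1)
    assume x: "x \<in> gasket"
    have l2: "(\<lambda>k. \<bar>G n x - G k x\<bar>) \<longlonglongrightarrow> \<bar>G n x - v x\<bar>" by (intro tendsto_intros pt x)
    have b2: "\<bar>G n x - G k x\<bar> \<le> 23 * e" if k: "k \<ge> N" for k
      using abs_representative_le[OF dd rd x, of n k] N[OF k] by linarith
    show "\<bar>G n x - v x\<bar> \<le> 23 * e" by (rule LIMSEQ_le_const2[OF l2]) (blast intro: b2)
  qed
  obtain N1 where N1: "\<And>m n. m \<ge> N1 \<Longrightarrow> n \<ge> N1 \<Longrightarrow> ?N (\<lambda>x. u m x - u n x) < 1"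
    using cau[rule_format, of 1] by auto
  have vd: "v \<in> sg_domain"
  proof (rule sg_domain_continuous[OF vc])
    fix n
    \<comment> \<open>Writing v as \<open>G N1\<close> minus the small difference
      \<open>G N1 - v\<close> bounds its energies through two known ones.\<close>
    have "sg_energy n (\<lambda>x. G N1 x - (G N1 x - v x)) (\<lambda>x. G N1 x - (G N1 x - v x)) \<le> 2 * sg_form (u N1) (u N1) + 2 * 1\<^sup>2"
      using sg_energy_diff_le[of n "G N1" "\<lambda>x. G N1 x - v x"] sg_energy_le_form[OF ud G, of n N1]
        near(1)[of 1 N1 N1 n] N1 by simp
    thus "sg_energy n v v \<le> 2 * sg_form (u N1) (u N1) + 2 * 1\<^sup>2" by simp
  qed
  have "(\<lambda>n. ?N (\<lambda>x. u n x - v x)) \<longlonglongrightarrow> 0"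
  proof (rule LIMSEQ_I)
    fix r :: real assume r: "0 < r"
    \<comment> \<open>The form contributes e^2 and the L2 part (23 e)^2; 1 + 529 <= 576 = 24^2, and
      25 makes the inequality strict.\<close>
    define e where "e = r / 25"
    have e: "0 < e" using r by (simp add: e_def)
    obtain N where N: "\<And>m n. m \<ge> N \<Longrightarrow> n \<ge> N \<Longrightarrow> ?N (\<lambda>x. u m x - u n x) < e"
      using cau e by metis
    show "\<exists>no. \<forall>n\<ge>no. norm (?N (\<lambda>x. u n x - v x) - 0) < r"
    proof (intro exI allI impI)
      fix n assume n: "N \<le> n"
      have d: "(\<lambda>x. u n x - v x) \<in> sg_domain" by (rule sg_domain_diff[OF ud vd])
      have rp: "represents (\<lambda>x. G n x - v x) (\<lambda>x. u n x - v x)" by (rule represents_diff[OF G represents_self[OF vc]])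
      have "sg_form (\<lambda>x. u n x - v x) (\<lambda>x. u n x - v x) \<le> e\<^sup>2"
        by (rule sg_form_le[OF d rp]) (rule near(1)[OF e N[OF n]])
      moreover have "L2_norm2 sg_measure (\<lambda>x. u n x - v x) \<le> (23 * e)\<^sup>2"
      proof (rule L2_norm2_sg_le[OF sg_domain_L2[OF d]])
        have "AE x in sg_measure. u n x = G n x" using G[of n] by (simp add: represents_def ae_eq_def)
        moreover have "AE x in sg_measure. \<bar>G n x - v x\<bar> \<le> 23 * e"
          by (rule AE_I2) (simp add: near(2)[OF e N[OF n]])
        ultimately show "AE x in sg_measure. \<bar>u n x - v x\<bar> \<le> 23 * e" by eventually_elim simp
      qed
      ultimately have "sg_form (\<lambda>x. u n x - v x) (\<lambda>x. u n x - v x) + L2_norm2 sg_measure (\<lambda>x. u n x - v x) \<le> (24 * e)\<^sup>2"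
      proof -
        have "(24 * e)\<^sup>2 = 576 * e\<^sup>2" "(23 * e)\<^sup>2 = 529 * e\<^sup>2" by (simp_all add: power_mult_distrib)
        thus "A + L \<le> (24 * e)\<^sup>2" if "A \<le> e\<^sup>2" "L \<le> (23 * e)\<^sup>2" for A L
          using that zero_le_power2[of e] by linarith
      qed
      hence "?N (\<lambda>x. u n x - v x) \<le> sqrt ((24 * e)\<^sup>2)" unfolding E1_norm_def by (rule real_sqrt_le_mono)
      also have "\<dots> < r" using e by (simp add: e_def)
      finally show "norm (?N (\<lambda>x. u n x - v x) - 0) < r"
        using sg_form_nonneg[OF d] L2_norm2_nonneg[of sg_measure "\<lambda>x. u n x - v x"] by (simp add: E1_norm_def)
    qed
  qed
  thus "\<exists>v\<in>sg_domain. (\<lambda>n. ?N (\<lambda>x. u n x - v x)) \<longlonglongrightarrow> 0" using vd by blast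
qed

subsection \<open>Piecewise harmonic functions and regularity\<close>

text \<open>The harmonic extension rule: a midpoint gets 2/5 of each of its two end values and 1/5
  of the opposite one. For distinct letters a and j, \<open>3 - a - j\<close> is the third
  letter.\<close>

definition harmonic_child :: "nat \<Rightarrow> (nat \<Rightarrow> real) \<Rightarrow> nat \<Rightarrow> real" where
  "harmonic_child a x j = (if j = a then x a else (2 * x a + 2 * x j + x (3 - a - j)) / 5)"

fun harmonic_values :: "nat list \<Rightarrow> (nat \<Rightarrow> real) \<Rightarrow> nat \<Rightarrow> real" where
  "harmonic_values [] x = x"
| "harmonic_values (a # w) x = harmonic_values w (harmonic_child a x)"

lemma harmonic_values_snoc: "harmonic_values (w @ [a]) x = harmonic_child a (harmonic_values w x)"
  by (induction w arbitrary: x) auto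

text \<open>The equality case of \<open>cell_form_refine\<close>, where all deviations from the
  harmonic extension vanish.\<close>

lemma cell_form_harmonic_child:
  "cell_form x x = 5/3 * (\<Sum>a\<in>{0,1,2}. cell_form (harmonic_child a x) (harmonic_child a x))"
  by (simp add: cell_form_def harmonic_child_def field_simps)

text \<open>The maximum principle: every refined value is a convex combination of the given
  three.\<close>

lemma harmonic_values_near:
  assumes "w \<in> words n" "\<And>i. i \<in> {0,1,2} \<Longrightarrow> \<bar>x i - c\<bar> \<le> d" "i \<in> {0,1,2}"
  shows "\<bar>harmonic_values w x i - c\<bar> \<le> d"
  using assms(1,2)
proof (induction w arbitrary: n x)
  case (Cons a w)
  then obtain m where m: "a \<in> {0,1,2}" "w \<in> words m" by (cases n) (auto simp: words_def)
  have "\<bar>harmonic_child a x j - c\<bar> \<le> d" if j: "j \<in> {0,1,2}" for j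
  proof (cases "j = a")
    case False
    hence "3 - a - j \<in> {0,1,2}" using m(1) j by auto
    hence "\<bar>x (3 - a - j) - c\<bar> \<le> d" "\<bar>x a - c\<bar> \<le> d" "\<bar>x j - c\<bar> \<le> d"
      using Cons.prems(2) m(1) j by blast+
    thus ?thesis using False by (simp add: harmonic_child_def abs_le_iff field_simps)
  qed (use Cons.prems(2) m(1) in \<open>simp add: harmonic_child_def\<close>)
  thus ?case using Cons.IH[OF m(2)] by simp
qed (use assms(3) in auto)

text \<open>The harmonic spline of level N: the values of g down to level N, refined harmonically
  below. For a word of length at most N, \<open>take N w\<close> is the word itself and nothing is
  refined.\<close>

definition spline :: "nat \<Rightarrow> (real^2 \<Rightarrow> real) \<Rightarrow> nat list \<Rightarrow> nat \<Rightarrow> real" where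
  "spline N g w = harmonic_values (drop N w) (vertex_values g (take N w))"

lemma spline_coarse: "length w \<le> N \<Longrightarrow> spline N g w = vertex_values g w"
  by (simp add: spline_def)

lemma spline_snoc: "N \<le> length w \<Longrightarrow> spline N g (w @ [a]) = harmonic_child a (spline N g w)"
  by (simp add: spline_def harmonic_values_snoc)

lemma compatible_spline: "compatible (spline N g)"
  unfolding compatible_def
proof (intro allI ballI conjI)
  fix n u a assume u: "u \<in> words n" and a: "a \<in> {0,1,2::nat}"
  note c = compatibleD[OF compatible_vertex_values[of g] u a]
  show "spline N g (u @ [a]) a = spline N g u a"
  proof (cases "N \<le> length u")
    case True
    thus ?thesis by (simp add: spline_snoc harmonic_child_def)
  qed (simp add: spline_coarse c(1))
  fix b assume b: "b \<in> {0,1,2::nat}"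
  show "spline N g (u @ [a]) b = spline N g (u @ [b]) a"
  proof (cases "N \<le> length u")
    case True
    \<comment> \<open>The extension rule is symmetric in the two ends of an edge, so both adjacent
      cells assign the same value to its midpoint.\<close>
    have "3 - a - b = 3 - b - a" by simp
    thus ?thesis using True by (simp add: spline_snoc harmonic_child_def add.commute)
  qed (simp add: spline_coarse c(2)[OF b])
qed

lemma vertex_energy_spline_le: "vertex_energy n (spline N g) (spline N g) \<le> vertex_energy N (spline N g) (spline N g)"
proof (cases "n \<le> N")
  case True
  thus ?thesis by (rule vertex_energy_mono[OF compatible_spline])
next
  case False
  hence "N \<le> n" by simp
  thus ?thesis
  proof (induction n rule: dec_induct)
    case (step n)
    have "vertex_energy (Suc n) (spline N g) (spline N g) = vertex_energy n (spline N g) (spline N g)"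
    proof -
      have "(\<Sum>w\<in>words n. \<Sum>a\<in>{0,1,2}. cell_form (spline N g (w @ [a])) (spline N g (w @ [a])))
          = (\<Sum>w\<in>words n. 3/5 * cell_form (spline N g w) (spline N g w))"
      proof (intro sum.cong refl)
        fix w assume "w \<in> words n"
        hence "N \<le> length w" using step.hyps length_words by auto
        note sn = spline_snoc[OF this, of g]
        thus "(\<Sum>a\<in>{0,1,2}. cell_form (spline N g (w @ [a])) (spline N g (w @ [a]))) = 3/5 * cell_form (spline N g w) (spline N g w)"
          unfolding sn using cell_form_harmonic_child[of "spline N g w"] by linarith
      qed
      thus ?thesis unfolding vertex_energy_def sum_words_snoc sum_distrib_left[symmetric] by simp
    qed
    thus ?case using step.IH by simp
  qed simp
qed

text \<open>At a vertex of a deep cell around x the spline is within d of g x by the maximum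
  principle, since the enclosing cell of level N has vertex values that close to g x; its continuous
  extension v varies by at most d on the deep cell. With d = e / 3 the error 2 d stays below
  e.\<close>

proposition uniform_approximation:
  assumes g: "continuous_on gasket g" and e: "0 < (e :: real)"
  shows "\<exists>v\<in>sg_domain. continuous_on gasket v \<and> (\<forall>x\<in>gasket. \<bar>g x - v x\<bar> < e)"
proof -
  define d where "d = e / 3"
  have d: "0 < d" using e by (simp add: d_def)
  obtain N where N: "\<And>n w x y. N \<le> n \<Longrightarrow> w \<in> words n \<Longrightarrow> x \<in> cell w \<Longrightarrow> y \<in> cell w \<Longrightarrow> \<bar>g x - g y\<bar> \<le> d"
    using continuous_osc_cell[OF g d] by metis
  obtain v where v: "continuous_on gasket v"
    and vT: "\<And>n w i. w \<in> words n \<Longrightarrow> i \<in> {0,1,2} \<Longrightarrow> v (word_map w (sg_vertex i)) = spline N g w i"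
    using continuous_extension[OF compatible_spline vertex_energy_spline_le] by metis
  have "v \<in> sg_domain"
  proof (rule sg_domain_continuous[OF v])
    fix n
    have "sg_energy n v v = vertex_energy n (spline N g) (spline N g)"
      by (rule vertex_energy_cong) (simp_all only: vertex_values_def vT)
    thus "sg_energy n v v \<le> vertex_energy N (spline N g) (spline N g)" using vertex_energy_spline_le by simp
  qed
  moreover have "\<bar>g x - v x\<bar> < e" if x: "x \<in> gasket" for x
  proof -
    obtain M where M: "\<And>n w x y. M \<le> n \<Longrightarrow> w \<in> words n \<Longrightarrow> x \<in> cell w \<Longrightarrow> y \<in> cell w \<Longrightarrow> \<bar>v x - v y\<bar> \<le> d"
      using continuous_osc_cell[OF v d] by metis
    obtain w where w: "w \<in> words (N + M)" "x \<in> cell w" using ex_cell[OF x] by blast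
    obtain s t where st: "w = s @ t" "s \<in> words N" "t \<in> words M" using w(1) words_add[of N M] by auto
    have xs: "x \<in> cell s" using w(2) st cell_append_subset[OF st(3)] by auto
    have "\<bar>vertex_values g s i - g x\<bar> \<le> d" if "i \<in> {0,1,2}" for i
      unfolding vertex_values_def by (rule N[OF order.refl st(2) word_map_vertex_in_cell[OF that] xs])
    from harmonic_values_near[OF st(3) this, where i=0] have "\<bar>spline N g w 0 - g x\<bar> \<le> d"
      using st length_words[OF st(2)] by (simp add: spline_def)
    moreover have "\<bar>v x - v (word_map w (sg_vertex 0))\<bar> \<le> d"
      by (rule M[OF _ w]) (simp, rule word_map_vertex_in_cell, simp)
    moreover have "v (word_map w (sg_vertex 0)) = spline N g w 0" using vT[OF w(1), of 0] by simp
    ultimately show ?thesis using d d_def by linarith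
  qed
  ultimately show ?thesis using v by blast
qed

text \<open>Density in the form norm is immediate: the continuous representative is at distance 0.
  The content lies in uniform density in the continuous functions.\<close>

proposition sg_form_regular: "regular_form sg_measure sg_domain sg_form"
  unfolding regular_form_def space_sg_measure
proof (intro conjI ballI allI impI)
  fix u and e :: real assume u: "u \<in> sg_domain" and e: "0 < e"
  obtain g where g: "represents g u" by (rule sg_domain_repE[OF u])
  have gc: "continuous_on gasket g" using g by (simp add: represents_def)
  have gd: "g \<in> sg_domain" by (rule sg_domain_continuous[OF gc sg_domain_bounded[OF u g]])
  have d: "(\<lambda>x. u x - g x) \<in> sg_domain" by (rule sg_domain_diff[OF u gd])
  have "represents (\<lambda>x. g x - g x) (\<lambda>x. u x - g x)" by (rule represents_diff[OF g represents_self[OF gc]])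
  from sg_form_le[OF d this, of 0] have "sg_form (\<lambda>x. u x - g x) (\<lambda>x. u x - g x) \<le> 0"
    by (simp add: vertex_energy_def vertex_values_def cell_form_def)
  moreover have "L2_norm2 sg_measure (\<lambda>x. u x - g x) \<le> 0\<^sup>2"
    by (rule L2_norm2_sg_le[OF sg_domain_L2[OF d]])
       (use g in \<open>auto simp: represents_def ae_eq_def elim!: eventually_mono\<close>)
  ultimately have "E1_norm sg_measure sg_form (\<lambda>x. u x - g x) = 0"
    using sg_form_nonneg[OF d] L2_norm2_nonneg[of sg_measure "\<lambda>x. u x - g x"] by (simp add: E1_norm_def)
  thus "\<exists>v\<in>sg_domain. continuous_on gasket v \<and> E1_norm sg_measure sg_form (\<lambda>x. u x - v x) < e"
    using gd gc e by (intro bexI[of _ g]) auto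
qed (rule uniform_approximation)

subsection \<open>Density in the space of square integrable functions\<close>

definition L2_approximable :: "(real^2 \<Rightarrow> real) \<Rightarrow> bool" where
  "L2_approximable u \<longleftrightarrow> u \<in> L2 sg_measure \<and>
     (\<forall>e>0. \<exists>g. continuous_on gasket g \<and> L2_norm2 sg_measure (\<lambda>x. u x - g x) < e)"

lemma L2_approximable_continuous: "continuous_on gasket g \<Longrightarrow> L2_approximable g"
  unfolding L2_approximable_def by (auto intro!: continuous_L2 exI[of _ g] simp: L2_norm2_def)

lemma L2_approximable_cong:
  assumes "L2_approximable u" "\<And>x. x \<in> gasket \<Longrightarrow> u x = v x"
  shows "L2_approximable v"
proof -
  have "v \<in> L2 sg_measure \<longleftrightarrow> u \<in> L2 sg_measure"
    unfolding L2_def mem_Collect_eq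
    by (intro arg_cong2[of _ _ _ _ "(\<and>)"] measurable_cong Bochner_Integration.integrable_cong refl)
       (simp_all add: assms(2))
  moreover have "L2_norm2 sg_measure (\<lambda>x. v x - g x) = L2_norm2 sg_measure (\<lambda>x. u x - g x)" for g
    unfolding L2_norm2_def by (intro Bochner_Integration.integral_cong refl) (simp add: assms(2))
  ultimately show ?thesis using assms(1) by (simp add: L2_approximable_def)
qed

lemma L2_approximable_add:
  assumes "L2_approximable u" "L2_approximable v"
  shows "L2_approximable (\<lambda>x. u x + v x)"
  unfolding L2_approximable_def
proof (intro conjI allI impI)
  have uv: "u \<in> L2 sg_measure" "v \<in> L2 sg_measure" using assms by (auto simp: L2_approximable_def)
  thus "(\<lambda>x. u x + v x) \<in> L2 sg_measure" by (rule L2_add)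
  fix e :: real assume "0 < e"
  hence e: "0 < e / 4" by simp
  obtain g where g: "continuous_on gasket g" "L2_norm2 sg_measure (\<lambda>x. u x - g x) < e / 4"
    using assms(1) e unfolding L2_approximable_def by blast
  obtain h where h: "continuous_on gasket h" "L2_norm2 sg_measure (\<lambda>x. v x - h x) < e / 4"
    using assms(2) e unfolding L2_approximable_def by blast
  have eq: "(\<lambda>x. u x + v x - (g x + h x)) = (\<lambda>x. (u x - g x) + (v x - h x))" by (simp add: algebra_simps)
  have "L2_norm2 sg_measure (\<lambda>x. u x + v x - (g x + h x)) < e"
    unfolding eq
    using L2_norm2_add_le[OF L2_diff[OF uv(1) continuous_L2[OF g(1)]] L2_diff[OF uv(2) continuous_L2[OF h(1)]]] g h
    by linarith
  thus "\<exists>g. continuous_on gasket g \<and> L2_norm2 sg_measure (\<lambda>x. u x + v x - g x) < e"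
    using continuous_on_add[OF g(1) h(1)] by blast
qed

lemma L2_approximable_limit:
  assumes f: "\<And>n. L2_approximable (f n)" and u: "u \<in> L2 sg_measure"
    and lim: "(\<lambda>n. L2_norm2 sg_measure (\<lambda>x. u x - f n x)) \<longlonglongrightarrow> 0"
  shows "L2_approximable u"
  unfolding L2_approximable_def
proof (intro conjI allI impI u)
  fix e :: real assume "0 < e"
  hence e: "0 < e / 4" by simp
  obtain n where n: "L2_norm2 sg_measure (\<lambda>x. u x - f n x) < e / 4"
    using order_tendstoD(2)[OF lim e] by (auto simp: eventually_sequentially)
  obtain g where g: "continuous_on gasket g" "L2_norm2 sg_measure (\<lambda>x. f n x - g x) < e / 4"
    using f[of n] e unfolding L2_approximable_def by blast
  have fn: "f n \<in> L2 sg_measure" using f[of n] by (simp add: L2_approximable_def)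
  have eq: "(\<lambda>x. u x - g x) = (\<lambda>x. (u x - f n x) + (f n x - g x))" by simp
  have "L2_norm2 sg_measure (\<lambda>x. u x - g x) < e"
    unfolding eq
    using L2_norm2_add_le[OF L2_diff[OF u fn] L2_diff[OF fn continuous_L2[OF g(1)]]] n g by linarith
  thus "\<exists>g. continuous_on gasket g \<and> L2_norm2 sg_measure (\<lambda>x. u x - g x) < e" using g(1) by blast
qed

lemma L2_norm2_dominated:
  assumes "u \<in> L2 sg_measure" "\<And>n. f n \<in> L2 sg_measure" "integrable sg_measure b"
    and lim: "\<And>x. x \<in> gasket \<Longrightarrow> (\<lambda>n. f n x) \<longlonglongrightarrow> u x"
    and bd: "\<And>n x. x \<in> gasket \<Longrightarrow> (u x - f n x)\<^sup>2 \<le> b x"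
  shows "(\<lambda>n. L2_norm2 sg_measure (\<lambda>x. u x - f n x)) \<longlonglongrightarrow> 0"
proof -
  have [measurable]: "u \<in> borel_measurable sg_measure" "f n \<in> borel_measurable sg_measure" for n
    using assms by (auto simp: L2_def)
  have "(\<lambda>n. \<integral>x. (u x - f n x)\<^sup>2 \<partial>sg_measure) \<longlonglongrightarrow> (\<integral>x. 0 \<partial>sg_measure)"
  proof (rule integral_dominated_convergence[where w=b])
    show "AE x in sg_measure. (\<lambda>n. (u x - f n x)\<^sup>2) \<longlonglongrightarrow> 0"
    proof (rule AE_I2)
      fix x assume "x \<in> space sg_measure"
      hence "(\<lambda>n. (u x - f n x)\<^sup>2) \<longlonglongrightarrow> (u x - u x)\<^sup>2" by (intro tendsto_intros lim) simp
      thus "(\<lambda>n. (u x - f n x)\<^sup>2) \<longlonglongrightarrow> 0" by simp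
    qed
    show "AE x in sg_measure. norm ((u x - f n x)\<^sup>2) \<le> b x" for n
      using bd by (intro AE_I2) simp
  qed (use assms(3) in measurable)
  thus ?thesis by (simp add: L2_norm2_def)
qed

lemma indicator_L2: "A \<in> sets sg_measure \<Longrightarrow> indicator A \<in> L2 sg_measure"
  unfolding L2_def
  by (auto intro!: sg.integrable_const_bound[where B=1] AE_I2 simp: indicator_def power2_eq_square)

text \<open>The functions max 0 (1 - n * distance to C) decrease to the indicator. The empty set is
  treated apart because \<open>infdist\<close> to it is 0 by convention, which would make them
  constantly 1.\<close>

lemma L2_approximable_indicator_closed:
  assumes C: "closed C" "C \<subseteq> gasket"
  shows "L2_approximable (indicator C)"
proof (cases "C = {}")
  case True
  thus ?thesis using L2_approximable_continuous[of "indicator C"] by (simp add: indicator_def)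
next
  case False
  define f where "f n x = max 0 (1 - real n * infdist x C)" for n x
  have fc: "continuous_on gasket (f n)" for n
    unfolding f_def by (intro continuous_on_max continuous_intros)
  have Cm: "C \<in> sets sg_measure" using C by (simp add: in_sets_sg_measure)
  show ?thesis
  proof (rule L2_approximable_limit[OF L2_approximable_continuous[OF fc] indicator_L2[OF Cm]])
    show "(\<lambda>n. L2_norm2 sg_measure (\<lambda>x. indicator C x - f n x)) \<longlonglongrightarrow> 0"
    proof (rule L2_norm2_dominated[OF indicator_L2[OF Cm] continuous_L2[OF fc], of "\<lambda>_. 1"])
      fix x :: "real^2"
      show "(\<lambda>n. f n x) \<longlonglongrightarrow> indicator C x"
      proof (cases "x \<in> C")
        case True
        thus ?thesis by (simp add: f_def)
      next
        case x: False
        hence pos: "0 < infdist x C"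
          using in_closed_iff_infdist_zero[OF C(1) False] infdist_nonneg[of x C] by (auto simp: order_less_le)
        obtain m where m: "1 < real m * infdist x C" using reals_Archimedean3[OF pos] by blast
        have "f n x = indicator C x" if "n \<ge> m" for n
        proof -
          have "real m * infdist x C \<le> real n * infdist x C" using that pos by (intro mult_right_mono) auto
          thus ?thesis using m x by (simp add: f_def)
        qed
        thus ?thesis by (intro tendsto_eventually) (auto simp: eventually_sequentially)
      qed
      fix n
      have "0 \<le> real n * infdist x C" by (simp add: infdist_nonneg)
      hence "\<bar>indicator C x - f n x\<bar> \<le> 1" by (auto simp: f_def indicator_def abs_le_iff)
      thus "(indicator C x - f n x)\<^sup>2 \<le> 1" by (simp add: abs_square_le_1)
    qed simp
  qed
qed

lemma L2_approximable_scale: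
  assumes "L2_approximable u"
  shows "L2_approximable (\<lambda>x. c * u x)"
  unfolding L2_approximable_def
proof (intro conjI allI impI)
  have u: "u \<in> L2 sg_measure" using assms by (simp add: L2_approximable_def)
  thus "(\<lambda>x. c * u x) \<in> L2 sg_measure" by (rule L2_scale)
  fix e :: real assume "0 < e"
  \<comment> \<open>Adding 1 keeps the denominator positive for c = 0 and the final inequality
    strict.\<close>
  hence e: "0 < e / (c\<^sup>2 + 1)" by (intro divide_pos_pos add_nonneg_pos) auto
  obtain g where g: "continuous_on gasket g" "L2_norm2 sg_measure (\<lambda>x. u x - g x) < e / (c\<^sup>2 + 1)"
    using assms e unfolding L2_approximable_def by blast
  have "L2_norm2 sg_measure (\<lambda>x. c * u x - c * g x) = c\<^sup>2 * L2_norm2 sg_measure (\<lambda>x. u x - g x)"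
    unfolding L2_norm2_def right_diff_distrib[symmetric] power_mult_distrib by simp
  also have "\<dots> \<le> c\<^sup>2 * (e / (c\<^sup>2 + 1))" using g by (intro mult_left_mono) auto
  also have "\<dots> < e"
  proof -
    have "0 < c\<^sup>2 + 1" by (intro add_nonneg_pos) auto
    thus ?thesis using \<open>0 < e\<close> by (simp add: field_simps)
  qed
  finally show "\<exists>g. continuous_on gasket g \<and> L2_norm2 sg_measure (\<lambda>x. c * u x - g x) < e"
    using continuous_on_mult_left[OF g(1)] by blast
qed

lemma L2_approximable_sum:
  "finite I \<Longrightarrow> (\<And>i. i \<in> I \<Longrightarrow> L2_approximable (f i)) \<Longrightarrow> L2_approximable (\<lambda>x. \<Sum>i\<in>I. f i x)"
proof (induction I rule: finite_induct)
  case empty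
  show ?case using L2_approximable_continuous[of "\<lambda>_. 0"] by simp
qed (auto intro: L2_approximable_add)

text \<open>Closed sets are stable under intersection, so a Dynkin induction over complements and
  disjoint unions reaches all measurable sets; a countable union is the dominated limit of its
  finite parts.\<close>

lemma L2_approximable_indicator:
  assumes "A \<in> sets sg_measure"
  shows "L2_approximable (indicator A)"
proof -
  let ?E = "{C. closed C \<and> C \<subseteq> gasket}"
  have sets: "sets sg_measure = sigma_sets gasket ?E" by (rule sets_sg_measure_closed)
  have stable: "Int_stable ?E" by (auto simp: Int_stable_def)
  have "A \<in> sigma_sets gasket ?E" using assms sets by simp
  have closed: "?E \<subseteq> Pow gasket" by auto
  from stable closed \<open>A \<in> sigma_sets gasket ?E\<close> show ?thesis
  proof (induction A rule: sigma_sets_induct_disjoint)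
    case (basic C)
    thus ?case by (intro L2_approximable_indicator_closed) auto
  next
    case empty
    show ?case by (rule L2_approximable_indicator_closed) auto
  next
    case (compl A)
    have "L2_approximable (\<lambda>x. 1 + (-1) * indicator A x)"
      by (intro L2_approximable_add L2_approximable_scale compl L2_approximable_continuous continuous_on_const)
    thus ?case by (rule L2_approximable_cong) (auto simp: indicator_def)
  next
    case (union A)
    have Am: "A i \<in> sets sg_measure" for i using union(2) sets by auto
    show ?case
    proof (rule L2_approximable_limit[where f="\<lambda>n. indicator (\<Union>i<n. A i)"])
      fix n :: nat
      have "L2_approximable (\<lambda>x. \<Sum>i<n. indicator (A i) x)"
        using union(3) by (intro L2_approximable_sum) auto
      moreover have "(\<Sum>i<n. indicator (A i) x) = (indicator (\<Union>i<n. A i) x :: real)" for x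
        using union(1) by (intro indicator_UN_disjoint[symmetric]) (auto simp: disjoint_family_on_def)
      ultimately show "L2_approximable (indicator (\<Union>i<n. A i))"
        by (rule L2_approximable_cong)
    next
      show "indicator (\<Union>i. A i) \<in> L2 sg_measure" using Am by (intro indicator_L2) auto
      show "(\<lambda>n. L2_norm2 sg_measure (\<lambda>x. indicator (\<Union>i. A i) x - indicator (\<Union>i<n. A i) x)) \<longlonglongrightarrow> 0"
      proof (rule L2_norm2_dominated[of _ _ "\<lambda>_. 1"])
        show "(\<lambda>n. indicator (\<Union>i<n. A i) x) \<longlonglongrightarrow> (indicator (\<Union>i. A i) x :: real)" for x
          by (rule LIMSEQ_indicator_UN)
        show "(indicator (\<Union>i. A i) x - indicator (\<Union>i<n. A i) x)\<^sup>2 \<le> (1 :: real)" for n x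
          by (simp add: indicator_def)
      qed (use Am in \<open>auto intro!: indicator_L2\<close>)
    qed
  qed
qed

text \<open>Simple functions with absolute value at most 2 |u| converge to u pointwise, so the
  squared errors are dominated by (3 u)^2 = 9 u^2.\<close>

lemma L2_approximable_all:
  assumes u: "u \<in> L2 sg_measure"
  shows "L2_approximable u"
proof -
  have "\<exists>F. (\<forall>i. simple_function sg_measure (F i)) \<and> (\<forall>x\<in>gasket. (\<lambda>i. F i x) \<longlonglongrightarrow> u x) \<and>
      (\<forall>i. \<forall>x\<in>gasket. \<bar>F i x\<bar> \<le> 2 * \<bar>u x\<bar>)"
    using borel_measurable_implies_sequence_metric[OF L2_measurable[OF u], of 0] by (simp add: dist_real_def)
  then obtain F where F: "\<And>i. simple_function sg_measure (F i)"
    "\<And>x. x \<in> gasket \<Longrightarrow> (\<lambda>i. F i x) \<longlonglongrightarrow> u x"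
    "\<And>i x. x \<in> gasket \<Longrightarrow> \<bar>F i x\<bar> \<le> 2 * \<bar>u x\<bar>"
    by blast
  have Fa: "L2_approximable (F i)" for i
  proof (rule L2_approximable_cong)
    show "L2_approximable (\<lambda>x. \<Sum>y\<in>F i ` gasket. y * indicator (F i -` {y} \<inter> gasket) x)"
    proof (intro L2_approximable_sum L2_approximable_scale L2_approximable_indicator)
      show "finite (F i ` gasket)" using simple_functionD(1)[OF F(1)[of i]] by simp
      show "F i -` {y} \<inter> gasket \<in> sets sg_measure" for y using simple_functionD(2)[OF F(1)[of i]] by simp
    qed
    fix x assume "x \<in> gasket"
    hence "F i x = (\<Sum>y\<in>F i ` gasket. indicator (F i -` {y} \<inter> gasket) x *\<^sub>R y)"
      by (intro simple_function_indicator_representation_banach[OF F(1)[of i], unfolded space_sg_measure])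
    also have "\<dots> = (\<Sum>y\<in>F i ` gasket. y * indicator (F i -` {y} \<inter> gasket) x)"
      by (intro sum.cong refl) simp
    finally show "(\<Sum>y\<in>F i ` gasket. y * indicator (F i -` {y} \<inter> gasket) x) = F i x" by (rule sym)
  qed
  show ?thesis
  proof (rule L2_approximable_limit[OF Fa u L2_norm2_dominated[OF u _ _ F(2)]])
    show "F n \<in> L2 sg_measure" for n using Fa[of n] by (simp add: L2_approximable_def)
    show "integrable sg_measure (\<lambda>x. 9 * (u x)\<^sup>2)" using L2_square_integrable[OF u] by simp
    fix n x assume "x \<in> gasket"
    hence "\<bar>u x - F n x\<bar> \<le> \<bar>3 * u x\<bar>" using F(3)[of x n] by linarith
    hence "(u x - F n x)\<^sup>2 \<le> (3 * u x)\<^sup>2" by (simp add: abs_le_square_iff)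
    thus "(u x - F n x)\<^sup>2 \<le> 9 * (u x)\<^sup>2" by (simp add: power_mult_distrib)
  qed
qed

lemma sg_domain_dense:
  assumes u: "u \<in> L2 sg_measure" and e: "0 < e"
  shows "\<exists>v\<in>sg_domain. L2_norm2 sg_measure (\<lambda>x. u x - v x) < e"
proof -
  have "0 < e / 4" "0 < sqrt (e / 8)" using e by auto
  then obtain g where g: "continuous_on gasket g" "L2_norm2 sg_measure (\<lambda>x. u x - g x) < e / 4"
    using L2_approximable_all[OF u] unfolding L2_approximable_def by blast
  obtain v where v: "v \<in> sg_domain" "\<And>x. x \<in> gasket \<Longrightarrow> \<bar>g x - v x\<bar> < sqrt (e / 8)"
    using uniform_approximation[OF g(1) \<open>0 < sqrt (e / 8)\<close>] by blast
  have gv: "(\<lambda>x. g x - v x) \<in> L2 sg_measure" by (rule L2_diff[OF continuous_L2[OF g(1)] sg_domain_L2[OF v(1)]])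
  have "L2_norm2 sg_measure (\<lambda>x. g x - v x) \<le> (sqrt (e / 8))\<^sup>2"
    by (rule L2_norm2_sg_le[OF gv]) (use v(2) in \<open>auto intro!: AE_I2 less_imp_le\<close>)
  hence "L2_norm2 sg_measure (\<lambda>x. g x - v x) \<le> e / 8" using e by simp
  moreover have "(\<lambda>x. u x - v x) = (\<lambda>x. (u x - g x) + (g x - v x))" by simp
  \<comment> \<open>The two parts contribute less than 2 * e/4 and at most 2 * e/8, together less
    than 3 e / 4.\<close>
  ultimately have "L2_norm2 sg_measure (\<lambda>x. u x - v x) < e"
    using L2_norm2_add_le[OF L2_diff[OF u continuous_L2[OF g(1)]] gv] g(2) e by simp
  thus ?thesis using v(1) by blast
qed

lemma sg_form_symmetric: "symmetric_form sg_measure sg_domain sg_form"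
  unfolding symmetric_form_def
proof (intro conjI ballI allI impI)
  show "sg_domain \<subseteq> L2 sg_measure" using sg_domain_L2 by blast
  show "(\<lambda>x. 0) \<in> sg_domain"
    by (rule sg_domain_continuous[of _ 0]) (simp_all add: vertex_energy_def vertex_values_def cell_form_def)
qed (use sg_domain_ae_eq sg_domain_add sg_domain_scale sg_domain_dense sg_form_ae_eq sg_form_commute
      sg_form_add sg_form_scale sg_form_nonneg in auto)

theorem theorem1p1:
  shows "\<exists>(F :: (real^2 \<Rightarrow> real) set) (E :: (real^2 \<Rightarrow> real) \<Rightarrow> (real^2 \<Rightarrow> real) \<Rightarrow> real).
           dirichlet_form sg_measure F E \<and>
           regular_form sg_measure F E \<and>
           strongly_local sg_measure F E \<and>
           self_similar F E \<and>
           F = {u \<in> L2 sg_measure. sup_energy u < \<infinity>} \<and>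
           (\<exists>c>0. \<exists>C>0. \<forall>u\<in>F.
              ennreal c * sup_energy u \<le> ennreal (E u u) \<and>
              ennreal (E u u) \<le> ennreal C * sup_energy u)"
proof (intro exI[of _ sg_domain] exI[of _ sg_form] conjI)
  show "dirichlet_form sg_measure sg_domain sg_form"
    unfolding dirichlet_form_def using sg_form_symmetric sg_form_closed sg_form_markovian by blast
  have "\<forall>u\<in>sg_domain. ennreal (1/1452) * sup_energy u \<le> ennreal (sg_form u u) \<and>
      ennreal (sg_form u u) \<le> ennreal 144 * sup_energy u"
  proof (intro conjI ballI)
    fix u assume u: "u \<in> sg_domain"
    have "ennreal (1/1452) * sup_energy u \<le> ennreal (1/1452) * ennreal (1452 * sg_form u u)"
      by (intro mult_left_mono sg_form_comparable(1)[OF u]) auto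
    also have "\<dots> = ennreal (1/1452 * (1452 * sg_form u u))" by (rule ennreal_mult'[symmetric]) simp
    finally show "ennreal (1/1452) * sup_energy u \<le> ennreal (sg_form u u)" by simp
    show "ennreal (sg_form u u) \<le> ennreal 144 * sup_energy u" by (rule sg_form_comparable(2)[OF u])
  qed
  thus "\<exists>c>0. \<exists>C>0. \<forall>u\<in>sg_domain.
      ennreal c * sup_energy u \<le> ennreal (sg_form u u) \<and> ennreal (sg_form u u) \<le> ennreal C * sup_energy u"
    by (rule_tac exI[of _ "1/1452"], intro conjI) (simp, rule exI[of _ 144], simp)
qed (rule sg_form_regular sg_form_strongly_local sg_form_self_similar sg_domain_def)+

end
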